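(* Consider the two-stage stochastic program $\min_{z\in\mathcal Z}\mathbb E[c(z,Y)]$ with $c(z,y):=p(z)+V(z,y)$ and $$V(z,y):=\min_{v\in\mathbb R^{d_v}_+}\{c_v^{\mathrm T}v: Wv=h(y)-T(y,z)\}.$$ Suppose that: (A) $\mathcal Z$ is nonempty and compact, the matrix $W$ has full row rank, the set $\Lambda:=\{\lambda:\lambda^{\mathrm T}W\le c_v^{\mathrm T}\}$ is nonempty, and $V(z,y)<+\infty$ for each $(z,y)\in\mathcal Z\times\mathcal Y$. (B) $h$ and $T(\cdot,z)$ are Lipschitz continuous on $\mathcal Y$ for each $z\in\mathcal Z$ with Lipschitz constants $L_h$ and $L_{T,y}(z)$; $p$ and $T(y,\cdot)$ are Lipschitz continuous on $\mathcal Z$ for each $y\in\mathcal Y$ with Lipschitz constants $L_p$ and $L_{T,z}(y)$; and $\sup_{z\in\mathcal Z}L_{T,y}(z)<+\infty$, $\sup_{y\in\mathcal Y}L_{T,z}(y)<+\infty$. (C) The support $\mathcal X$ of $X$ is compact, $f^*$ and $Q^*$ are continuous on $\mathcal X$, and $\mathbb E\bigl[\sup_{(z,x)\in\mathcal Z\times\mathcal X}\|h(f^*(x)+Q^*(x)\varepsilon)-T(f^*(x)+Q^*(x)\varepsilon,z)\|\bigr]<+\infty$. (D) $\mathbb E\bigl[\sup_{z\in\mathcal Z}\|h(Y)-T(Y,z)\|^2\bigr]<+\infty$. Moreover, with $\operatorname{vert}(\Lambda)$ the (finite) set of extreme points of $\Lambda$ and $\mathcal V(y,\lambda,z):=\lambda^{\mathrm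 T}(h(y)-T(y,z))$, the random variable $\mathcal V(f^*(x)+Q^*(x)\varepsilon,\lambda,z)-\mathbb E_{\bar\varepsilon\sim P_\varepsilon}[\mathcal V(f^*(x)+Q^*(x)\bar\varepsilon,\lambda,z)]$ is sub-Gaussian with variance proxy $\sigma_c^2(x)$ for each $\lambda\in\operatorname{vert}(\Lambda)$, $z\in\mathcal Z$ and a.e. $x\in\mathcal X$. (E) The errors $\{\varepsilon^i\}$ are i.i.d. Then all of the following hold. (i) For each $z\in\mathcal Z$ there is a constant $L(z)$ with $|c(z,\bar y)-c(z,y)|\le L(z)\|\bar y-y\|$ for all $y,\bar y\in\mathcal Y$, and $\sup_{z\in\mathcal Z}L(z)<+\infty$. (ii) For a.e. $x\in\mathcal X$, $\sup_{z\in\mathcal Z}|g_n^*(z;x)-g(z;x)|\xrightarrow{p}0$. (iii) For every $q\in[1,+\infty]$, $\bigl\|\sup_{z\in\mathcal Z}|g_n^*(z;X)-g(z;X)|\bigr\|_{L^q}\xrightarrow{p}0$. (iv) For any $\kappa>0$ and a.e. $x\in\mathcal X$ there exist positive constants $K(\kappa,x)$ and $\beta(\kappa,x)$ such that $\mathbb P\{\sup_{z\in\mathcal Z}|g_n^*(z;x)-g(z;x)|>\kappa\}\le K(\kappa,x)\exp(-n\beta(\kappa,x))$ for all $n\in\mathbb N$. (v) For a.e. $x\in\mathcal X$, $\sqrt n\,(g_n^*(\cdot;x)-g(\cdot;x))\xrightarrow{d}V_\infty(\cdot;x)$ for some random element $V_\infty(\cdot;x)$ of $\mathcal C(\mathcal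 Z)$, the Banach space of real-valued continuous functions on $\mathcal Z$ with the supremum norm (with $g_n^*(\cdot;x),g(\cdot;x)$ being (random) elements of $\mathcal C(\mathcal Z)$).
   Context: Setting. $X$ is a random vector of covariates with distribution $P_X$ and support $\mathcal X\subseteq\mathbb R^{d_x}$; $Y$ is a random vector with (closed) support $\mathcal Y\subseteq\mathbb R^{d_y}$, which is assumed nonempty and convex; $\mathcal Z\subset\mathbb R^{d_z}$. It is assumed that $Y=f^*(X)+Q^*(X)\varepsilon$, where $f^*(x)=\mathbb E[Y\mid X=x]$, $Q^*(\bar x)\in\mathbb R^{d_y\times d_y}$ is positive definite for all $\bar x\in\mathcal X$, and $\varepsilon$ is a zero-mean random vector independent of $X$ with distribution $P_\varepsilon$. Here $p$ is real-valued, $h$ and $T$ are vector-valued, and $W$, $c_v$ are a fixed matrix and vector, all of commensurate dimensions. $g(z;x):=\mathbb E[c(z,f^*(x)+Q^*(x)\varepsilon)]$ (expectation over $\varepsilon\sim P_\varepsilon$) and $g_n^*(z;x):=\frac1n\sum_{i=1}^n c(z,f^*(x)+Q^*(x)\varepsilon^i)$, where $\varepsilon^i$, $i=1,\dots,n$, are the realizations of the error $\varepsilon$ in $n$ joint observations $(y^i,x^i)$ of $(Y,X)$, i.e. $\varepsilon^i=[Q^*(x^i)]^{-1}(y^i-f^*(x^i))$. The standing assumptions of the paper are that $\mathbb E[|c(z,f^*(x)+Q^*(x)\varepsilon)|]<+\infty$ for each $z\in\mathcal Z$ and a.e. $x\in\mathcal X$, and $g(\cdot;x)$ is lower semicontinuous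 on $\mathcal Z$ for a.e. $x\in\mathcal X$. Conventions: $\|\cdot\|$ is the Euclidean norm or its induced matrix norm; "a.e. $x$" is with respect to $P_X$; $\mathbb P$, $\xrightarrow{p}$, $\xrightarrow{d}$ refer to the measure generating the data; all functions and sets are assumed measurable. A random variable (or vector) $U$ is sub-Gaussian with variance proxy $\sigma^2$ if $\mathbb E[U]=0$ and $\mathbb E[\exp(s\,u^{\mathrm T}U)]\le\exp(\sigma^2s^2/2)$ for all $s\in\mathbb R$ and $\|u\|=1$. For $q\in[1,+\infty]$ and measurable $F$ on $\mathcal X$, $\|F(X)\|_{L^q}:=(\int_{\mathcal X}\|F(x)\|^q\,dP_X(x))^{1/q}$ ($P_X$-essential supremum if $q=+\infty$), with the data held fixed when $F$ depends on the data. *)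

theory Defs
  imports "HOL-Probability.Probability"
begin

section \<open>Second-stage problem\<close>

text \<open>
  The minimum is taken as an infimum in the extended reals: it is \<open>\<infinity>\<close> exactly when the
  second-stage problem is infeasible, and \<open>-\<infinity>\<close> exactly when it is unbounded.  If it is finite
  it is attained, as is always the case for a linear program.  It is finite at every feasible
  \<open>(z, y)\<close> if \<open>dual_feasible W c\<^sub>v\<close> is nonempty, so \<open>real_of_ereal\<close> loses nothing there.
\<close>

definition recourse ::
    "real^'v^'m \<Rightarrow> real^'v \<Rightarrow> ('y \<Rightarrow> real^'m) \<Rightarrow> ('y \<Rightarrow> 'z \<Rightarrow> real^'m) \<Rightarrow> 'z \<Rightarrow> 'y \<Rightarrow> ereal"
  where "recourse W c\<^sub>v h T z y =
    (INF v \<in> {v. (\<forall>j. 0 \<le> v $ j) \<and> W *v v = h y - T y z}. ereal (c\<^sub>v \<bullet> v))"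

definition dual_feasible :: "real^'v^'m \<Rightarrow> real^'v \<Rightarrow> (real^'m) set"
  where "dual_feasible W c\<^sub>v = {lam. \<forall>j. (lam v* W) $ j \<le> c\<^sub>v $ j}"

text \<open>Symmetry is not demanded; symmetric positive definite matrices are a special case.\<close>

definition pos_definite :: "real^'n^'n \<Rightarrow> bool"
  where "pos_definite A \<longleftrightarrow> (\<forall>u. u \<noteq> 0 \<longrightarrow> 0 < u \<bullet> (A *v u))"

definition lower_semicontinuous_on :: "'a::topological_space set \<Rightarrow> ('a \<Rightarrow> real) \<Rightarrow> bool"
  where "lower_semicontinuous_on S \<phi> \<longleftrightarrow>
    (\<forall>z\<in>S. ereal (\<phi> z) \<le> Liminf (at z within S) (\<lambda>z'. ereal (\<phi> z')))"


section \<open>Probability\<close>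

definition support_of :: "'a::topological_space measure \<Rightarrow> 'a set"
  where "support_of \<mu> = {x. \<forall>U. open U \<and> x \<in> U \<longrightarrow> 0 < emeasure \<mu> U}"

text \<open>
  The exponential moments are nonnegative integrals, so that the bound includes their finiteness.
\<close>

definition sub_gaussian :: "'a measure \<Rightarrow> ('a \<Rightarrow> 'b::euclidean_space) \<Rightarrow> real \<Rightarrow> bool"
  where "sub_gaussian M U proxy \<longleftrightarrow>
    integrable M U \<and> (\<integral>\<omega>. U \<omega> \<partial>M) = 0 \<and>
    (\<forall>s u. norm u = 1 \<longrightarrow>
      (\<integral>\<^sup>+\<omega>. ennreal (exp (s * (u \<bullet> U \<omega>))) \<partial>M) \<le> ennreal (exp (proxy * s\<^sup>2 / 2)))"

text \<open>
  Suprema over uncountable sets occur below, which are measurable only up to null sets.  Probabilities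
  of events defined through them are outer probabilities; on measurable sets (and on sets measurable
  with respect to the completion) these are the usual probabilities.
\<close>

definition tends_to_0_in_prob :: "'a measure \<Rightarrow> (nat \<Rightarrow> 'a \<Rightarrow> ennreal) \<Rightarrow> bool"
  where "tends_to_0_in_prob M U \<longleftrightarrow>
    (\<forall>e>0. (\<lambda>n. outer_measure_of M {\<omega> \<in> space M. ennreal e < U n \<omega>}) \<longlonglongrightarrow> 0)"

definition ennreal_powr :: "ennreal \<Rightarrow> real \<Rightarrow> ennreal"
  where "ennreal_powr a r = (if a = \<infinity> then \<infinity> else ennreal (enn2real a powr r))"

definition Lq_norm :: "'a measure \<Rightarrow> ennreal \<Rightarrow> ('a \<Rightarrow> ennreal) \<Rightarrow> ennreal"
  where "Lq_norm \<mu> q F =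
    (if q = \<infinity> then esssup \<mu> F
     else ennreal_powr (\<integral>\<^sup>+x. ennreal_powr (F x) (enn2real q) \<partial>\<mu>) (1 / enn2real q))"


section \<open>Random elements of the space of continuous functions\<close>

text \<open>
  For compact \<open>Z\<close> this is the Banach space of continuous real functions on \<open>Z\<close> with the supremum
  distance; its elements are functions that are \<open>undefined\<close> outside \<open>Z\<close>.
\<close>

abbreviation C_space :: "'z::topological_space set \<Rightarrow> ('z \<Rightarrow> real) metric"
  where "C_space Z \<equiv> cfunspace (top_of_set Z) euclidean_metric"

definition borel_sigma :: "'b topology \<Rightarrow> 'b measure"
  where "borel_sigma T = sigma (topspace T) {U. openin T U}"

text \<open>
  \<open>random_element_version M T U U'\<close> says that \<open>U'\<close> is a Borel random element of \<open>T\<close> which is equal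
  to \<open>U\<close> almost surely.  Versions are needed since \<open>U\<close> may leave the carrier of \<open>T\<close> on a null set.
\<close>

definition random_element_version ::
    "'a measure \<Rightarrow> 'b topology \<Rightarrow> ('a \<Rightarrow> 'b) \<Rightarrow> ('a \<Rightarrow> 'b) \<Rightarrow> bool"
  where "random_element_version M T U U' \<longleftrightarrow>
    U' \<in> M \<rightarrow>\<^sub>M borel_sigma T \<and> (AE \<omega> in M. U \<omega> = U' \<omega>)"

definition tends_in_distribution ::
    "'a measure \<Rightarrow> 'b topology \<Rightarrow> (nat \<Rightarrow> 'a \<Rightarrow> 'b) \<Rightarrow> 'c measure \<Rightarrow> ('c \<Rightarrow> 'b) \<Rightarrow> bool"
  where "tends_in_distribution M T U N V \<longleftrightarrow>
    V \<in> N \<rightarrow>\<^sub>M borel_sigma T \<and>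
    (\<exists>U'. (\<forall>n. random_element_version M T (U n) (U' n)) \<and>
      (\<forall>\<phi>. continuous_map T euclideanreal \<phi> \<and> bounded (\<phi> ` topspace T) \<longrightarrow>
        (\<lambda>n. \<integral>\<omega>. \<phi> (U' n \<omega>) \<partial>M) \<longlonglongrightarrow> (\<integral>\<omega>. \<phi> (V \<omega>) \<partial>N)))"

end

(* For a feasible right-hand side u, linear programming duality gives the second-stage value as the
   maximum of lam . u over the finitely many vertices lam of the dual polyhedron.  Hence c is Lipschitz in
   y, and Lipschitz in z with a constant that does not depend on the error.  The exponential bound is
   Chernoff's inequality at the points of a finite net of Z, the sub-Gaussian hypothesis at the vertices
   providing the exponential moments; the bound uniform in x adds a net of the support of X, on which the
   integrand is equicontinuous up to the factor 1 + |e|.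

   For the functional central limit theorem, Hoeffding's lemma makes the increments of the empirical
   process sub-Gaussian with respect to the Euclidean distance, so that chaining along lattice nets confines
   all processes to one compact set of C(Z) with high probability.  The limit is built on a countable dense
   set as a triangular combination of independent normal variables, with coefficients from Gram-Schmidt
   orthogonalization in L2, and extended by continuity, the same chaining bound applying to it.  Given
   tightness it is enough to test convergence on trigonometric polynomials of finitely many coordinates,
   where the one-dimensional central limit theorem applies. *)

theory Submission
  imports Defs
begin

section \<open>Linear programming duality\<close>

text \<open>Two families of null sets stand in the way of statements for almost every x. Membership
  of \<open>f x + Q x *v e\<close> in the support of Y is known only for almost every pair (x, e),
  and the sub-Gaussian bound only off a null set of x that depends on z. The first is removed by
  continuity of f and Q and closedness of the support: one set S of errors, of probability one,
  serves all x at once. The second is removed by asking for the bound only on a countable dense set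
  of z; the Lipschitz property in z does the rest. Statements (iv) and (v) then hold on a set GG of
  full measure, while (ii) and (iii) come from one event on which the deviation is small for all x
  in the compact support, so that every exponent q is covered at once. Up to a constant the cost is
  a maximum of finitely many linear functions of the right-hand side; of their moment bounds only
  the finiteness of its exponential moment is retained. The functional limit theorem uses this only
  for square integrability, because differences in z are bounded random variables.\<close>

lemma dual_feasible_rows:
  "lam \<in> dual_feasible W c \<longleftrightarrow> (\<forall>j. (lam v* W) $ j \<le> c $ j)"
  by (simp add: dual_feasible_def)

lemma full_row_rank_vector_matrix_mult_eq_0:
  fixes W :: "real^'v^'m"
  assumes "rank W = CARD('m)" "lam v* W = 0"
  shows "lam = 0"
proof -
  obtain x where "W *v x = lam"
    using assms(1) by (metis full_rank_surjective surjD)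
  then have "lam \<bullet> lam = 0"
    using assms(2) dot_lmul_matrix[of lam W x] by simp
  then show ?thesis by simp
qed

text \<open>A simplex-type walk, by induction on the number of slack constraints. A feasible point
  that is not extreme lies inside a segment of the polyhedron; moving along its line keeps the tight
  constraints tight, and moving in a direction that does not lower the objective until the next
  constraint becomes tight reduces the number of slack ones. The objective has the form
  \<open>W *v v\<close> with v \<ge> 0, so such a direction can be chosen to meet a
  constraint.\<close>

lemma dual_feasible_le_extreme_point:
  fixes W :: "real^'v^'m"
  assumes rank: "rank W = CARD('m)" and v: "\<And>j. 0 \<le> v $ j" and lam: "lam \<in> dual_feasible W c"
  shows "\<exists>mu. mu extreme_point_of dual_feasible W c \<and> lam \<bullet> (W *v v) \<le> mu \<bullet> (W *v v)"
  using lam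
proof (induction "card {j. (lam v* W) $ j < c $ j}" arbitrary: lam rule: less_induct)
  case less
  show ?case
  proof (cases "lam extreme_point_of dual_feasible W c")
    case False
    then obtain a b where ab: "a \<in> dual_feasible W c" "b \<in> dual_feasible W c" "lam \<in> open_segment a b"
      using less.prems unfolding extreme_point_of_def by blast
    then obtain t where t: "0 < t" "t < 1" "lam = (1 - t) *\<^sub>R a + t *\<^sub>R b" and "a \<noteq> b"
      by (auto simp: in_segment)
    \<comment> \<open>The slack at lam is a convex combination of the nonnegative slacks at a and b
      with positive weights, so if it is 0 both of them are.\<close>
    have tight: "((b - a) v* W) $ j = 0" if "(lam v* W) $ j = c $ j" for j
    proof -
      have "(1 - t) * (c $ j - (a v* W) $ j) + t * (c $ j - (b v* W) $ j) = 0"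
        using that unfolding t(3)
        by (simp add: vector_matrix_left_distrib scaleR_vector_matrix_assoc algebra_simps)
      moreover have "0 \<le> (1 - t) * (c $ j - (a v* W) $ j)" "0 \<le> t * (c $ j - (b v* W) $ j)"
        using t ab by (auto simp: dual_feasible_rows)
      ultimately have "(1 - t) * (c $ j - (a v* W) $ j) = 0" "t * (c $ j - (b v* W) $ j) = 0"
        by linarith+
      then have "(a v* W) $ j = (b v* W) $ j" using t(1,2) by simp
      then show ?thesis
        by (simp add: vector_matrix_mult_def left_diff_distrib sum_subtractf right_diff_distrib)
    qed
    have *: "x \<bullet> (W *v v) = (\<Sum>j\<in>UNIV. (x v* W) $ j * v $ j)" for x
      by (subst dot_lmul_matrix[symmetric]) (simp add: inner_vec_def)
    have neg: "((- x) v* W) $ j = - ((x v* W) $ j)" for x j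
      by (simp add: vector_matrix_mult_def sum_negf)
    obtain w where w: "0 \<le> w \<bullet> (W *v v)" "\<exists>j. 0 < (w v* W) $ j"
      and w0: "\<And>j. (lam v* W) $ j = c $ j \<Longrightarrow> (w v* W) $ j = 0"
    proof -
      define w where "w = (if 0 \<le> (b - a) \<bullet> (W *v v) then b - a else - (b - a))"
      have w: "0 \<le> w \<bullet> (W *v v)" "w \<noteq> 0"
        using \<open>a \<noteq> b\<close> by (auto simp: w_def inner_diff_left)
      have w0: "(w v* W) $ j = 0" if "(lam v* W) $ j = c $ j" for j
        unfolding w_def using tight[OF that] neg[of "b - a" j] by auto
      show ?thesis
      proof (cases "\<exists>j. 0 < (w v* W) $ j")
        case True
        with w(1) w0 that show ?thesis by blast
      next
        case False
        \<comment> \<open>If no component of w W is positive, the objective is constant along w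
          because v \<ge> 0. Then -w is as good a direction, and it does meet a constraint, as full
          row rank excludes w W = 0.\<close>
        then have "w \<bullet> (W *v v) \<le> 0"
          unfolding * using v by (intro sum_nonpos mult_nonpos_nonneg) (auto simp: not_less)
        then have eq: "w \<bullet> (W *v v) = 0" using w(1) by simp
        have "w v* W \<noteq> 0"
          using full_row_rank_vector_matrix_mult_eq_0[OF rank] w(2) by blast
        then obtain j where "(w v* W) $ j \<noteq> 0" by (auto simp: vec_eq_iff)
        moreover have "(w v* W) $ j \<le> 0" using False by (simp add: not_less)
        ultimately have "(w v* W) $ j < 0" by (rule order_neq_le_trans)
        then have "0 < ((- w) v* W) $ j" unfolding neg by simp
        then show ?thesis
        proof (intro that[of "- w"] exI)
          show "0 \<le> - w \<bullet> (W *v v)" using eq by simp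
          show "0 < ((- w) v* W) $ j" by fact
          show "((- w) v* W) $ i = 0" if "(lam v* W) $ i = c $ i" for i
            unfolding neg w0[OF that] by simp
        qed
      qed
    qed
    \<comment> \<open>Ratio test: \<open>r j\<close> is the step length at which constraint j
      becomes tight, and the minimum over the increasing constraints is the longest step that stays
      feasible.\<close>
    define r where "r j = (c $ j - (lam v* W) $ j) / (w v* W) $ j" for j
    define J where "J = {j. 0 < (w v* W) $ j}"
    have J: "finite J" "J \<noteq> {}" using w(2) by (auto simp: J_def)
    define s where "s = Min (r ` J)"
    have "s \<in> r ` J" unfolding s_def using J by (intro Min_in) auto
    then obtain j0 where j0: "j0 \<in> J" "s = r j0" by blast
    have s_le: "s \<le> r j" if "j \<in> J" for j unfolding s_def using J that by simp
    have s_nonneg: "0 \<le> s"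
      using j0 less.prems by (auto simp: r_def J_def dual_feasible_rows)
    define lam' where "lam' = lam + s *\<^sub>R w"
    have lam': "(lam' v* W) $ j = (lam v* W) $ j + s * (w v* W) $ j" for j
      by (simp add: lam'_def vector_matrix_left_distrib scaleR_vector_matrix_assoc)
    have feas: "lam' \<in> dual_feasible W c"
      unfolding dual_feasible_rows
    proof
      fix j
      show "(lam' v* W) $ j \<le> c $ j"
      proof (cases "j \<in> J")
        case True
        then have "s * (w v* W) $ j \<le> c $ j - (lam v* W) $ j"
          using s_le[OF True] by (simp add: r_def J_def pos_le_divide_eq)
        then show ?thesis by (simp add: lam')
      next
        case False
        then have "s * (w v* W) $ j \<le> 0" using s_nonneg by (auto simp: J_def intro: mult_nonneg_nonpos)
        moreover have "(lam v* W) $ j \<le> c $ j" using less.prems by (simp add: dual_feasible_rows)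
        ultimately show ?thesis by (simp add: lam')
      qed
    qed
    have tight0: "(lam' v* W) $ j0 = c $ j0"
      using j0 by (simp add: lam' r_def J_def)
    \<comment> \<open>The constraint j0 was slack before the step, since w W vanishes at the tight
      ones; so the set of slack constraints shrinks strictly.\<close>
    have "j0 \<in> {j. (lam v* W) $ j < c $ j}"
      using j0 w0[of j0] less.prems by (auto simp: J_def dual_feasible_rows order_less_le)
    moreover have "{j. (lam' v* W) $ j < c $ j} \<subseteq> {j. (lam v* W) $ j < c $ j}"
      using w0 less.prems by (auto simp: lam' dual_feasible_rows order_less_le)
    moreover have "j0 \<notin> {j. (lam' v* W) $ j < c $ j}"
      using tight0 by simp
    ultimately have "{j. (lam' v* W) $ j < c $ j} \<subset> {j. (lam v* W) $ j < c $ j}"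
      by blast
    then have "card {j. (lam' v* W) $ j < c $ j} < card {j. (lam v* W) $ j < c $ j}"
      by (simp add: psubset_card_mono)
    from less.hyps[OF this feas] obtain mu where
      "mu extreme_point_of dual_feasible W c" "lam' \<bullet> (W *v v) \<le> mu \<bullet> (W *v v)" by blast
    moreover have "lam \<bullet> (W *v v) \<le> lam' \<bullet> (W *v v)"
      using s_nonneg w(1) by (simp add: lam'_def inner_add_left)
    ultimately show ?thesis by (meson order_trans)
  qed blast
qed

lemma finite_extreme_points_dual_feasible:
  fixes W :: "real^'v^'m"
  shows "finite {mu. mu extreme_point_of dual_feasible W c}"
proof (rule finite_polyhedron_extreme_points)
  have eq: "dual_feasible W c = \<Inter>((\<lambda>j. {x. column j W \<bullet> x \<le> c $ j}) ` UNIV)"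
    by (auto simp: dual_feasible_def vector_matrix_mult_def inner_vec_def column_def mult.commute)
  show "polyhedron (dual_feasible W c)"
    unfolding eq by (intro polyhedron_Inter) (auto intro: polyhedron_halfspace_le)
qed

text \<open>The right-hand sides for which the second-stage problem is feasible.\<close>

definition pos_cone :: "real^'v^'m \<Rightarrow> (real^'m) set"
  where "pos_cone W = (\<lambda>v. W *v v) ` {v. \<forall>j. 0 \<le> v $ j}"

text \<open>The support function of the vertex set of the dual polyhedron. As a maximum over
  finitely many vertices it is real for every u, also outside \<open>pos_cone W\<close>, where the
  second-stage value is \<infinity>.\<close>

definition vertex_max :: "real^'v^'m \<Rightarrow> real^'v \<Rightarrow> real^'m \<Rightarrow> real"
  where "vertex_max W c u = (MAX mu\<in>{mu. mu extreme_point_of dual_feasible W c}. mu \<bullet> u)"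

text \<open>A linear image of a closed cone can fail to be closed; a finitely generated convex cone
  cannot. The identification provides the closedness that strict separation needs.\<close>

lemma nonneg_orthant_image_eq_convex_cone_hull:
  fixes F :: "real^'v \<Rightarrow> 'a::euclidean_space"
  assumes "linear F"
  shows "F ` {v. \<forall>j. 0 \<le> v $ j} = convex_cone hull (range (\<lambda>j. F (axis j 1)))"
proof (rule antisym)
  show "F ` {v. \<forall>j. 0 \<le> v $ j} \<subseteq> convex_cone hull (range (\<lambda>j. F (axis j 1)))"
  proof clarify
    fix v :: "real^'v" assume v: "\<forall>j. 0 \<le> v $ j"
    have "v = (\<Sum>j\<in>UNIV. (v $ j) *\<^sub>R axis j 1)"
      using basis_expansion[of v] by (simp add: scalar_mult_eq_scaleR)
    then have "F v = F (\<Sum>j\<in>UNIV. (v $ j) *\<^sub>R axis j 1)"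
      by simp
    also have "\<dots> = (\<Sum>j\<in>UNIV. (v $ j) *\<^sub>R F (axis j 1))"
      by (simp add: linear_sum[OF assms] linear_cmul[OF assms])
    finally have "F v = (\<Sum>j\<in>UNIV. (v $ j) *\<^sub>R F (axis j 1))" .
    moreover have "(\<Sum>j\<in>A. (v $ j) *\<^sub>R F (axis j 1)) \<in> convex_cone hull (range (\<lambda>j. F (axis j 1)))"
      if "finite A" for A
      using that
      by (induction A)
        (use v in \<open>auto intro!: convex_cone_hull_add convex_cone_hull_mul hull_inc[OF rangeI]
            simp: convex_cone_hull_contains_0\<close>)
    ultimately show "F v \<in> convex_cone hull (range (\<lambda>j. F (axis j 1)))" by simp
  qed
next
  show "convex_cone hull (range (\<lambda>j. F (axis j 1))) \<subseteq> F ` {v. \<forall>j. 0 \<le> v $ j}"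
  proof (rule hull_minimal)
    show "range (\<lambda>j. F (axis j 1)) \<subseteq> F ` {v. \<forall>j. 0 \<le> v $ j}"
      by (auto simp: axis_def intro!: imageI)
    have "convex_cone {v :: real^'v. \<forall>j. 0 \<le> v $ j}"
    proof -
      have "(0 :: real^'v) \<in> {v. \<forall>j. 0 \<le> v $ j}" by simp
      then have "{v :: real^'v. \<forall>j. 0 \<le> v $ j} \<noteq> {}" by blast
      then show ?thesis
        by (auto simp: convex_cone_def convex_def conic_def)
    qed
    then show "convex_cone (F ` {v. \<forall>j. 0 \<le> v $ j})"
      using assms by (simp add: convex_cone_linear_image)
  qed
qed

lemma closed_nonneg_orthant_image:
  fixes F :: "real^'v \<Rightarrow> 'a::euclidean_space"
  assumes "linear F"
  shows "closed (F ` {v. \<forall>j. 0 \<le> v $ j})" "convex (F ` {v. \<forall>j. 0 \<le> v $ j})"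
  unfolding nonneg_orthant_image_eq_convex_cone_hull[OF assms]
  by (auto intro: closed_convex_cone_hull convex_convex_cone_hull)

lemma closed_pos_cone: "closed (pos_cone W)"
  unfolding pos_cone_def by (rule closed_nonneg_orthant_image) simp

lemma weak_duality:
  fixes W :: "real^'v^'m"
  assumes "\<And>j. 0 \<le> v $ j" "lam \<in> dual_feasible W c"
  shows "lam \<bullet> (W *v v) \<le> c \<bullet> v"
proof -
  have "(lam v* W) \<bullet> v \<le> c \<bullet> v"
    unfolding inner_vec_def
    using assms by (intro sum_mono) (auto simp: dual_feasible_def intro: mult_right_mono)
  then show ?thesis by (simp add: dot_lmul_matrix)
qed

text \<open>Separate \<open>(W v0, \<theta>)\<close> from the closed cone of all \<open>(W v, c \<bullet> v)\<close> with \<open>v \<ge> 0\<close>; the weight of the second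
  coordinate is positive since \<open>v0\<close> is feasible.\<close>

lemma strong_duality_approx:
  fixes W :: "real^'v^'m"
  assumes v0: "\<And>j. 0 \<le> v0 $ j" and dual: "dual_feasible W c \<noteq> {}"
    and low: "\<And>v. (\<forall>j. 0 \<le> v $ j) \<Longrightarrow> W *v v = W *v v0 \<Longrightarrow> \<theta> < c \<bullet> v"
  shows "\<exists>lam \<in> dual_feasible W c. \<theta> < lam \<bullet> (W *v v0)"
proof -
  let ?F = "\<lambda>v. (W *v v, c \<bullet> v)"
  let ?C = "?F ` {v. \<forall>j. 0 \<le> v $ j}"
  have lin: "linear ?F"
    by (auto simp: linear_iff matrix_vector_right_distrib matrix_vector_mult_scaleR inner_add_right)
  have mem: "(W *v v, c \<bullet> v) \<in> ?C" if "\<forall>j. 0 \<le> v $ j" for v using that by auto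
  have "(W *v v0, \<theta>) \<notin> ?C" using low by fastforce
  then obtain a b where ab: "a \<bullet> (W *v v0, \<theta>) < b" "\<And>x. x \<in> ?C \<Longrightarrow> b < a \<bullet> x"
    using separating_hyperplane_closed_point[of ?C "(W *v v0, \<theta>)"] closed_nonneg_orthant_image[OF lin]
    by blast
  obtain mu \<tau> where a: "a = (mu, \<tau>)" by (cases a)
  have "b < 0" using ab(2)[OF mem[of 0]] by (simp add: a)
  have nonneg: "0 \<le> mu \<bullet> (W *v v) + \<tau> * (c \<bullet> v)" if "\<forall>j. 0 \<le> v $ j" for v
  proof (rule ccontr)
    assume neg: "\<not> 0 \<le> mu \<bullet> (W *v v) + \<tau> * (c \<bullet> v)"
    \<comment> \<open>The factor k places the scaled point exactly on the separating hyperplane,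
      although all points of the cone lie strictly on one side of it.\<close>
    define k where "k = b / (mu \<bullet> (W *v v) + \<tau> * (c \<bullet> v))"
    have "0 \<le> k" using neg \<open>b < 0\<close> by (simp add: k_def divide_nonpos_neg)
    then have "b < a \<bullet> (W *v (k *\<^sub>R v), c \<bullet> (k *\<^sub>R v))"
      using that by (intro ab(2) mem) simp
    also have "\<dots> = k * (mu \<bullet> (W *v v) + \<tau> * (c \<bullet> v))"
      by (simp add: a algebra_simps matrix_vector_mult_scaleR)
    also have "\<dots> = b" using neg by (simp add: k_def)
    finally show False by simp
  qed
  have lt: "mu \<bullet> (W *v v0) + \<tau> * \<theta> < 0" using ab(1) \<open>b < 0\<close> by (simp add: a)
  have "0 < \<tau>"
  proof -
    have "\<theta> < c \<bullet> v0" using low v0 by blast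
    moreover have "0 < \<tau> * (c \<bullet> v0 - \<theta>)"
      using nonneg[of v0] lt v0 by (simp add: algebra_simps)
    ultimately show ?thesis by (simp add: zero_less_mult_iff)
  qed
  \<comment> \<open>Dividing by the positive weight and changing sign turns the normal vector into a
    dual point: nonnegativity on the images of the unit vectors is the list of dual
    constraints.\<close>
  define lam where "lam = - (1 / \<tau>) *\<^sub>R mu"
  have "lam \<in> dual_feasible W c"
    unfolding dual_feasible_rows
  proof
    fix j
    have "0 \<le> mu \<bullet> (W *v axis j 1) + \<tau> * (c \<bullet> axis j 1)" by (rule nonneg) (simp add: axis_def)
    then have "0 \<le> (mu v* W) $ j + \<tau> * c $ j"
      by (simp add: dot_lmul_matrix[symmetric] inner_axis)
    moreover have "(lam v* W) $ j = - (1/\<tau>) * (mu v* W) $ j"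
      unfolding lam_def scaleR_vector_matrix_assoc by simp
    ultimately show "(lam v* W) $ j \<le> c $ j"
      using \<open>0 < \<tau>\<close> by (simp add: pos_le_divide_eq minus_le_iff) (simp add: algebra_simps)
  qed
  moreover have "\<theta> < lam \<bullet> (W *v v0)"
    using lt \<open>0 < \<tau>\<close> by (simp add: lam_def field_simps)
  ultimately show ?thesis by blast
qed

section \<open>The second-stage value as a maximum over dual vertices\<close>

context
  fixes W :: "real^'v^'m" and c :: "real^'v"
  assumes rank: "rank W = CARD('m)" and dual: "dual_feasible W c \<noteq> {}"
begin

lemma extreme_points_nonempty: "{mu. mu extreme_point_of dual_feasible W c} \<noteq> {}"
proof -
  obtain lam where "lam \<in> dual_feasible W c" using dual by blast
  from dual_feasible_le_extreme_point[OF rank _ this, of 0] show ?thesis by auto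
qed

lemma vertex_max_ge:
  assumes "mu extreme_point_of dual_feasible W c"
  shows "mu \<bullet> u \<le> vertex_max W c u"
  unfolding vertex_max_def using assms finite_extreme_points_dual_feasible by (intro Max_ge) auto

lemma vertex_max_attained:
  obtains mu where "mu extreme_point_of dual_feasible W c" "vertex_max W c u = mu \<bullet> u"
proof -
  have "vertex_max W c u \<in> (\<lambda>mu. mu \<bullet> u) ` {mu. mu extreme_point_of dual_feasible W c}"
    unfolding vertex_max_def using finite_extreme_points_dual_feasible extreme_points_nonempty
    by (intro Max_in) auto
  then show ?thesis using that by blast
qed

lemma vertex_max_lipschitz:
  obtains B where "0 \<le> B" "\<And>u u'. \<bar>vertex_max W c u - vertex_max W c u'\<bar> \<le> B * norm (u - u')"
proof
  let ?E = "{mu. mu extreme_point_of dual_feasible W c}"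
  \<comment> \<open>The largest norm of a vertex would do; the sum dominates it and is nonnegative
    by its form.\<close>
  define B where "B = (\<Sum>mu\<in>?E. norm mu)"
  show "0 \<le> B" by (simp add: B_def sum_nonneg)
  have *: "vertex_max W c u - vertex_max W c u' \<le> B * norm (u - u')" for u u'
  proof -
    obtain mu where mu: "mu extreme_point_of dual_feasible W c" "vertex_max W c u = mu \<bullet> u"
      by (rule vertex_max_attained)
    have "vertex_max W c u - vertex_max W c u' \<le> mu \<bullet> (u - u')"
      using vertex_max_ge[OF mu(1), of u'] mu(2) by (simp add: inner_diff_right)
    also have "\<dots> \<le> norm mu * norm (u - u')" by (rule norm_cauchy_schwarz)
    also have "\<dots> \<le> B * norm (u - u')"
      unfolding B_def using mu(1) finite_extreme_points_dual_feasible
      by (intro mult_right_mono member_le_sum) auto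
    finally show ?thesis .
  qed
  show "\<bar>vertex_max W c u - vertex_max W c u'\<bar> \<le> B * norm (u - u')" for u u'
    using *[of u u'] *[of u' u] by (simp add: norm_minus_commute)
qed

text \<open>Weak duality at a maximizing vertex bounds the infimum from below. If the infimum were
  larger, a real number strictly in between would be exceeded by some dual feasible point, hence by
  some vertex.\<close>

lemma recourse_eq_vertex_max:
  assumes "h y - T y z \<in> pos_cone W"
  shows "recourse W c h T z y = ereal (vertex_max W c (h y - T y z))"
proof -
  obtain v0 where v0: "\<And>j. 0 \<le> v0 $ j" "h y - T y z = W *v v0"
    using assms by (auto simp: pos_cone_def)
  let ?S = "{v. (\<forall>j. 0 \<le> v $ j) \<and> W *v v = h y - T y z}"
  show ?thesis
  proof (rule antisym)
    show "ereal (vertex_max W c (h y - T y z)) \<le> recourse W c h T z y"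
      unfolding recourse_def
    proof (rule INF_greatest)
      fix v assume v: "v \<in> ?S"
      obtain mu where mu: "mu extreme_point_of dual_feasible W c"
        "vertex_max W c (h y - T y z) = mu \<bullet> (h y - T y z)"
        by (rule vertex_max_attained)
      then show "ereal (vertex_max W c (h y - T y z)) \<le> ereal (c \<bullet> v)"
        using weak_duality[of v mu W c] v by (auto simp: extreme_point_of_def)
    qed
    show "recourse W c h T z y \<le> ereal (vertex_max W c (h y - T y z))"
    proof (rule ccontr)
      assume "\<not> ?thesis"
      then obtain \<theta> where \<theta>: "ereal (vertex_max W c (h y - T y z)) < ereal \<theta>" "ereal \<theta> < recourse W c h T z y"
        by (metis ereal_dense2 not_le)
      have "\<theta> < c \<bullet> v" if "\<forall>j. 0 \<le> v $ j" "W *v v = W *v v0" for v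
      proof -
        have "recourse W c h T z y \<le> ereal (c \<bullet> v)"
          unfolding recourse_def using that v0 by (intro INF_lower) auto
        then show ?thesis using \<theta>(2) by (metis ereal_less(2) ereal_less_eq(3) less_le_trans linorder_not_le)
      qed
      from strong_duality_approx[OF v0(1) dual this] obtain lam
        where lam: "lam \<in> dual_feasible W c" "\<theta> < lam \<bullet> (W *v v0)" by auto
      from dual_feasible_le_extreme_point[OF rank v0(1) lam(1)] obtain mu
        where mu: "mu extreme_point_of dual_feasible W c" "lam \<bullet> (W *v v0) \<le> mu \<bullet> (W *v v0)" by auto
      have "mu \<bullet> (W *v v0) \<le> vertex_max W c (h y - T y z)"
        using vertex_max_ge[OF mu(1)] v0(2) by simp
      with mu lam \<theta>(1) show False by simp
    qed
  qed
qed

end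

lemma recourse_eq_infinity:
  assumes "h y - T y z \<notin> pos_cone W"
  shows "recourse W c h T z y = \<infinity>"
proof -
  have "{v. (\<forall>j. 0 \<le> v $ j) \<and> W *v v = h y - T y z} = {}"
    using assms by (force simp: pos_cone_def)
  then show ?thesis unfolding recourse_def by (simp only: image_empty Inf_empty top_ereal_def)
qed

lemma recourse_less_infinity_iff:
  fixes W :: "real^'v^'m"
  assumes "rank W = CARD('m)" "dual_feasible W c \<noteq> {}"
  shows "recourse W c h T z y < \<infinity> \<longleftrightarrow> h y - T y z \<in> pos_cone W"
  using recourse_eq_vertex_max[OF assms, of h y T z] recourse_eq_infinity[of h y T z W c]
  by (cases "h y - T y z \<in> pos_cone W") auto

lemma borel_measurable_recourse:
  fixes W :: "real^'v^'m"
  assumes "rank W = CARD('m)" "dual_feasible W c \<noteq> {}"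
    and [measurable]: "h \<in> borel_measurable borel" "(\<lambda>y. T y z) \<in> borel_measurable borel"
  shows "(\<lambda>y. real_of_ereal (recourse W c h T z y)) \<in> borel_measurable borel"
proof -
  \<comment> \<open>An infeasible y has value \<infinity>, which \<open>real_of_ereal\<close> sends
    to 0, so the function is pieced together along a closed cone.\<close>
  have eq: "(\<lambda>y. real_of_ereal (recourse W c h T z y))
     = (\<lambda>y. if h y - T y z \<in> pos_cone W then vertex_max W c (h y - T y z) else 0)"
    using recourse_eq_vertex_max[OF assms(1,2), of h _ T z] recourse_eq_infinity[of h _ T z W c]
    by (auto simp: fun_eq_iff)
  obtain B where B: "0 \<le> B" "\<And>u u'. \<bar>vertex_max W c u - vertex_max W c u'\<bar> \<le> B * norm (u - u')"
    using vertex_max_lipschitz[OF assms(1,2)] by blast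
  have "B-lipschitz_on UNIV (vertex_max W c)"
    using B by (intro lipschitz_onI) (auto simp: dist_norm)
  then have "continuous_on UNIV (vertex_max W c)"
    by (rule lipschitz_on_continuous_on)
  then have [measurable]: "vertex_max W c \<in> borel_measurable borel"
    by (rule borel_measurable_continuous_onI)
  have [measurable]: "pos_cone W \<in> sets borel" using closed_pos_cone by (rule borel_closed)
  show ?thesis unfolding eq by measurable
qed

section \<open>Weak convergence of random continuous functions\<close>

lemma mspace_C_space_iff:
  assumes "compact Z"
  shows "u \<in> mspace (C_space Z) \<longleftrightarrow> u \<in> extensional Z \<and> continuous_on Z u"
proof -
  have "compactin (top_of_set Z) (topspace (top_of_set Z))"
    using assms by (simp add: compactin_subtopology)
  from compactin_mspace_cfunspace[OF this, of euclidean_metric] show ?thesis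
    by (auto simp: extensional_def mtopology_of_def)
qed

lemma mdist_C_space_le_iff:
  assumes "compact Z" "Z \<noteq> {}" "u \<in> mspace (C_space Z)" "v \<in> mspace (C_space Z)"
  shows "mdist (C_space Z) u v \<le> a \<longleftrightarrow> (\<forall>z\<in>Z. \<bar>u z - v z\<bar> \<le> a)"
  using cfunspace_mdist_le[OF assms(3,4)] assms(2) by (simp add: dist_real_def)

text \<open>Open sets are described by pointwise non-strict bounds, in which the distance of the
  function space no longer occurs. Halving the radius passes from an open metric ball to such a
  bound.\<close>

lemma openin_C_space_iff:
  assumes "compact Z" "Z \<noteq> {}"
  shows "openin (mtopology_of (C_space Z)) U \<longleftrightarrow> U \<subseteq> mspace (C_space Z) \<and>
    (\<forall>u\<in>U. \<exists>r>0. \<forall>v\<in>mspace (C_space Z). (\<forall>z\<in>Z. \<bar>u z - v z\<bar> \<le> r) \<longrightarrow> v \<in> U)"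
    (is "?L \<longleftrightarrow> ?R")
proof -
  interpret C: Metric_space "mspace (C_space Z)" "mdist (C_space Z)"
    by (rule Metric_space_mspace_mdist)
  have L: "?L \<longleftrightarrow> U \<subseteq> mspace (C_space Z) \<and> (\<forall>u\<in>U. \<exists>r>0. C.mball u r \<subseteq> U)"
    by (simp add: mtopology_of_def C.openin_mtopology Ball_def del: mspace_cfunspace)
  show ?thesis
  proof
    assume ?L
    then have U: "U \<subseteq> mspace (C_space Z)" "\<And>u. u \<in> U \<Longrightarrow> \<exists>r>0. C.mball u r \<subseteq> U" by (auto simp: L)
    have "\<exists>r>0. \<forall>v\<in>mspace (C_space Z). (\<forall>z\<in>Z. \<bar>u z - v z\<bar> \<le> r) \<longrightarrow> v \<in> U" if u: "u \<in> U" for u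
    proof -
      obtain r where r: "r > 0" "C.mball u r \<subseteq> U" using U(2)[OF u] by blast
      have "v \<in> U" if v: "v \<in> mspace (C_space Z)" "\<forall>z\<in>Z. \<bar>u z - v z\<bar> \<le> r / 2" for v
      proof -
        have u': "u \<in> mspace (C_space Z)" using u U(1) by blast
        have "mdist (C_space Z) u v \<le> r / 2"
          using mdist_C_space_le_iff[OF assms u' v(1)] v(2) by blast
        then have "v \<in> C.mball u r" using r(1) u' v(1) by (simp add: C.in_mball del: mspace_cfunspace)
        then show ?thesis using r(2) by blast
      qed
      then show ?thesis using r(1) by (intro exI[of _ "r/2"]) (auto simp del: mspace_cfunspace)
    qed
    then show ?R using U(1) by blast
  next
    assume R: ?R
    have "\<exists>r>0. C.mball u r \<subseteq> U" if u: "u \<in> U" for u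
    proof -
      from R u obtain r where r: "r > 0"
        "\<And>v. v \<in> mspace (C_space Z) \<Longrightarrow> (\<forall>z\<in>Z. \<bar>u z - v z\<bar> \<le> r) \<Longrightarrow> v \<in> U" by blast
      have "v \<in> U" if "v \<in> C.mball u r" for v
      proof -
        have v: "u \<in> mspace (C_space Z)" "v \<in> mspace (C_space Z)" "mdist (C_space Z) u v < r"
          using that by (auto simp only: C.in_mball)
        then show ?thesis
          using mdist_C_space_le_iff[OF assms v(1,2), of r] r(2)[OF v(2)] by simp
      qed
      then show ?thesis using r(1) by blast
    qed
    then show ?L using R L by blast
  qed
qed

lemma topspace_C_space: "topspace (mtopology_of (C_space Z)) = mspace (C_space Z)"
  by (simp only: topspace_mtopology_of)

lemma space_borel_sigma [simp]: "space (borel_sigma T) = topspace T"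
  by (auto simp: borel_sigma_def space_measure_of_conv)

lemma sets_borel_sigma: "sets (borel_sigma T) = sigma_sets (topspace T) {U. openin T U}"
  unfolding borel_sigma_def by (rule sets_measure_of) (auto dest: openin_subset)

lemma measurable_continuous_map_borel_sigma:
  fixes \<phi> :: "'b \<Rightarrow> real"
  assumes "continuous_map T euclideanreal \<phi>"
  shows "\<phi> \<in> borel_measurable (borel_sigma T)"
proof (rule borel_measurableI)
  fix S :: "real set" assume "open S"
  then have "openin T {x \<in> topspace T. \<phi> x \<in> S}"
    using assms by (auto simp: continuous_map_def)
  moreover have "\<phi> -` S \<inter> space (borel_sigma T) = {x \<in> topspace T. \<phi> x \<in> S}" by auto
  ultimately show "\<phi> -` S \<inter> space (borel_sigma T) \<in> sets (borel_sigma T)"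
    by (simp add: sets_borel_sigma sigma_sets.Basic)
qed

text \<open>The centres come from the dense part D, where measurability or moment bounds are
  available, and not merely from Z.\<close>

lemma compact_finite_net_of_dense:
  fixes Z :: "'z::metric_space set"
  assumes Z: "compact Z" and D: "D \<subseteq> Z" "Z \<subseteq> closure D" and "0 < r"
  shows "\<exists>F. finite F \<and> F \<subseteq> D \<and> Z \<subseteq> (\<Union>d\<in>F. ball d r)"
proof -
  have "Z \<subseteq> (\<Union>d\<in>D. ball d r)"
  proof
    fix z assume "z \<in> Z"
    then obtain d where "d \<in> D" "dist d z < r"
      using D(2) \<open>0 < r\<close> by (meson closure_approachable subsetD)
    then show "z \<in> (\<Union>d\<in>D. ball d r)" by auto
  qed
  from compactE_image[OF Z _ this] show ?thesis by (metis open_ball)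
qed

lemma abs_diff_le_on_closure:
  fixes u v :: "'z::metric_space \<Rightarrow> real"
  assumes "continuous_on Z u" "continuous_on Z v" "D \<subseteq> Z" "Z \<subseteq> closure D"
    and le: "\<And>d. d \<in> D \<Longrightarrow> \<bar>u d - v d\<bar> \<le> a" and z: "z \<in> Z"
  shows "\<bar>u z - v z\<bar> \<le> a"
proof -
  obtain x where x: "\<And>n. x n \<in> D" "x \<longlonglongrightarrow> z"
    using z assms(4) closure_sequential by blast
  have "continuous_on Z (\<lambda>z. \<bar>u z - v z\<bar>)" using assms(1,2) by (intro continuous_intros)
  moreover have "\<forall>n. x n \<in> Z" using assms(3) x(1) by blast
  ultimately have "((\<lambda>z. \<bar>u z - v z\<bar>) \<circ> x) \<longlonglongrightarrow> \<bar>u z - v z\<bar>"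
    using x(2) z unfolding continuous_on_sequentially by blast
  then show ?thesis
    by (rule LIMSEQ_le_const2) (use le x(1) in auto)
qed

text \<open>An open set is a countable union of cylinder sets of small diameter: approximate values on a finite net, and a
  modulus of continuity on a countable dense set.\<close>

lemma measurable_C_space:
  fixes Z :: "'z::metric_space set"
  assumes Z: "compact Z" "Z \<noteq> {}" and D: "countable D" "D \<subseteq> Z" "Z \<subseteq> closure D"
    and U: "\<And>\<omega>. \<omega> \<in> space M \<Longrightarrow> U \<omega> \<in> mspace (C_space Z)"
    and coord: "\<And>d. d \<in> D \<Longrightarrow> (\<lambda>\<omega>. U \<omega> d) \<in> borel_measurable M"
  shows "U \<in> M \<rightarrow>\<^sub>M borel_sigma (mtopology_of (C_space Z))"
  unfolding borel_sigma_def
proof (rule measurable_measure_of)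
  show "{G. openin (mtopology_of (C_space Z)) G} \<subseteq> Pow (topspace (mtopology_of (C_space Z)))"
    using openin_subset by blast
  show "U \<in> space M \<rightarrow> topspace (mtopology_of (C_space Z))"
    using U unfolding topspace_C_space by blast
  fix G assume "G \<in> {G. openin (mtopology_of (C_space Z)) G}"
  then have Gsub: "G \<subseteq> mspace (C_space Z)" and
    G: "\<And>u. u \<in> G \<Longrightarrow> \<exists>r>0. \<forall>v\<in>mspace (C_space Z). (\<forall>z\<in>Z. \<bar>u z - v z\<bar> \<le> r) \<longrightarrow> v \<in> G"
    unfolding mem_Collect_eq openin_C_space_iff[OF Z] by blast+
  have "\<exists>F. \<forall>k::nat. finite (F k) \<and> F k \<subseteq> D \<and> Z \<subseteq> (\<Union>d\<in>F k. ball d (1 / (real k + 1)))"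
    by (intro choice allI compact_finite_net_of_dense Z D) auto
  then obtain F where F: "\<And>k::nat. finite (F k)" "\<And>k. F k \<subseteq> D"
    "\<And>k. Z \<subseteq> (\<Union>d\<in>F k. ball d (1 / (real k + 1)))" by blast
  define S where "S = (\<lambda>(k::nat, m::nat, q::'z \<Rightarrow> real). {u. (\<forall>z\<in>F k. \<bar>u z - q z\<bar> \<le> 1 / (real m + 1)) \<and>
    (\<forall>d\<in>D. \<forall>d'\<in>D. dist d d' < 1 / (real k + 1) \<longrightarrow> \<bar>u d - u d'\<bar> \<le> 1 / (real m + 1))})"
  \<comment> \<open>Prescribing rational values on a finite net keeps the index set countable, which
    the measurability of the union requires.\<close>
  define I where "I = (SIGMA k:UNIV. (UNIV :: nat set) \<times> PiE (F k) (\<lambda>_. \<rat> :: real set))"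
  define I' where "I' = {i \<in> I. S i \<inter> mspace (C_space Z) \<subseteq> G}"
  have "countable I" unfolding I_def
    by (intro countable_SIGMA countable_PiE F countable_rat countableI_type)
  then have cI: "countable I'" by (rule countable_subset[rotated]) (auto simp: I'_def)
  have meas: "{\<omega> \<in> space M. U \<omega> \<in> S i} \<in> sets M" for i
  proof -
    obtain k m q where i: "i = (k, m, q)" by (cases i)
    have [measurable]: "(\<lambda>\<omega>. U \<omega> d) \<in> borel_measurable M" if "d \<in> F k" for d
      using that F(2) coord by blast
    have cF: "countable (F k)" using F(1) by (simp add: countable_finite)
    have 1: "{\<omega> \<in> space M. \<forall>z\<in>F k. \<bar>U \<omega> z - q z\<bar> \<le> 1 / (real m + 1)} \<in> sets M"
      by (intro sets.sets_Collect_countable_All' cF) measurable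
    have 2: "{\<omega> \<in> space M. \<forall>d\<in>D. \<forall>d'\<in>D. dist d d' < 1 / (real k + 1) \<longrightarrow>
        \<bar>U \<omega> d - U \<omega> d'\<bar> \<le> 1 / (real m + 1)} \<in> sets M"
    proof (intro sets.sets_Collect_countable_All' D(1) sets.sets_Collect_imp)
      fix d d' assume [simp]: "d \<in> D" "d' \<in> D"
      have [measurable]: "(\<lambda>\<omega>. U \<omega> d) \<in> borel_measurable M" "(\<lambda>\<omega>. U \<omega> d') \<in> borel_measurable M"
        using coord by auto
      show "{\<omega> \<in> space M. \<bar>U \<omega> d - U \<omega> d'\<bar> \<le> 1 / (real m + 1)} \<in> sets M" by measurable
    qed simp
    show ?thesis unfolding i S_def using sets.sets_Collect_conj[OF 2 1] by simp
  qed
  have "U -` G \<inter> space M = (\<Union>i\<in>I'. {\<omega> \<in> space M. U \<omega> \<in> S i})"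
  proof (intro equalityI subsetI)
    fix \<omega> assume "\<omega> \<in> U -` G \<inter> space M"
    then have \<omega>: "U \<omega> \<in> G" "\<omega> \<in> space M" by auto
    define u where "u = U \<omega>"
    obtain r where r: "r > 0"
      "\<And>v. v \<in> mspace (C_space Z) \<Longrightarrow> (\<forall>z\<in>Z. \<bar>u z - v z\<bar> \<le> r) \<Longrightarrow> v \<in> G"
      using G[OF \<omega>(1)] unfolding u_def by blast
    have ucont: "continuous_on Z u" using U[OF \<omega>(2)] mspace_C_space_iff[OF Z(1)] unfolding u_def by blast
    \<comment> \<open>Four errors of size 1 / (m + 1) add up below: the modulus and the
      approximation by q, each once for u and once for v.\<close>
    obtain m :: nat where m: "4 / (real m + 1) < r"
    proof -
      obtain m where "4 / r < real m" using reals_Archimedean2 by blast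
      then show ?thesis using that[of m] r(1) by (simp add: field_simps)
    qed
    have "uniformly_continuous_on Z u" using ucont Z(1) by (rule compact_uniformly_continuous)
    then obtain \<delta> where \<delta>: "\<delta> > 0" "\<And>z z'. z \<in> Z \<Longrightarrow> z' \<in> Z \<Longrightarrow> dist z' z < \<delta> \<Longrightarrow> dist (u z') (u z) < 1 / (real m + 1)"
      unfolding uniformly_continuous_on_def by (metis add_pos_nonneg divide_pos_pos of_nat_0_le_iff
        zero_less_one add.commute)
    obtain k :: nat where k: "1 / (real k + 1) < \<delta>"
    proof -
      obtain k where "1 / \<delta> < real k" using reals_Archimedean2 by blast
      then show ?thesis using that[of k] \<delta>(1) by (simp add: field_simps)
    qed
    have "\<exists>q\<in>\<rat>. \<bar>u z - q\<bar> \<le> 1 / (real m + 1)" for z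
    proof -
      have "u z - 1 / (real m + 1) < u z" by simp
      from Rats_dense_in_real[OF this] obtain q where "q \<in> \<rat>" "u z - 1 / (real m + 1) < q" "q < u z"
        by blast
      then show ?thesis by (intro bexI[of _ q]) auto
    qed
    then obtain q where q: "\<And>z. q z \<in> \<rat>" "\<And>z. \<bar>u z - q z\<bar> \<le> 1 / (real m + 1)" by metis
    let ?q = "restrict q (F k)"
    have uS: "u \<in> S (k, m, ?q)"
      using q(2) \<delta>(2) D(2) k unfolding S_def
      by (auto simp: dist_real_def) (metis dist_commute less_eq_real_def order_less_trans subsetD abs_minus_commute)
    have "S (k, m, ?q) \<inter> mspace (C_space Z) \<subseteq> G"
    proof
      fix v assume "v \<in> S (k, m, ?q) \<inter> mspace (C_space Z)"
      then have v: "v \<in> S (k, m, ?q)" "v \<in> mspace (C_space Z)" by blast+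
      have vcont: "continuous_on Z v" using v(2) mspace_C_space_iff[OF Z(1)] by blast
      have "\<bar>u d - v d\<bar> \<le> 4 / (real m + 1)" if d: "d \<in> D" for d
      proof -
        obtain f where f: "f \<in> F k" "dist f d < 1 / (real k + 1)" using F(3)[of k] d D(2) by fastforce
        then have "f \<in> D" using F(2) by blast
        have "\<bar>u f - u d\<bar> \<le> 1 / (real m + 1)" "\<bar>v f - v d\<bar> \<le> 1 / (real m + 1)"
          "\<bar>u f - q f\<bar> \<le> 1 / (real m + 1)" "\<bar>v f - q f\<bar> \<le> 1 / (real m + 1)"
          using uS v(1) f d \<open>f \<in> D\<close> by (auto simp: S_def)
        then have "\<bar>u d - v d\<bar> \<le> 1 / (real m + 1) + 1 / (real m + 1) + 1 / (real m + 1) + 1 / (real m + 1)"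
          by linarith
        then show ?thesis by simp
      qed
      then have "\<bar>u z - v z\<bar> \<le> 4 / (real m + 1)" if "z \<in> Z" for z
        using abs_diff_le_on_closure[OF ucont vcont D(2,3) _ that] by blast
      then show "v \<in> G" using m by (intro r(2)[OF v(2)]) force
    qed
    then have "(k, m, ?q) \<in> I'" using q(1) by (auto simp: I'_def I_def simp del: mspace_cfunspace)
    then show "\<omega> \<in> (\<Union>i\<in>I'. {\<omega> \<in> space M. U \<omega> \<in> S i})" using uS \<omega>(2) unfolding u_def by blast
  next
    fix \<omega> assume "\<omega> \<in> (\<Union>i\<in>I'. {\<omega> \<in> space M. U \<omega> \<in> S i})"
    then show "\<omega> \<in> U -` G \<inter> space M" using U unfolding I'_def by blast
  qed
  also have "\<dots> \<in> sets M" using cI meas by (intro sets.countable_UN') auto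
  finally show "U -` G \<inter> space M \<in> sets M" .
qed

section \<open>Compact sets of equicontinuous functions\<close>

definition equicont_set :: "'z::metric_space set \<Rightarrow> real \<Rightarrow> (nat \<Rightarrow> real) \<Rightarrow> (nat \<Rightarrow> real) \<Rightarrow> ('z \<Rightarrow> real) set"
  where "equicont_set Z B \<delta> \<eta> = {u \<in> extensional Z. (\<forall>z\<in>Z. \<bar>u z\<bar> \<le> B) \<and>
    (\<forall>k. \<forall>z\<in>Z. \<forall>z'\<in>Z. dist z z' \<le> \<delta> k \<longrightarrow> \<bar>u z - u z'\<bar> \<le> \<eta> k)}"

text \<open>All conditions are non-strict and the values outside Z are fixed, so the set is a closed
  part of a product of compact intervals and singletons, and Tychonoff's theorem applies.
  Compactness refers to pointwise convergence; for moduli tending to 0 this is as good as uniform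
  convergence.\<close>

lemma compact_equicont_set: "compact (equicont_set Z B \<delta> \<eta>)"
proof -
  let ?S = "\<lambda>z. if z \<in> Z then {-B..B} else {undefined}"
  have "compactin (product_topology (\<lambda>_. euclideanreal) UNIV) (PiE UNIV ?S)"
    unfolding compactin_PiE by auto
  then have "compact (PiE UNIV ?S)"
    by (simp add: euclidean_product_topology compactin_euclidean_iff)
  moreover have "closed {u :: 'a \<Rightarrow> real. \<forall>k. \<forall>z\<in>Z. \<forall>z'\<in>Z. dist z z' \<le> \<delta> k \<longrightarrow> \<bar>u z - u z'\<bar> \<le> \<eta> k}"
    unfolding Ball_def
    by (intro closed_Collect_all closed_Collect_imp closed_Collect_le continuous_intros
        continuous_on_product_coordinates) (auto intro: open_Collect_const)
  moreover have "equicont_set Z B \<delta> \<eta> = PiE UNIV ?S \<inter>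
     {u. \<forall>k. \<forall>z\<in>Z. \<forall>z'\<in>Z. dist z z' \<le> \<delta> k \<longrightarrow> \<bar>u z - u z'\<bar> \<le> \<eta> k}"
    by (auto simp: equicont_set_def PiE_def Pi_def extensional_def abs_le_iff split: if_splits)
      (metis minus_le_iff, metis)?
  ultimately show ?thesis by (simp add: compact_Int_closed)
qed

lemma equicont_set_continuous_on:
  assumes "u \<in> equicont_set Z B \<delta> \<eta>" "\<And>k. 0 < \<delta> k" "\<eta> \<longlonglongrightarrow> 0"
  shows "continuous_on Z u"
  unfolding continuous_on_iff
proof (intro ballI allI impI)
  fix z and e :: real assume z: "z \<in> Z" and "0 < e"
  obtain k where "\<eta> k < e" using order_tendstoD(2)[OF assms(3) \<open>0 < e\<close>] by (auto dest: eventually_happens)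
  moreover have "\<bar>u z' - u z\<bar> \<le> \<eta> k" if "z' \<in> Z" "dist z' z < \<delta> k" for z'
    using assms(1) z that by (simp add: equicont_set_def)
  ultimately show "\<exists>d>0. \<forall>z'\<in>Z. dist z' z < d \<longrightarrow> dist (u z') (u z) < e"
    using assms(2)[of k] by (intro exI[of _ "\<delta> k"]) (auto simp: dist_real_def intro: le_less_trans)
qed

text \<open>On an equicontinuous set the values on a dense sequence determine the function and
  control it uniformly. So a test function on C(Z) becomes a continuous function of a sequence of
  reals, which can be approximated by functions of finitely many coordinates.\<close>

lemma equicont_set_test_function:
  fixes Z :: "'z::metric_space set"
  assumes Z: "compact Z" "Z \<noteq> {}" and d: "range (d :: nat \<Rightarrow> 'z) \<subseteq> Z" "Z \<subseteq> closure (range d)" and \<delta>: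
    "\<And>k. 0 < \<delta> k" and \<eta>: "\<eta> \<longlonglongrightarrow> 0"
    and \<phi>: "continuous_map (mtopology_of (C_space Z)) euclideanreal \<phi>"
  obtains \<psi> where "continuous_on ((\<lambda>u i. u (d i)) ` equicont_set Z B \<delta> \<eta>) \<psi>"
    "\<And>u. u \<in> equicont_set Z B \<delta> \<eta> \<Longrightarrow> \<psi> (\<lambda>i. u (d i)) = \<phi> u"
proof -
  let ?K = "equicont_set Z B \<delta> \<eta>"
  let ?\<rho> = "\<lambda>u i. u (d i) :: real"
  have inj: "inj_on ?\<rho> ?K"
  proof (rule inj_onI)
    fix u v assume uv: "u \<in> ?K" "v \<in> ?K" "?\<rho> u = ?\<rho> v"
    have "\<bar>u x - v x\<bar> \<le> 0" if "x \<in> range d" for x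
      using fun_cong[OF uv(3)] that by auto
    then have "\<bar>u z - v z\<bar> \<le> 0" if "z \<in> Z" for z
      using abs_diff_le_on_closure[OF equicont_set_continuous_on[OF uv(1) \<delta> \<eta>]
          equicont_set_continuous_on[OF uv(2) \<delta> \<eta>] d _ that] by blast
    then show "u = v" using uv(1,2) by (intro extensionalityI[of _ Z]) (auto simp: equicont_set_def)
  qed
  define \<psi> where "\<psi> = (\<lambda>x. \<phi> (inv_into ?K ?\<rho> x))"
  have \<psi>: "\<psi> (?\<rho> u) = \<phi> u" if "u \<in> ?K" for u
    unfolding \<psi>_def using inv_into_f_f[OF inj that] by simp
  have "continuous_on (?\<rho> ` ?K) \<psi>"
    unfolding continuous_on_topological
  proof (intro ballI allI impI)
    fix x and S :: "real set" assume "x \<in> ?\<rho> ` ?K" and S: "open S" "\<psi> x \<in> S"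
    then obtain u where u: "u \<in> ?K" and x: "x = ?\<rho> u" by blast
    have S: "open S" "\<phi> u \<in> S" using S \<psi>[OF u] by (auto simp: x)
    have K: "v \<in> mspace (C_space Z)" if "v \<in> ?K" for v
      unfolding mspace_C_space_iff[OF Z(1)]
      using equicont_set_continuous_on[OF that \<delta> \<eta>] that by (auto simp: equicont_set_def)
    have "openin (mtopology_of (C_space Z)) {v \<in> topspace (mtopology_of (C_space Z)). \<phi> v \<in> S}"
      using \<phi> S(1) by (auto simp: continuous_map_def)
    then obtain r where r: "r > 0"
      "\<And>v. v \<in> mspace (C_space Z) \<Longrightarrow> (\<forall>z\<in>Z. \<bar>u z - v z\<bar> \<le> r) \<Longrightarrow> \<phi> v \<in> S"
      unfolding openin_C_space_iff[OF Z] topspace_C_space using K[OF u] S(2) by blast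
    \<comment> \<open>With a modulus below r / 4 at scale \<open>\<delta> k\<close>, closeness r / 4
      on a finite net of that scale gives closeness 3r / 4 on all of Z.\<close>
    obtain k where k: "\<eta> k < r / 4"
      using order_tendstoD(2)[OF \<eta>, of "r/4"] r(1) by (auto dest: eventually_happens)
    obtain F where F: "finite F" "F \<subseteq> range d" "Z \<subseteq> (\<Union>y\<in>F. ball y (\<delta> k))"
      using compact_finite_net_of_dense[OF Z(1) d \<delta>, of k] by (elim exE conjE)
    obtain I where I: "finite I" "F = d ` I" using finite_subset_image[OF F(1,2)] by blast
    have "open {y :: nat \<Rightarrow> real. \<bar>y i - x i\<bar> < r / 4}" for i
      by (intro open_Collect_less continuous_intros continuous_on_product_coordinates)
    then have "open (\<Inter>i\<in>I. {y :: nat \<Rightarrow> real. \<bar>y i - x i\<bar> < r / 4})"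
      using I(1) by (intro open_INT) auto
    moreover have "x \<in> (\<Inter>i\<in>I. {y. \<bar>y i - x i\<bar> < r / 4})" using r(1) by simp
    moreover have "\<psi> y \<in> S" if y: "y \<in> ?\<rho> ` ?K" "y \<in> (\<Inter>i\<in>I. {y. \<bar>y i - x i\<bar> < r / 4})" for y
    proof -
      obtain v where v: "v \<in> ?K" "y = ?\<rho> v" using y(1) by blast
      have "\<phi> v \<in> S"
      proof (rule r(2)[OF K[OF v(1)]], rule)
        fix z assume z: "z \<in> Z"
        then obtain f where f: "f \<in> F" "dist f z < \<delta> k" using F(3) by auto
        have "f \<in> Z" using f(1) F(2) d(1) by blast
        then have "\<bar>u f - u z\<bar> \<le> \<eta> k" "\<bar>v f - v z\<bar> \<le> \<eta> k"
          using u v(1) f z by (auto simp: equicont_set_def)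
        moreover have "\<bar>v f - u f\<bar> < r / 4" using y(2) f(1) by (auto simp: I v x)
        ultimately show "\<bar>u z - v z\<bar> \<le> r" using k r(1) by linarith
      qed
      then show ?thesis using \<psi>[OF v(1)] v(2) by simp
    qed
    ultimately show "\<exists>A. open A \<and> x \<in> A \<and> (\<forall>y\<in>?\<rho> ` ?K. y \<in> A \<longrightarrow> \<psi> y \<in> S)" by blast
  qed
  then show ?thesis using that \<psi> by blast
qed

section \<open>Trigonometric polynomials of finitely many coordinates\<close>

inductive_set trig_poly :: "((nat \<Rightarrow> real) \<Rightarrow> real) set" where
  cos: "finite F \<Longrightarrow> (\<lambda>u. a * cos ((\<Sum>z\<in>F. t z * u z) + \<theta>)) \<in> trig_poly"
| add: "f \<in> trig_poly \<Longrightarrow> g \<in> trig_poly \<Longrightarrow> (\<lambda>u. f u + g u) \<in> trig_poly"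

lemma trig_poly_const: "(\<lambda>_. c) \<in> trig_poly"
  using trig_poly.cos[of "{}" c "\<lambda>_. 0" 0] by simp

text \<open>The product-to-sum formula; the free phase \<theta> replaces a separate sine.
  Frequencies are extended by 0 to the union of the two index sets.\<close>

lemma trig_poly_cos_mult_cos:
  assumes "finite F" "finite G"
  shows "(\<lambda>u. (a * cos ((\<Sum>z\<in>F. s z * u z) + \<theta>)) * (b * cos ((\<Sum>z\<in>G. t z * u z) + \<theta>'))) \<in> trig_poly"
proof -
  let ?s = "\<lambda>z. if z \<in> F then s z else 0" and ?t = "\<lambda>z. if z \<in> G then t z else 0"
  have F: "(\<Sum>z\<in>F. s z * u z) = (\<Sum>z\<in>F\<union>G. ?s z * u z)" for u :: "nat \<Rightarrow> real"
    using assms by (intro sum.mono_neutral_cong_left) auto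
  have G: "(\<Sum>z\<in>G. t z * u z) = (\<Sum>z\<in>F\<union>G. ?t z * u z)" for u :: "nat \<Rightarrow> real"
    using assms by (intro sum.mono_neutral_cong_left) auto
  have "(\<lambda>u. (a * b / 2) * cos ((\<Sum>z\<in>F\<union>G. (?s z - ?t z) * u z) + (\<theta> - \<theta>'))
       + (a * b / 2) * cos ((\<Sum>z\<in>F\<union>G. (?s z + ?t z) * u z) + (\<theta> + \<theta>'))) \<in> trig_poly"
    using assms by (intro trig_poly.intros) auto
  moreover have "(a * cos x) * (b * cos y) = (a * b / 2) * cos (x - y) + (a * b / 2) * cos (x + y)" for x y :: real
    by (simp add: cos_diff cos_add algebra_simps)
  ultimately show ?thesis
    unfolding F G by (simp add: left_diff_distrib distrib_right sum.distrib sum_subtractf algebra_simps)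
qed

lemma trig_poly_mult:
  assumes "f \<in> trig_poly" "g \<in> trig_poly"
  shows "(\<lambda>u. f u * g u) \<in> trig_poly"
  using assms
proof (induction f)
  case (cos F a s \<theta>)
  from assms(2) show ?case
  proof (induction g)
    case (cos G b t \<theta>')
    then show ?case using \<open>finite F\<close> by (intro trig_poly_cos_mult_cos)
  next
    case (add f g)
    then show ?case using trig_poly.add by (force simp: distrib_left)
  qed
next
  case (add f f')
  then show ?case using trig_poly.add by (force simp: distrib_right)
qed

lemma trig_poly_real_polynomial_function:
  fixes p :: "real \<Rightarrow> real"
  assumes "real_polynomial_function p" "f \<in> trig_poly"
  shows "(\<lambda>u. p (f u)) \<in> trig_poly"
  using assms(1)
proof induction
  case (linear p)
  have "p x = p 1 * x" for x
    using linear_scale[OF bounded_linear.linear[OF linear(1)], of x 1] by (simp add: mult.commute)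
  then have "(\<lambda>u. p (f u)) = (\<lambda>u. p 1 * f u)" by (intro ext)
  then show ?case using trig_poly_mult[OF trig_poly_const assms(2)] by simp
qed (auto intro: trig_poly_const trig_poly.add trig_poly_mult)

lemma trig_poly_bounded:
  assumes "f \<in> trig_poly"
  shows "\<exists>A. \<forall>u. \<bar>f u\<bar> \<le> A"
  using assms
proof induction
  case (cos F a t \<theta>)
  have "\<bar>a * cos x\<bar> \<le> \<bar>a\<bar>" for x by (simp add: abs_mult mult_left_le)
  then show ?case by blast
next
  case (add f g)
  then obtain A B where "\<And>u. \<bar>f u\<bar> \<le> A" "\<And>u. \<bar>g u\<bar> \<le> B" by auto
  then have "\<bar>f u + g u\<bar> \<le> A + B" for u by (meson abs_triangle_ineq add_mono order_trans)
  then show ?case by blast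
qed

lemma trig_poly_measurable:
  assumes "f \<in> trig_poly" and [measurable]: "\<And>i. (\<lambda>\<omega>. U \<omega> i) \<in> borel_measurable M"
  shows "(\<lambda>\<omega>. f (U \<omega>)) \<in> borel_measurable M"
  using assms(1)
proof induction
  case (cos F a t \<theta>)
  show ?case by measurable
qed measurable

lemma trig_poly_continuous_on: "f \<in> trig_poly \<Longrightarrow> continuous_on S f"
proof (induction rule: trig_poly.induct)
  case (cos F a t \<theta>)
  have "continuous_on S (\<lambda>u. u z)" for z :: nat
    by (rule continuous_on_subset[OF continuous_on_product_coordinates]) simp
  note [continuous_intros] = this
  show ?case by (intro continuous_intros)
qed (intro continuous_intros)

lemma trig_poly_separates:
  assumes "u z \<noteq> v z"
  shows "\<exists>f\<in>trig_poly. f u \<noteq> f v"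
proof -
  \<comment> \<open>The scaling brings both coordinates into [-1, 1], where the sine is injective;
    the phase -pi/2 turns the sine into a cosine.\<close>
  define s where "s = 1 / (1 + \<bar>u z\<bar> + \<bar>v z\<bar>)"
  have s: "s > 0" by (simp add: s_def add_pos_nonneg)
  have b: "\<bar>s * u z\<bar> \<le> 1" "\<bar>s * v z\<bar> \<le> 1" by (auto simp: s_def abs_mult divide_le_eq)
  have "sin (s * u z) \<noteq> sin (s * v z)"
    using sin_inj_pi[of "s * u z" "s * v z"] b pi_ge_two s assms by (auto simp: abs_le_iff)
  then have "cos (s * u z + - pi/2) \<noteq> cos (s * v z + - pi/2)"
    by (simp add: cos_diff)
  then show ?thesis
    using trig_poly.cos[of "{z}" 1 "\<lambda>_. s" "-pi/2"]
    by (intro bexI[of _ "\<lambda>u. 1 * cos ((\<Sum>z\<in>{z}. s * u z) + - pi / 2)"]) auto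
qed

lemma trig_poly_approx:
  fixes Z :: "'z::metric_space set"
  assumes Z: "compact Z" "Z \<noteq> {}" and d: "range (d :: nat \<Rightarrow> 'z) \<subseteq> Z" "Z \<subseteq> closure (range d)"
    and \<delta>: "\<And>k. 0 < \<delta> k" and \<eta>: "\<eta> \<longlonglongrightarrow> 0"
    and \<phi>: "continuous_map (mtopology_of (C_space Z)) euclideanreal \<phi>"
    and B: "\<And>u. u \<in> mspace (C_space Z) \<Longrightarrow> \<bar>\<phi> u\<bar> \<le> B" and "0 < e" "0 \<le> B"
  obtains b where "b \<in> trig_poly" "\<And>u. \<bar>b u\<bar> \<le> B + e"
    "\<And>u. u \<in> equicont_set Z R \<delta> \<eta> \<Longrightarrow> \<bar>b (\<lambda>i. u (d i)) - \<phi> u\<bar> \<le> 2 * e"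
proof -
  let ?K = "equicont_set Z R \<delta> \<eta>"
  let ?\<rho> = "\<lambda>u i. u (d i) :: real"
  have Kc: "continuous_on Z u" if "u \<in> ?K" for u using equicont_set_continuous_on[OF that \<delta> \<eta>] .
  have KC: "u \<in> mspace (C_space Z)" if "u \<in> ?K" for u
    unfolding mspace_C_space_iff[OF Z(1)] using Kc[OF that] that by (auto simp: equicont_set_def)
  obtain \<psi> where \<psi>: "continuous_on (?\<rho> ` ?K) \<psi>" "\<And>u. u \<in> ?K \<Longrightarrow> \<psi> (?\<rho> u) = \<phi> u"
    by (rule equicont_set_test_function[OF Z d _ \<eta> \<phi>, of \<delta> R]) (use \<delta> in blast)+
  interpret function_ring_on trig_poly "?\<rho> ` ?K"
  proof
    have "continuous_on UNIV ?\<rho>"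
      by (intro continuous_on_coordinatewise_then_product continuous_on_product_coordinates)
    then have "continuous_on ?K ?\<rho>" by (rule continuous_on_subset) simp
    then show "compact (?\<rho> ` ?K)" using compact_equicont_set by (rule compact_continuous_image)
    fix x y :: "nat \<Rightarrow> real" assume "x \<noteq> y"
    then show "\<exists>f\<in>trig_poly. f x \<noteq> f y" using trig_poly_separates by (metis ext)
  qed (auto intro: trig_poly_continuous_on trig_poly.add trig_poly_mult trig_poly_const)
  obtain a where a: "a \<in> trig_poly" "\<And>x. x \<in> ?\<rho> ` ?K \<Longrightarrow> \<bar>\<psi> x - a x\<bar> < e"
    using Stone_Weierstrass_basic[OF \<psi>(1) \<open>0 < e\<close>] by blast
  have a': "\<bar>\<phi> u - a (?\<rho> u)\<bar> < e" if "u \<in> ?K" for u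
    using a(2)[OF imageI[OF that]] \<psi>(2)[OF that] by simp
  obtain A where A: "\<And>u. \<bar>a u\<bar> \<le> A" using trig_poly_bounded[OF a(1)] by blast
  \<comment> \<open>Since \<phi> takes values in [-B, B], clipping does not increase the distance to
    it; the polynomial p then costs a second e.\<close>
  define clip where "clip x = max (-B) (min B x)" for x
  have "continuous_on {-A..A} clip" unfolding clip_def by (intro continuous_intros)
  then obtain p where p: "real_polynomial_function p" "\<And>x. x \<in> {-A..A} \<Longrightarrow> \<bar>clip x - p x\<bar> < e"
    using Stone_Weierstrass_real_polynomial_function[of "{-A..A}" clip e] \<open>0 < e\<close> by auto
  have p_le: "\<bar>clip (a u) - p (a u)\<bar> < e" for u
    using A[of u] by (intro p(2)) (auto simp: abs_le_iff)
  show ?thesis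
  proof
    show "(\<lambda>u. p (a u)) \<in> trig_poly" by (rule trig_poly_real_polynomial_function[OF p(1) a(1)])
    show "\<bar>p (a u)\<bar> \<le> B + e" for u
      using p_le[of u] \<open>0 \<le> B\<close> by (auto simp: clip_def max_def min_def split: if_splits)
    show "\<bar>p (a (?\<rho> u)) - \<phi> u\<bar> \<le> 2 * e" if u: "u \<in> ?K" for u
      using p_le[of "?\<rho> u"] a'[OF u] B[OF KC[OF u]] \<open>0 \<le> B\<close>
      by (auto simp: clip_def max_def min_def abs_le_iff split: if_splits)
  qed
qed

lemma (in prob_space) expectation_diff_le_on_event:
  fixes X Y :: "'a \<Rightarrow> real"
  assumes [measurable]: "X \<in> borel_measurable M" "Y \<in> borel_measurable M" "E \<in> sets M"
    and "\<And>\<omega>. \<omega> \<in> space M \<Longrightarrow> \<bar>X \<omega>\<bar> \<le> A" "\<And>\<omega>. \<omega> \<in> space M \<Longrightarrow> \<bar>Y \<omega>\<bar> \<le> B"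
    and "\<And>\<omega>. \<omega> \<in> space M \<Longrightarrow> \<omega> \<notin> E \<Longrightarrow> \<bar>X \<omega> - Y \<omega>\<bar> \<le> e" "0 \<le> e"
  shows "\<bar>expectation X - expectation Y\<bar> \<le> e + (A + B) * prob E"
proof -
  have iX: "integrable M X" and iY: "integrable M Y"
    using assms by (intro integrable_const_bound[of _ A] integrable_const_bound[of _ B]; auto)+
  have "\<bar>expectation X - expectation Y\<bar> = \<bar>expectation (\<lambda>\<omega>. X \<omega> - Y \<omega>)\<bar>"
    using iX iY by simp
  also have "\<dots> \<le> expectation (\<lambda>\<omega>. \<bar>X \<omega> - Y \<omega>\<bar>)"
    by (rule integral_abs_bound)
  also have "\<dots> \<le> expectation (\<lambda>\<omega>. e + (A + B) * indicator E \<omega>)"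
  proof (rule integral_mono)
    fix \<omega> assume \<omega>: "\<omega> \<in> space M"
    have "\<bar>X \<omega> - Y \<omega>\<bar> \<le> A + B" using assms(4,5)[OF \<omega>] by linarith
    then show "\<bar>X \<omega> - Y \<omega>\<bar> \<le> e + (A + B) * indicator E \<omega>"
      using assms(6)[OF \<omega>] \<open>0 \<le> e\<close> by (cases "\<omega> \<in> E") auto
  qed (use iX iY in \<open>auto intro!: integrable_add integrable_mult_right integrable_real_indicator simp:
    less_top[symmetric]\<close>)
  also have "\<dots> = e + (A + B) * prob E"
    by (subst Bochner_Integration.integral_add)
      (auto intro!: integrable_mult_right integrable_real_indicator simp: prob_space less_top[symmetric])
  finally show ?thesis .
qed

lemma trig_poly_expectation_tendsto:
  assumes "prob_space M" "prob_space N" "f \<in> trig_poly"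
    and [measurable]: "\<And>n i. (\<lambda>\<omega>. U n \<omega> i) \<in> borel_measurable M"
      "\<And>i. (\<lambda>\<omega>. V \<omega> i) \<in> borel_measurable N"
    and conv: "\<And>F t \<theta>. finite F \<Longrightarrow> (\<lambda>n. \<integral>\<omega>. cos ((\<Sum>z\<in>F. t z * U n \<omega> z) + \<theta>) \<partial>M)
      \<longlonglongrightarrow> (\<integral>\<omega>. cos ((\<Sum>z\<in>F. t z * V \<omega> z) + \<theta>) \<partial>N)"
  shows "(\<lambda>n. \<integral>\<omega>. f (U n \<omega>) \<partial>M) \<longlonglongrightarrow> (\<integral>\<omega>. f (V \<omega>) \<partial>N)"
  using assms(3)
proof induction
  case (cos F a t \<theta>)
  then show ?case using tendsto_mult_left[OF conv[OF cos], of a] by simp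
next
  case (add f g)
  interpret M: prob_space M by fact
  interpret N: prob_space N by fact
  have "integrable M (\<lambda>\<omega>. h (U n \<omega>))" "integrable N (\<lambda>\<omega>. h (V \<omega>))" if h: "h \<in> trig_poly" for n h
  proof -
    obtain A where "\<And>u. \<bar>h u\<bar> \<le> A" using trig_poly_bounded[OF h] by blast
    then show "integrable M (\<lambda>\<omega>. h (U n \<omega>))" "integrable N (\<lambda>\<omega>. h (V \<omega>))"
      using trig_poly_measurable[OF h, of "U n" M] trig_poly_measurable[OF h, of V N]
      by (auto intro!: M.integrable_const_bound[of _ A] N.integrable_const_bound[of _ A])
  qed
  then show ?case using add tendsto_add[OF add.IH] by simp
qed

text \<open>The trigonometric polynomials separate points, hence by Stone--Weierstrass they approximate a test function on
  a compact set; clipping, again approximated by a polynomial, keeps the approximant bounded off the compact set.\<close>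

lemma convergence_from_tightness:
  fixes Z :: "'z::metric_space set"
  assumes Z: "compact Z" "Z \<noteq> {}" and d: "range (d :: nat \<Rightarrow> 'z) \<subseteq> Z" "Z \<subseteq> closure (range d)"
    and M: "prob_space M" and N: "prob_space N"
    and U: "\<And>n. U n \<in> M \<rightarrow>\<^sub>M borel_sigma (mtopology_of (C_space Z))"
    and V: "V \<in> N \<rightarrow>\<^sub>M borel_sigma (mtopology_of (C_space Z))"
    and Ud: "\<And>n i. (\<lambda>\<omega>. U n \<omega> (d i)) \<in> borel_measurable M"
    and Vd: "\<And>i. (\<lambda>\<omega>. V \<omega> (d i)) \<in> borel_measurable N"
    and conv: "\<And>F t \<theta>. finite F \<Longrightarrow> (\<lambda>n. \<integral>\<omega>. cos ((\<Sum>z\<in>F. t z * U n \<omega> (d z)) + \<theta>) \<partial>M)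
      \<longlonglongrightarrow> (\<integral>\<omega>. cos ((\<Sum>z\<in>F. t z * V \<omega> (d z)) + \<theta>) \<partial>N)"
    and tight: "\<And>e::real. 0 < e \<Longrightarrow> \<exists>R \<delta> \<eta>. (\<forall>k. 0 < \<delta> k) \<and> \<eta> \<longlonglongrightarrow> 0 \<and>
      (\<forall>n. \<exists>E\<in>sets M. measure M E \<le> e \<and> (\<forall>\<omega>\<in>space M - E. U n \<omega> \<in> equicont_set Z R \<delta> \<eta>)) \<and>
      (\<exists>E\<in>sets N. measure N E \<le> e \<and> (\<forall>\<omega>\<in>space N - E. V \<omega> \<in> equicont_set Z R \<delta> \<eta>))"
    and \<phi>: "continuous_map (mtopology_of (C_space Z)) euclideanreal \<phi>"
      "bounded (\<phi> ` topspace (mtopology_of (C_space Z)))"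
  shows "(\<lambda>n. \<integral>\<omega>. \<phi> (U n \<omega>) \<partial>M) \<longlonglongrightarrow> (\<integral>\<omega>. \<phi> (V \<omega>) \<partial>N)"
proof -
  interpret M: prob_space M by fact
  interpret N: prob_space N by fact
  obtain B where B: "0 \<le> B" "\<And>u. u \<in> mspace (C_space Z) \<Longrightarrow> \<bar>\<phi> u\<bar> \<le> B"
  proof -
    obtain B where "\<forall>x\<in>\<phi> ` topspace (mtopology_of (C_space Z)). norm x \<le> B"
      using \<phi>(2) unfolding bounded_iff by blast
    then have "\<And>u. u \<in> mspace (C_space Z) \<Longrightarrow> \<bar>\<phi> u\<bar> \<le> max 0 B"
      unfolding topspace_C_space by (force simp: le_max_iff_disj)
    then show ?thesis using that[of "max 0 B"] by simp
  qed
  have Usp: "U n \<omega> \<in> mspace (C_space Z)" if "\<omega> \<in> space M" for n \<omega>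
    using measurable_space[OF U that, of n] unfolding space_borel_sigma topspace_C_space .
  have Vsp: "V \<omega> \<in> mspace (C_space Z)" if "\<omega> \<in> space N" for \<omega>
    using measurable_space[OF V that] unfolding space_borel_sigma topspace_C_space .
  note \<phi>m = measurable_continuous_map_borel_sigma[OF \<phi>(1)]
  show ?thesis
  proof (rule LIMSEQ_I)
    fix r :: real assume "0 < r"
    \<comment> \<open>The three comparisons below cost 3e, e and 3e, which stays below r; \<epsilon>
      is chosen so that the exceptional events contribute at most e to a comparison.\<close>
    define e where "e = min 1 (r / 10)"
    have e: "0 < e" "e \<le> 1" "e \<le> r / 10" using \<open>0 < r\<close> by (auto simp: e_def)
    define \<epsilon> where "\<epsilon> = e / (2 * B + 1)"
    have \<epsilon>: "0 < \<epsilon>" using e B(1) by (simp add: \<epsilon>_def)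
    obtain R \<delta> \<eta> where K: "\<And>k. 0 < \<delta> k" "\<eta> \<longlonglongrightarrow> 0"
      "\<And>n. \<exists>E\<in>sets M. measure M E \<le> \<epsilon> \<and> (\<forall>\<omega>\<in>space M - E. U n \<omega> \<in> equicont_set Z R \<delta> \<eta>)"
      "\<exists>E\<in>sets N. measure N E \<le> \<epsilon> \<and> (\<forall>\<omega>\<in>space N - E. V \<omega> \<in> equicont_set Z R \<delta> \<eta>)"
      using tight[OF \<epsilon>] by blast
    obtain b where b: "b \<in> trig_poly" "\<And>u. \<bar>b u\<bar> \<le> B + e"
      "\<And>u. u \<in> equicont_set Z R \<delta> \<eta> \<Longrightarrow> \<bar>b (\<lambda>i. u (d i)) - \<phi> u\<bar> \<le> 2 * e"
      by (rule trig_poly_approx[OF Z d _ K(2) \<phi>(1) B(2) e(1) B(1), of \<delta> R]) (use K(1) in blast)+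
    have small: "2 * e + (B + (B + e)) * \<epsilon>' \<le> 3 * e" if "\<epsilon>' \<le> \<epsilon>" "0 \<le> \<epsilon>'" for \<epsilon>'
    proof -
      have "(B + (B + e)) * \<epsilon>' \<le> (2 * B + 1) * \<epsilon>"
        using that e B(1) \<epsilon> by (intro mult_mono) auto
      also have "\<dots> = e" using B(1) by (simp add: \<epsilon>_def)
      finally show ?thesis by simp
    qed
    have Ub: "\<bar>(\<integral>\<omega>. \<phi> (U n \<omega>) \<partial>M) - (\<integral>\<omega>. b (\<lambda>i. U n \<omega> (d i)) \<partial>M)\<bar> \<le> 3 * e" for n
    proof -
      obtain E where E: "E \<in> sets M" "measure M E \<le> \<epsilon>" "\<And>\<omega>. \<omega> \<in> space M - E \<Longrightarrow> U n \<omega> \<in> equicont_set Z R \<delta> \<eta>"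
        using K(3) by blast
      have "\<bar>(\<integral>\<omega>. \<phi> (U n \<omega>) \<partial>M) - (\<integral>\<omega>. b (\<lambda>i. U n \<omega> (d i)) \<partial>M)\<bar> \<le> 2 * e + (B + (B + e)) * measure M E"
        by (rule M.expectation_diff_le_on_event)
          (use E b e Usp B measurable_compose[OF U \<phi>m] trig_poly_measurable[OF b(1) Ud] in
            \<open>auto simp: abs_minus_commute simp del: mspace_cfunspace\<close>)
      also have "\<dots> \<le> 3 * e" using small[OF E(2) measure_nonneg] .
      finally show ?thesis .
    qed
    have Vb: "\<bar>(\<integral>\<omega>. \<phi> (V \<omega>) \<partial>N) - (\<integral>\<omega>. b (\<lambda>i. V \<omega> (d i)) \<partial>N)\<bar> \<le> 3 * e"
    proof -
      obtain E where E: "E \<in> sets N" "measure N E \<le> \<epsilon>" "\<And>\<omega>. \<omega> \<in> space N - E \<Longrightarrow> V \<omega> \<in> equicont_set Z R \<delta> \<eta>"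
        using K(4) by blast
      have "\<bar>(\<integral>\<omega>. \<phi> (V \<omega>) \<partial>N) - (\<integral>\<omega>. b (\<lambda>i. V \<omega> (d i)) \<partial>N)\<bar> \<le> 2 * e + (B + (B + e)) * measure N E"
        by (rule N.expectation_diff_le_on_event)
          (use E b e Vsp B measurable_compose[OF V \<phi>m] trig_poly_measurable[OF b(1) Vd] in
            \<open>auto simp: abs_minus_commute simp del: mspace_cfunspace\<close>)
      also have "\<dots> \<le> 3 * e" using small[OF E(2) measure_nonneg] .
      finally show ?thesis .
    qed
    have "(\<lambda>n. \<integral>\<omega>. b (\<lambda>i. U n \<omega> (d i)) \<partial>M) \<longlonglongrightarrow> (\<integral>\<omega>. b (\<lambda>i. V \<omega> (d i)) \<partial>N)"
      by (rule trig_poly_expectation_tendsto[OF M N b(1) Ud Vd conv])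
    then obtain n0 where n0: "\<And>n. n \<ge> n0 \<Longrightarrow> \<bar>(\<integral>\<omega>. b (\<lambda>i. U n \<omega> (d i)) \<partial>M) - (\<integral>\<omega>. b (\<lambda>i. V \<omega> (d i)) \<partial>N)\<bar> < e"
      using LIMSEQ_D[OF _ e(1)] by fastforce
    have "\<bar>(\<integral>\<omega>. \<phi> (U n \<omega>) \<partial>M) - (\<integral>\<omega>. \<phi> (V \<omega>) \<partial>N)\<bar> < r" if "n \<ge> n0" for n
      using n0[OF that] Ub[of n] Vb e \<open>0 < r\<close> by linarith
    then show "\<exists>n0. \<forall>n\<ge>n0. norm ((\<integral>\<omega>. \<phi> (U n \<omega>) \<partial>M) - (\<integral>\<omega>. \<phi> (V \<omega>) \<partial>N)) < r" by auto
  qed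
qed

section \<open>Chaining\<close>

text \<open>Space is cut into cubes of side \<open>1 / s\<close>, and one point of Z is chosen in
  each cube that meets Z, so the net lies in Z itself.\<close>

lemma exists_lattice_net:
  fixes Z :: "'z::euclidean_space set"
  assumes B: "\<And>z. z \<in> Z \<Longrightarrow> norm z \<le> B" and "0 \<le> B"
  shows "\<exists>F. finite F \<and> F \<subseteq> Z \<and> real (card F) \<le> ((2 * B + 5) * DIM('z)) ^ DIM('z) * (4 ^ DIM('z)) ^ k
    \<and> (\<forall>z\<in>Z. \<exists>a\<in>F. dist z a \<le> 1 / 4 ^ k)"
proof -
  \<comment> \<open>Two points of a cell differ by at most \<open>1 / s\<close> in each coordinate,
    and the norm is at most the sum over the coordinates; the factor DIM turns this into distance
    \<open>1 / 4 ^ k\<close>.\<close>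
  define s where "s = real DIM('z) * 4 ^ k"
  have s: "1 \<le> s" unfolding s_def using DIM_positive[where 'a='z]
    by (metis mult_mono' mult_1 of_nat_0_le_iff one_le_power one_le_numeral of_nat_1 of_nat_mono Suc_leI
      One_nat_def zero_le_one)
  define cell where "cell z = restrict (\<lambda>i. \<lfloor>(z \<bullet> i) * s\<rfloor>) Basis" for z :: 'z
  define M where "M = \<lceil>B * s\<rceil> + 1"
  have M: "0 \<le> M" using \<open>0 \<le> B\<close> s by (simp add: M_def ceiling_le_iff) (smt (verit) mult_nonneg_nonneg zero_le_ceiling)
  let ?P = "PiE (Basis :: 'z set) (\<lambda>_. {-M..M})"
  have cellP: "cell ` Z \<subseteq> ?P"
  proof
    fix x assume "x \<in> cell ` Z"
    then obtain z where z: "z \<in> Z" "x = cell z" by blast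
    have "\<lfloor>(z \<bullet> i) * s\<rfloor> \<in> {-M..M}" if "i \<in> Basis" for i
    proof -
      have "\<bar>z \<bullet> i\<bar> \<le> B" using B[OF z(1)] Basis_le_norm[OF that, of z] by linarith
      then have "\<bar>(z \<bullet> i) * s\<bar> \<le> B * s" using s by (simp add: abs_mult mult_right_mono)
      then show ?thesis unfolding M_def by (simp add: abs_le_iff) linarith
    qed
    then show "x \<in> ?P" by (auto simp: z cell_def)
  qed
  have finP: "finite ?P" by (intro finite_PiE) auto
  define F where "F = inv_into Z cell ` (cell ` Z)"
  have "finite F" unfolding F_def using finite_subset[OF cellP finP] by simp
  moreover have "F \<subseteq> Z" by (auto simp: F_def inv_into_into)
  moreover have "real (card F) \<le> ((2 * B + 5) * DIM('z)) ^ DIM('z) * (4 ^ DIM('z)) ^ k"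
  proof -
    have "card F \<le> card (cell ` Z)" unfolding F_def using finite_subset[OF cellP finP] by (rule card_image_le)
    also have "\<dots> \<le> card ?P" using cellP finP by (simp add: card_mono)
    also have "card ?P = nat (2 * M + 1) ^ DIM('z)" using M by (simp add: card_PiE)
    finally have "real (card F) \<le> real_of_int (2 * M + 1) ^ DIM('z)"
      using M by (metis (mono_tags, lifting) of_nat_le_iff of_nat_power of_nat_nat add_nonneg_nonneg
        mult_nonneg_nonneg zero_le_numeral zero_le_one)
    also have "\<dots> \<le> ((2 * B + 5) * s) ^ DIM('z)"
    proof (rule power_mono)
      \<comment> \<open>Rounding costs 1 and the summand in M another 1; the resulting constant 5 is
        absorbed because s \<ge> 1.\<close>
      have "real_of_int M \<le> B * s + 2" unfolding M_def by linarith
      then have "real_of_int (2 * M + 1) \<le> 2 * (B * s) + 5" by simp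
      also have "\<dots> \<le> (2 * B + 5) * s" using s by (simp add: algebra_simps)
      finally show "real_of_int (2 * M + 1) \<le> (2 * B + 5) * s" .
    qed (use M in simp)
    also have "\<dots> = ((2 * B + 5) * DIM('z)) ^ DIM('z) * (4 ^ DIM('z)) ^ k"
      unfolding s_def power_mult_distrib by (simp add: power_mult[symmetric] mult.commute)
    finally show ?thesis .
  qed
  moreover have "\<exists>a\<in>F. dist z a \<le> 1 / 4 ^ k" if z: "z \<in> Z" for z
  proof -
    define a where "a = inv_into Z cell (cell z)"
    have "cell a = cell z" unfolding a_def using z by (intro f_inv_into_f) auto
    have "\<bar>(z - a) \<bullet> i\<bar> \<le> 1 / s" if i: "i \<in> Basis" for i
    proof -
      have "\<lfloor>(z \<bullet> i) * s\<rfloor> = \<lfloor>(a \<bullet> i) * s\<rfloor>"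
        using fun_cong[OF \<open>cell a = cell z\<close>, of i] i by (simp add: cell_def)
      then have "\<bar>(z \<bullet> i) * s - (a \<bullet> i) * s\<bar> \<le> 1" by linarith
      then have "\<bar>(z - a) \<bullet> i\<bar> * s \<le> 1"
        using s by (simp add: inner_diff_left left_diff_distrib[symmetric] abs_mult)
      then show ?thesis using s by (simp add: field_simps)
    qed
    then have "norm (z - a) \<le> (\<Sum>i\<in>(Basis :: 'z set). 1 / s)"
      by (intro order_trans[OF norm_le_l1] sum_mono)
    also have "\<dots> = 1 / 4 ^ k" using s by (simp add: s_def)
    finally show ?thesis using z by (intro bexI[of _ a]) (auto simp: dist_norm F_def a_def)
  qed
  ultimately show ?thesis by blast
qed

text \<open>The geometric bound on the cardinalities is the entropy condition of chaining:
  exponentially small probabilities have to beat the number of pairs of a level. Nesting puts a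
  point and its coarser neighbour into a common net.\<close>

locale nested_nets =
  fixes Z :: "'z::euclidean_space set" and N :: "nat \<Rightarrow> 'z set" and C q :: real
  assumes compact_Z: "compact Z" and Z_nonempty: "Z \<noteq> {}"
    and C_nonneg: "0 \<le> C" and q_ge_1: "1 \<le> q"
    and finite_net: "finite (N k)" and net_subset: "N k \<subseteq> Z" and net_Suc: "N k \<subseteq> N (Suc k)"
    and card_net: "real (card (N k)) \<le> C * q ^ k"
    and net_approx: "z \<in> Z \<Longrightarrow> \<exists>a\<in>N k. dist z a \<le> 1 / 4 ^ k"

lemma exists_nested_nets:
  fixes Z :: "'z::euclidean_space set"
  assumes Z: "compact Z" "Z \<noteq> {}"
  shows "\<exists>N C q. nested_nets Z N C q"
proof -
  obtain B where B: "0 < B" "\<And>z. z \<in> Z \<Longrightarrow> norm z \<le> B"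
    using compact_imp_bounded[OF Z(1)] unfolding bounded_pos by blast
  define C where "C = ((2 * B + 5) * DIM('z)) ^ DIM('z)"
  define q where "q = (4 :: real) ^ DIM('z)"
  have C: "0 \<le> C" using B(1) by (simp add: C_def)
  have q: "1 \<le> q" by (simp add: q_def)
  have "\<exists>F. \<forall>k. finite (F k) \<and> F k \<subseteq> Z \<and> real (card (F k)) \<le> C * q ^ k \<and> (\<forall>z\<in>Z. \<exists>a\<in>F k. dist z a \<le> 1 / 4 ^ k)"
    using exists_lattice_net[OF B(2)] B(1) unfolding C_def q_def by (intro choice) auto
  then obtain F where F: "\<And>k. finite (F k)" "\<And>k. F k \<subseteq> Z" "\<And>k. real (card (F k)) \<le> C * q ^ k"
    "\<And>k z. z \<in> Z \<Longrightarrow> \<exists>a\<in>F k. dist z a \<le> 1 / 4 ^ k" by blast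
  \<comment> \<open>Unions make the nets nested; the k + 1 pieces cost a factor of at most 2 ^ k,
    which is why q is doubled.\<close>
  define N where "N k = (\<Union>j\<le>k. F j)" for k :: nat
  have "nested_nets Z N C (2 * q)"
  proof
    show "real (card (N k)) \<le> C * (2 * q) ^ k" for k
    proof -
      have "real (card (N k)) \<le> (\<Sum>j\<le>k. real (card (F j)))"
        unfolding N_def using card_UN_le[of "{..k}" F] by (simp flip: of_nat_sum)
      also have "\<dots> \<le> (\<Sum>j\<le>k. C * q ^ k)"
        using F(3) C q by (intro sum_mono) (meson atMost_iff mult_left_mono order_trans power_increasing)
      also have "\<dots> = C * (real (Suc k) * q ^ k)" by simp
      also have "\<dots> \<le> C * (2 ^ k * q ^ k)"
      proof (intro mult_left_mono mult_right_mono C)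
        have "Suc k \<le> 2 ^ k" by (metis Suc_leI less_exp)
        then show "real (Suc k) \<le> 2 ^ k" by (metis of_nat_le_iff of_nat_numeral of_nat_power)
      qed (use q in auto)
      finally show ?thesis by (simp add: power_mult_distrib)
    qed
    show "compact Z" "Z \<noteq> {}" "0 \<le> C" "1 \<le> 2 * q" using Z C q by auto
    show "finite (N k)" "N k \<subseteq> Z" "N k \<subseteq> N (Suc k)" for k using F by (auto simp: N_def le_Suc_eq)
    show "\<exists>a\<in>N k. dist z a \<le> 1 / 4 ^ k" if "z \<in> Z" for z k using F(4)[OF that, of k] by (auto simp: N_def)
  qed
  then show ?thesis by blast
qed

text \<open>The factor \<open>2 ^ k\<close> makes the union bound over the pairs of level \<open>k\<close> converge, while on neighbouring net points,
  at distance of order \<open>1 / 4 ^ k\<close>, it still leaves the summable increments \<open>R / 2 ^ k\<close>.\<close>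

definition chain_ok :: "(nat \<Rightarrow> 'z::metric_space set) \<Rightarrow> real \<Rightarrow> ('z \<Rightarrow> real) \<Rightarrow> bool"
  where "chain_ok N R u \<longleftrightarrow> (\<forall>a\<in>N 0. \<bar>u a\<bar> \<le> R) \<and>
    (\<forall>k. \<forall>a\<in>N (Suc k). \<forall>b\<in>N (Suc k). \<bar>u a - u b\<bar> \<le> R * 2 ^ k * dist a b)"

lemma chain_ok_mono: "chain_ok N R u \<Longrightarrow> R \<le> R' \<Longrightarrow> chain_ok N R' u"
  unfolding chain_ok_def by (meson mult_right_mono order_trans zero_le_dist zero_le_numeral zero_le_power)

context nested_nets
begin

definition D :: "'z set" where "D = (\<Union>k. N k)"

lemma countable_D: "countable D"
  unfolding D_def using finite_net by (auto intro: countable_finite)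

lemma D_subset: "D \<subseteq> Z"
  unfolding D_def using net_subset by blast

lemma net_mono: "k \<le> m \<Longrightarrow> N k \<subseteq> N m"
  using net_Suc by (simp add: lift_Suc_mono_le)

lemma D_dense: "Z \<subseteq> closure D"
proof
  fix z assume z: "z \<in> Z"
  show "z \<in> closure D" unfolding closure_approachable
  proof (intro allI impI)
    fix e :: real assume "0 < e"
    then obtain k where k: "(1 / 4) ^ k < e" using real_arch_pow_inv[of e "1/4"] by auto
    obtain a where "a \<in> N k" "dist z a \<le> 1 / 4 ^ k" using net_approx[OF z] by blast
    then show "\<exists>y\<in>D. dist y z < e" using k by (auto simp: D_def dist_commute power_one_over intro!: bexI[of _ a])
  qed
qed

lemma D_nonempty: "D \<noteq> {}"
  using D_dense Z_nonempty by auto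

text \<open>The bounds are the partial sums of the geometric series of 1 / 4 ^ j and R / 2 ^ j over
  k \<le> j < m, collected on the way down the levels.\<close>

lemma chain_ok_descend:
  assumes ok: "chain_ok N R u" and "k \<le> m" "z \<in> N m" and R: "0 \<le> R"
  shows "\<exists>a\<in>N k. dist z a \<le> 4 / 3 * (1 / 4 ^ k - 1 / 4 ^ m) \<and> \<bar>u z - u a\<bar> \<le> 2 * R * (1 / 2 ^ k - 1 / 2 ^ m)"
  using assms(2,3)
proof (induction m arbitrary: z rule: dec_induct)
  case base
  then show ?case by (intro bexI[of _ z]) auto
next
  case (step m)
  have "z \<in> Z" using step.prems net_subset by blast
  then obtain b where b: "b \<in> N m" "dist z b \<le> 1 / 4 ^ m" using net_approx by blast
  obtain a where a: "a \<in> N k" "dist b a \<le> 4 / 3 * (1 / 4 ^ k - 1 / 4 ^ m)"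
    "\<bar>u b - u a\<bar> \<le> 2 * R * (1 / 2 ^ k - 1 / 2 ^ m)" using step.IH[OF b(1)] by blast
  have "b \<in> N (Suc m)" using b(1) net_Suc by blast
  then have "\<bar>u z - u b\<bar> \<le> R * 2 ^ m * dist z b" using ok step.prems by (auto simp: chain_ok_def)
  also have "\<dots> \<le> R * 2 ^ m * (1 / 4 ^ m)" using b(2) R by (intro mult_left_mono) auto
  also have "\<dots> = R / 2 ^ m"
  proof -
    have "(4::real) ^ m = 2 ^ m * 2 ^ m" by (simp add: power_mult_distrib[symmetric])
    then show ?thesis by simp
  qed
  finally have "\<bar>u z - u a\<bar> \<le> R / 2 ^ m + 2 * R * (1 / 2 ^ k - 1 / 2 ^ m)" using a(3) by linarith
  also have "\<dots> = 2 * R * (1 / 2 ^ k - 1 / 2 ^ Suc m)" by (simp add: field_simps)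
  finally have 1: "\<bar>u z - u a\<bar> \<le> 2 * R * (1 / 2 ^ k - 1 / 2 ^ Suc m)" .
  have "dist z a \<le> 1 / 4 ^ m + 4 / 3 * (1 / 4 ^ k - 1 / 4 ^ m)"
    using b(2) a(2) dist_triangle[of z a b] by linarith
  also have "\<dots> = 4 / 3 * (1 / 4 ^ k - 1 / 4 ^ Suc m)" by (simp add: field_simps)
  finally show ?case using a(1) 1 by blast
qed

lemma chain_ok_approx:
  assumes "chain_ok N R u" "z \<in> D" "0 \<le> R"
  shows "\<exists>a\<in>N k. dist z a \<le> 4 / 3 * (1 / 4 ^ k) \<and> \<bar>u z - u a\<bar> \<le> 2 * R * (1 / 2 ^ k)"
proof -
  obtain j where "z \<in> N j" using assms(2) by (auto simp: D_def)
  \<comment> \<open>The point z may already lie in a net coarser than level k.\<close>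
  then have "z \<in> N (max k j)" using net_mono[of j "max k j"] by auto
  from chain_ok_descend[OF assms(1) _ this assms(3), of k] obtain a where a: "a \<in> N k"
    "dist z a \<le> 4 / 3 * (1 / 4 ^ k - 1 / 4 ^ max k j)" "\<bar>u z - u a\<bar> \<le> 2 * R * (1 / 2 ^ k - 1 / 2 ^ max k j)"
    by auto
  have "4 / 3 * (1 / 4 ^ k - 1 / 4 ^ max k j) \<le> 4 / 3 * (1 / 4 ^ k :: real)" by simp
  moreover have "2 * R * (1 / 2 ^ k - 1 / 2 ^ max k j) \<le> 2 * R * (1 / 2 ^ k)"
    using assms(3) by (intro mult_left_mono) auto
  ultimately show ?thesis using a by (intro bexI[of _ a]) linarith+
qed

lemma chain_ok_bound:
  assumes "chain_ok N R u" "z \<in> D" "0 \<le> R"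
  shows "\<bar>u z\<bar> \<le> 3 * R"
proof -
  obtain a where "a \<in> N 0" "\<bar>u z - u a\<bar> \<le> 2 * R" using chain_ok_approx[OF assms, of 0] by auto
  moreover have "\<bar>u a\<bar> \<le> R" using assms(1) \<open>a \<in> N 0\<close> by (simp add: chain_ok_def)
  ultimately show ?thesis by linarith
qed

lemma chain_ok_modulus:
  assumes ok: "chain_ok N R u" and z: "z \<in> D" "z' \<in> D" "dist z z' \<le> 1 / 4 ^ k" and R: "0 \<le> R"
  shows "\<bar>u z - u z'\<bar> \<le> 8 * R / 2 ^ k"
proof -
  obtain a where a: "a \<in> N k" "dist z a \<le> 4 / 3 * (1 / 4 ^ k)" "\<bar>u z - u a\<bar> \<le> 2 * R * (1 / 2 ^ k)"
    using chain_ok_approx[OF ok z(1) R, of k] by blast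
  obtain b where b: "b \<in> N k" "dist z' b \<le> 4 / 3 * (1 / 4 ^ k)" "\<bar>u z' - u b\<bar> \<le> 2 * R * (1 / 2 ^ k)"
    using chain_ok_approx[OF ok z(2) R, of k] by blast
  \<comment> \<open>The sum 4/3 + 1 + 4/3 is at most 4. With the factor 2 ^ k the middle link
    contributes 4R / 2 ^ k, and each of the two ends 2R / 2 ^ k.\<close>
  have "dist a b \<le> dist z a + dist z z' + dist z' b"
    using dist_triangle[of a b z] dist_triangle[of z b z'] by (simp add: dist_commute)
  also have "\<dots> \<le> 4 / 4 ^ k" using a(2) b(2) z(3) by (simp add: field_simps)
  finally have dab: "dist a b \<le> 4 / 4 ^ k" .
  have "a \<in> N (Suc k)" "b \<in> N (Suc k)" using a(1) b(1) net_Suc by blast+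
  then have "\<bar>u a - u b\<bar> \<le> R * 2 ^ k * dist a b" using ok by (auto simp: chain_ok_def)
  also have "\<dots> \<le> R * 2 ^ k * (4 / 4 ^ k)" using dab R by (intro mult_left_mono) auto
  also have "\<dots> = 4 * R / 2 ^ k"
  proof -
    have "(4::real) ^ k = 2 ^ k * 2 ^ k" by (simp add: power_mult_distrib[symmetric])
    then show ?thesis by simp
  qed
  finally have "\<bar>u z - u z'\<bar> \<le> 4 * R / 2 ^ k + 2 * R * (1 / 2 ^ k) + 2 * R * (1 / 2 ^ k)"
    using a(3) b(3) by linarith
  also have "\<dots> = 8 * R / 2 ^ k" by (simp add: field_simps)
  finally show ?thesis .
qed

text \<open>Bounds on D pass to Z by continuity. The radius drops by one level, because a strict
  inequality is needed for the approximating sequences eventually to satisfy the condition of level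
  k.\<close>

lemma chain_ok_imp_equicont_set:
  assumes ok: "chain_ok N R u" and R: "0 \<le> R" and u: "u \<in> extensional Z" "continuous_on Z u"
  shows "u \<in> equicont_set Z (3 * R) (\<lambda>k. 1 / 4 ^ Suc k) (\<lambda>k. 8 * R / 2 ^ k)"
proof -
  have "\<bar>u z - 0\<bar> \<le> 3 * R" if "z \<in> Z" for z
    by (rule abs_diff_le_on_closure[OF u(2) continuous_on_const D_subset D_dense _ that])
      (use chain_ok_bound[OF ok _ R] in simp)
  moreover have "\<bar>u z - u z'\<bar> \<le> 8 * R / 2 ^ k" if z: "z \<in> Z" "z' \<in> Z" "dist z z' \<le> 1 / 4 ^ Suc k" for z z' k
  proof -
    obtain x where x: "\<And>n. x n \<in> D" "x \<longlonglongrightarrow> z" using z(1) D_dense closure_sequential by blast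
    obtain y where y: "\<And>n. y n \<in> D" "y \<longlonglongrightarrow> z'" using z(2) D_dense closure_sequential by blast
    have "(u \<circ> x) \<longlonglongrightarrow> u z" "(u \<circ> y) \<longlonglongrightarrow> u z'"
      using u(2) x y z D_subset unfolding continuous_on_sequentially by blast+
    then have lim: "(\<lambda>n. \<bar>u (x n) - u (y n)\<bar>) \<longlonglongrightarrow> \<bar>u z - u z'\<bar>"
      by (auto simp: comp_def intro!: tendsto_intros)
    have "(\<lambda>n. dist (x n) (y n)) \<longlonglongrightarrow> dist z z'" using x(2) y(2) by (intro tendsto_intros)
    moreover have "dist z z' < 1 / 4 ^ k" by (rule le_less_trans[OF z(3)]) (simp add: field_simps)
    ultimately have "\<forall>\<^sub>F n in sequentially. dist (x n) (y n) < 1 / 4 ^ k" by (rule order_tendstoD(2))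
    then have "\<forall>\<^sub>F n in sequentially. \<bar>u (x n) - u (y n)\<bar> \<le> 8 * R / 2 ^ k"
      by eventually_elim (use chain_ok_modulus[OF ok _ _ _ R] x y in auto)
    with lim show ?thesis by (rule tendsto_upperbound) simp
  qed
  ultimately show ?thesis using u(1) by (simp add: equicont_set_def)
qed

text \<open>A path with a finite chaining constant is uniformly continuous on the dense set D, so it
  extends to Z. The limit process gets its continuous paths this way.\<close>

lemma chain_ok_extension:
  assumes ok: "chain_ok N R u" and R: "0 \<le> R"
  shows "\<exists>v. v \<in> extensional Z \<and> continuous_on Z v \<and> (\<forall>a\<in>D. v a = u a)"
proof -
  have "uniformly_continuous_on D u"
    unfolding uniformly_continuous_on_def
  proof (intro allI impI)
    fix e :: real assume "0 < e"
    then obtain k where k: "(1 / 2) ^ k < e / (8 * R + 1)"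
      using real_arch_pow_inv[of "e / (8 * R + 1)" "1/2"] R by auto
    have "8 * R / 2 ^ k \<le> (8 * R + 1) * (1 / 2) ^ k" using R by (simp add: power_one_over field_simps)
    also have "\<dots> < e" using k R by (simp add: field_simps)
    finally have "8 * R / 2 ^ k < e" .
    then show "\<exists>d>0. \<forall>x\<in>D. \<forall>x'\<in>D. dist x' x < d \<longrightarrow> dist (u x') (u x) < e"
      using chain_ok_modulus[OF ok _ _ _ R, of _ _ k]
      by (intro exI[of _ "1 / 4 ^ k"]) (auto simp: dist_real_def intro: le_less_trans[OF _ \<open>8 * R / 2 ^ k < e\<close>])
  qed
  then obtain g where g: "uniformly_continuous_on (closure D) g" "\<And>x. x \<in> D \<Longrightarrow> u x = g x"
    by (rule uniformly_continuous_on_extension_on_closure) blast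
  have "continuous_on Z g"
    using uniformly_continuous_imp_continuous[OF g(1)] D_dense by (rule continuous_on_subset)
  then have "continuous_on Z (restrict g Z)" by (rule continuous_on_eq) auto
  then show ?thesis using g(2) D_subset by (intro exI[of _ "restrict g Z"]) auto
qed

end

section \<open>Exponential and second-moment tail bounds\<close>

lemma (in prob_space) chernoff_bound:
  fixes X :: "'a \<Rightarrow> real"
  assumes [measurable]: "X \<in> borel_measurable M" and s: "0 < s"
    and mgf: "(\<integral>\<^sup>+\<omega>. ennreal (exp (s * X \<omega>)) \<partial>M) \<le> ennreal B" and B: "0 \<le> B"
  shows "prob {\<omega> \<in> space M. t < X \<omega>} \<le> exp (- s * t) * B"
proof -
  have "emeasure M {\<omega> \<in> space M. t < X \<omega>} \<le> emeasure M {\<omega> \<in> space M. 1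
    \<le> ennreal (exp (- s * t)) * ennreal (exp (s * X \<omega>))}"
  proof (rule emeasure_mono)
    show "{\<omega> \<in> space M. t < X \<omega>} \<subseteq> {\<omega> \<in> space M. 1 \<le> ennreal (exp (- s * t)) * ennreal (exp (s * X \<omega>))}"
    proof clarify
      fix \<omega> assume "t < X \<omega>"
      then have "0 \<le> s * (X \<omega> - t)" using s by simp
      then have "1 \<le> exp (- s * t) * exp (s * X \<omega>)" by (simp add: exp_add[symmetric] algebra_simps)
      then show "1 \<le> ennreal (exp (- s * t)) * ennreal (exp (s * X \<omega>))"
        by (simp add: ennreal_mult[symmetric] ennreal_ge_1)
    qed
  qed measurable
  also have "\<dots> \<le> ennreal (exp (- s * t)) * (\<integral>\<^sup>+\<omega>. ennreal (exp (s * X \<omega>)) * indicator (space M) \<omega> \<partial>M)"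
    by (rule nn_integral_Markov_inequality) measurable
  also have "(\<integral>\<^sup>+\<omega>. ennreal (exp (s * X \<omega>)) * indicator (space M) \<omega> \<partial>M) = (\<integral>\<^sup>+\<omega>. ennreal (exp (s * X \<omega>)) \<partial>M)"
    by (intro nn_integral_cong) simp
  also have "ennreal (exp (- s * t)) * \<dots> \<le> ennreal (exp (- s * t)) * ennreal B"
    by (intro mult_left_mono mgf) simp
  finally show ?thesis using B by (simp add: emeasure_eq_measure ennreal_mult[symmetric])
qed

lemma (in prob_space) sub_gaussian_tail:
  fixes X :: "'a \<Rightarrow> real"
  assumes [measurable]: "X \<in> borel_measurable M" and v: "0 < v" and t: "0 < t"
    and mgf: "\<And>s. (\<integral>\<^sup>+\<omega>. ennreal (exp (s * X \<omega>)) \<partial>M) \<le> ennreal (exp (s\<^sup>2 * v / 2))"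
  shows "prob {\<omega> \<in> space M. t < \<bar>X \<omega>\<bar>} \<le> 2 * exp (- t\<^sup>2 / (2 * v))"
proof -
  have one: "prob {\<omega> \<in> space M. t < r * X \<omega>} \<le> exp (- t\<^sup>2 / (2 * v))" if r: "r\<^sup>2 = 1" for r
  proof -
    \<comment> \<open>The minimizer of -s t + s^2 v / 2; the values 1 and -1 of r give the two
      tails.\<close>
    define s where "s = t / v"
    have s: "0 < s" using t v by (simp add: s_def)
    have "(\<integral>\<^sup>+\<omega>. ennreal (exp (s * (r * X \<omega>))) \<partial>M) \<le> ennreal (exp (s\<^sup>2 * v / 2))"
      using mgf[of "s * r"] r by (simp add: power_mult_distrib mult.assoc)
    then have "prob {\<omega> \<in> space M. t < r * X \<omega>} \<le> exp (- s * t) * exp (s\<^sup>2 * v / 2)"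
      using s by (intro chernoff_bound) auto
    also have "- s * t + s\<^sup>2 * v / 2 = - t\<^sup>2 / (2 * v)"
      using v by (simp add: s_def power2_eq_square field_simps)
    then have "exp (- s * t) * exp (s\<^sup>2 * v / 2) = exp (- t\<^sup>2 / (2 * v))" by (simp flip: exp_add)
    finally show ?thesis .
  qed
  have "prob {\<omega> \<in> space M. t < \<bar>X \<omega>\<bar>} \<le> prob ({\<omega> \<in> space M. t < 1 * X \<omega>} \<union> {\<omega> \<in> space M. t < (-1) * X \<omega>})"
    by (intro finite_measure_mono) (auto simp: abs_if split: if_splits)
  also have "\<dots> \<le> prob {\<omega> \<in> space M. t < 1 * X \<omega>} + prob {\<omega> \<in> space M. t < (-1) * X \<omega>}"
    by (rule measure_subadditive) auto
  finally show ?thesis using one[of 1] one[of "-1"] by simp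
qed

lemma (in prob_space) second_moment_tail:
  fixes X :: "'a \<Rightarrow> real"
  assumes [measurable]: "X \<in> borel_measurable M" and "0 < t" "0 \<le> \<sigma>"
    and "(\<integral>\<^sup>+\<omega>. ennreal ((X \<omega>)\<^sup>2) \<partial>M) \<le> ennreal \<sigma>"
  shows "prob {\<omega> \<in> space M. t < \<bar>X \<omega>\<bar>} \<le> \<sigma> / t\<^sup>2"
proof -
  have "emeasure M {\<omega> \<in> space M. t < \<bar>X \<omega>\<bar>} \<le> emeasure M {\<omega> \<in> space M. 1 \<le> ennreal (1 / t\<^sup>2) * ennreal ((X \<omega>)\<^sup>2)}"
  proof (rule emeasure_mono)
    show "{\<omega> \<in> space M. t < \<bar>X \<omega>\<bar>} \<subseteq> {\<omega> \<in> space M. 1 \<le> ennreal (1 / t\<^sup>2) * ennreal ((X \<omega>)\<^sup>2)}"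
    proof clarify
      fix \<omega> assume "t < \<bar>X \<omega>\<bar>"
      then have "t\<^sup>2 \<le> \<bar>X \<omega>\<bar>\<^sup>2" using \<open>0 < t\<close> by (intro power_mono) auto
      then show "1 \<le> ennreal (1 / t\<^sup>2) * ennreal ((X \<omega>)\<^sup>2)"
        using \<open>0 < t\<close> by (simp add: ennreal_mult[symmetric] ennreal_ge_1 field_simps)
    qed
  qed measurable
  also have "\<dots> \<le> ennreal (1 / t\<^sup>2) * (\<integral>\<^sup>+\<omega>. ennreal ((X \<omega>)\<^sup>2) * indicator (space M) \<omega> \<partial>M)"
    by (rule nn_integral_Markov_inequality) measurable
  also have "(\<integral>\<^sup>+\<omega>. ennreal ((X \<omega>)\<^sup>2) * indicator (space M) \<omega> \<partial>M) = (\<integral>\<^sup>+\<omega>. ennreal ((X \<omega>)\<^sup>2) \<partial>M)"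
    by (intro nn_integral_cong) simp
  also have "ennreal (1 / t\<^sup>2) * \<dots> \<le> ennreal (1 / t\<^sup>2) * ennreal \<sigma>"
    by (intro mult_left_mono assms) simp
  also have "\<dots> = ennreal (\<sigma> / t\<^sup>2)" using assms by (simp add: ennreal_mult[symmetric])
  finally show ?thesis using assms by (simp add: emeasure_eq_measure)
qed

section \<open>Union bound over all chaining levels\<close>

context nested_nets
begin

lemma measurable_chain_ok:
  assumes [measurable]: "\<And>a. a \<in> D \<Longrightarrow> (\<lambda>\<omega>. u \<omega> a) \<in> borel_measurable M"
  shows "{\<omega> \<in> space M. chain_ok N R (u \<omega>)} \<in> sets M"
proof -
  have D: "a \<in> N k \<Longrightarrow> a \<in> D" for a k by (auto simp: D_def)
  have fin: "countable (N k)" for k using finite_net by (rule countable_finite)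
  have 1: "{\<omega> \<in> space M. \<forall>a\<in>N 0. \<bar>u \<omega> a\<bar> \<le> R} \<in> sets M"
  proof (intro sets.sets_Collect_countable_All' fin)
    fix a assume "a \<in> N 0"
    then have [measurable]: "(\<lambda>\<omega>. u \<omega> a) \<in> borel_measurable M" using D assms by blast
    show "{\<omega> \<in> space M. \<bar>u \<omega> a\<bar> \<le> R} \<in> sets M" by measurable
  qed
  have 2: "{\<omega> \<in> space M. \<forall>k. \<forall>a\<in>N (Suc k). \<forall>b\<in>N (Suc k). \<bar>u \<omega> a - u \<omega> b\<bar> \<le> R * 2 ^ k * dist a b} \<in> sets M"
  proof (intro sets.sets_Collect_countable_All sets.sets_Collect_countable_All' fin)
    fix k a b assume "a \<in> N (Suc k)" "b \<in> N (Suc k)"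
    then have [measurable]: "(\<lambda>\<omega>. u \<omega> a) \<in> borel_measurable M" "(\<lambda>\<omega>. u \<omega> b) \<in> borel_measurable M"
      using D assms by blast+
    show "{\<omega> \<in> space M. \<bar>u \<omega> a - u \<omega> b\<bar> \<le> R * 2 ^ k * dist a b} \<in> sets M" by measurable
  qed
  show ?thesis unfolding chain_ok_def by (rule sets.sets_Collect_conj[OF 2 1])
qed

text \<open>For a pair of level k the threshold and the standard deviation are both proportional to
  the distance, which cancels and leaves the exponent -R^2 4^k / (2 K^2). It beats the number of
  pairs, at most C^2 q^(2k+2), and the levels sum like a geometric series of ratio x \<le> 1/2. The
  values on the coarsest net need only Chebyshev's inequality.\<close>

lemma prob_not_chain_ok:
  fixes \<sigma> :: real
  assumes "prob_space M" and u: "\<And>a. a \<in> D \<Longrightarrow> (\<lambda>\<omega>. u \<omega> a) \<in> borel_measurable M"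
    and R: "0 < R" and K: "0 < K" and \<sigma>: "0 \<le> \<sigma>"
    and mgf: "\<And>a b s. a \<in> D \<Longrightarrow> b \<in> D \<Longrightarrow>
      (\<integral>\<^sup>+\<omega>. ennreal (exp (s * (u \<omega> a - u \<omega> b))) \<partial>M) \<le> ennreal (exp (s\<^sup>2 * (K * dist a b)\<^sup>2 / 2))"
    and var: "\<And>a. a \<in> N 0 \<Longrightarrow> (\<integral>\<^sup>+\<omega>. ennreal ((u \<omega> a)\<^sup>2) \<partial>M) \<le> ennreal \<sigma>"
    and small: "q\<^sup>2 * exp (- R\<^sup>2 / (2 * K\<^sup>2)) \<le> 1 / 2"
  shows "measure M {\<omega> \<in> space M. \<not> chain_ok N R (u \<omega>)}
    \<le> card (N 0) * \<sigma> / R\<^sup>2 + 4 * C\<^sup>2 * (q\<^sup>2 * exp (- R\<^sup>2 / (2 * K\<^sup>2)))"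
proof -
  interpret prob_space M by fact
  have D: "a \<in> N k \<Longrightarrow> a \<in> D" for a k by (auto simp: D_def)
  define x where "x = q\<^sup>2 * exp (- R\<^sup>2 / (2 * K\<^sup>2))"
  have x: "0 < x" "x \<le> 1 / 2" using small q_ge_1 by (auto simp: x_def)
  define E where "E k = (\<Union>p\<in>N (Suc k) \<times> N (Suc k). {\<omega> \<in> space M. R * 2 ^ k * dist (fst p) (snd p) < \<bar>u \<omega> (fst p)
    - u \<omega> (snd p)\<bar>})" for k
  define E0 where "E0 = (\<Union>a\<in>N 0. {\<omega> \<in> space M. R < \<bar>u \<omega> a\<bar>})"
  have mpair: "{\<omega> \<in> space M. c < \<bar>u \<omega> a - u \<omega> b\<bar>} \<in> sets M" if "a \<in> D" "b \<in> D" for a b c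
  proof -
    have [measurable]: "(\<lambda>\<omega>. u \<omega> a) \<in> borel_measurable M" "(\<lambda>\<omega>. u \<omega> b) \<in> borel_measurable M" using u that by auto
    show ?thesis by measurable
  qed
  have m0: "{\<omega> \<in> space M. c < \<bar>u \<omega> a\<bar>} \<in> sets M" if "a \<in> D" for a c
  proof -
    have [measurable]: "(\<lambda>\<omega>. u \<omega> a) \<in> borel_measurable M" using u that by auto
    show ?thesis by measurable
  qed
  have Em: "E k \<in> sets M" for k
    unfolding E_def using finite_net D by (intro sets.finite_UN mpair) auto
  have E0m: "E0 \<in> sets M" unfolding E0_def using finite_net D by (intro sets.finite_UN m0) auto
  have sub: "{\<omega> \<in> space M. \<not> chain_ok N R (u \<omega>)} \<subseteq> E0 \<union> (\<Union>k. E k)"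
  proof
    fix \<omega> assume \<omega>: "\<omega> \<in> {\<omega> \<in> space M. \<not> chain_ok N R (u \<omega>)}"
    show "\<omega> \<in> E0 \<union> (\<Union>k. E k)"
    proof (cases "\<forall>a\<in>N 0. \<bar>u \<omega> a\<bar> \<le> R")
      case False
      then show ?thesis using \<omega> by (auto simp: E0_def not_le)
    next
      case True
      then obtain k a b where "a \<in> N (Suc k)" "b \<in> N (Suc k)" "R * 2 ^ k * dist a b < \<bar>u \<omega> a - u \<omega> b\<bar>"
        using \<omega> by (auto simp: chain_ok_def not_le)
      then have "\<omega> \<in> E k" using \<omega> by (auto simp: E_def intro!: bexI[of _ "(a, b)"])
      then show ?thesis by blast
    qed
  qed
  have pE0: "prob E0 \<le> card (N 0) * \<sigma> / R\<^sup>2"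
  proof -
    have "prob E0 \<le> (\<Sum>a\<in>N 0. prob {\<omega> \<in> space M. R < \<bar>u \<omega> a\<bar>})"
      unfolding E0_def using finite_net m0 D by (intro measure_UNION_le) auto
    also have "\<dots> \<le> (\<Sum>a\<in>N 0. \<sigma> / R\<^sup>2)"
      using R \<sigma> var u D by (intro sum_mono second_moment_tail) auto
    finally show ?thesis by simp
  qed
  have pE: "prob (E k) \<le> 2 * C\<^sup>2 * x ^ Suc k" for k
  proof -
    have pair: "prob {\<omega> \<in> space M. R * 2 ^ k * dist a b < \<bar>u \<omega> a - u \<omega> b\<bar>} \<le> 2 * exp (- R\<^sup>2 / (2 * K\<^sup>2)) ^ Suc k"
      if ab: "a \<in> N (Suc k)" "b \<in> N (Suc k)" for a b
    proof (cases "a = b")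
      case True
      then show ?thesis by simp
    next
      case False
      then have d: "0 < dist a b" by simp
      have [measurable]: "(\<lambda>\<omega>. u \<omega> a) \<in> borel_measurable M" "(\<lambda>\<omega>. u \<omega> b) \<in> borel_measurable M"
        using u D ab by blast+
      have "prob {\<omega> \<in> space M. R * 2 ^ k * dist a b < \<bar>u \<omega> a - u \<omega> b\<bar>}
        \<le> 2 * exp (- (R * 2 ^ k * dist a b)\<^sup>2 / (2 * (K * dist a b)\<^sup>2))"
        using R K d mgf D ab by (intro sub_gaussian_tail) auto
      moreover have "- (R * 2 ^ k * dist a b)\<^sup>2 / (2 * (K * dist a b)\<^sup>2) = (2 ^ k)\<^sup>2 * (- R\<^sup>2 / (2 * K\<^sup>2))"
        using d K by (simp add: power_mult_distrib)
      \<comment> \<open>The factor 4 ^ k is weakened to k + 1, so that the bound becomes a power of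
        a fixed number with the same exponent as that of q.\<close>
      moreover have "(2 ^ k)\<^sup>2 * (- R\<^sup>2 / (2 * K\<^sup>2)) \<le> real (Suc k) * (- R\<^sup>2 / (2 * K\<^sup>2))"
      proof (rule mult_right_mono_neg)
        have "Suc k \<le> 2 ^ k" by (metis Suc_leI less_exp)
        then have "real (Suc k) \<le> 2 ^ k" by (metis of_nat_le_iff of_nat_numeral of_nat_power)
        also have "\<dots> \<le> (2 ^ k)\<^sup>2" by (simp add: power2_eq_square)
        finally show "real (Suc k) \<le> (2 ^ k)\<^sup>2" .
      qed simp
      ultimately have "prob {\<omega> \<in> space M. R * 2 ^ k * dist a b < \<bar>u \<omega> a - u \<omega> b\<bar>}
        \<le> 2 * exp (real (Suc k) * (- R\<^sup>2 / (2 * K\<^sup>2)))"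
        by (smt (verit) exp_le_cancel_iff)
      then show ?thesis by (simp only: exp_of_nat_mult)
    qed
    have "prob (E k) \<le> (\<Sum>p\<in>N (Suc k) \<times> N (Suc k). prob {\<omega> \<in> space M. R * 2 ^ k * dist (fst p) (snd p) < \<bar>u \<omega>
      (fst p) - u \<omega> (snd p)\<bar>})"
      unfolding E_def
    proof (rule measure_UNION_le)
      fix p assume p: "p \<in> N (Suc k) \<times> N (Suc k)"
      then have "fst p \<in> D" "snd p \<in> D" using D by (auto simp: mem_Times_iff)
      then show "{\<omega> \<in> space M. R * 2 ^ k * dist (fst p) (snd p) < \<bar>u \<omega> (fst p) - u \<omega> (snd p)\<bar>} \<in> sets M"
        by (rule mpair)
    qed (intro finite_cartesian_product finite_net)
    also have "\<dots> \<le> (\<Sum>p\<in>N (Suc k) \<times> N (Suc k). 2 * exp (- R\<^sup>2 / (2 * K\<^sup>2)) ^ Suc k)"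
      by (intro sum_mono pair) auto
    also have "\<dots> = real (card (N (Suc k))) * real (card (N (Suc k))) * (2 * exp (- R\<^sup>2 / (2 * K\<^sup>2)) ^ Suc k)"
      by (simp add: card_cartesian_product)
    also have "\<dots> \<le> (C * q ^ Suc k) * (C * q ^ Suc k) * (2 * exp (- R\<^sup>2 / (2 * K\<^sup>2)) ^ Suc k)"
      using C_nonneg q_ge_1 by (intro mult_right_mono mult_mono card_net) auto
    also have "\<dots> = 2 * C\<^sup>2 * x ^ Suc k"
      unfolding x_def power_mult_distrib by (simp add: power2_eq_square power_mult_distrib)
    finally show ?thesis .
  qed
  have sums: "(\<lambda>k. 2 * C\<^sup>2 * x ^ Suc k) sums (2 * C\<^sup>2 * (x * (1 / (1 - x))))"
    unfolding power_Suc using x by (intro sums_mult geometric_sums) auto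
  have summ: "summable (\<lambda>k. prob (E k))"
    by (rule summable_comparison_test'[OF sums_summable[OF sums], of 0]) (simp add: pE del: power_Suc)
  have "prob (\<Union>k. E k) \<le> (\<Sum>k. prob (E k))"
    using Em summ by (intro finite_measure_subadditive_countably) auto
  also have "\<dots> \<le> (\<Sum>k. 2 * C\<^sup>2 * x ^ Suc k)"
    using pE summ sums_summable[OF sums] by (rule suminf_le)
  also have "\<dots> = 2 * C\<^sup>2 * (x * (1 / (1 - x)))" using sums by (rule sums_unique[symmetric])
  also have "\<dots> \<le> 2 * C\<^sup>2 * (x * 2)"
    using x by (intro mult_left_mono) (auto simp: field_simps)
  finally have pU: "prob (\<Union>k. E k) \<le> 4 * C\<^sup>2 * x" by simp
  have "prob {\<omega> \<in> space M. \<not> chain_ok N R (u \<omega>)} \<le> prob (E0 \<union> (\<Union>k. E k))"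
    using sub Em E0m by (intro finite_measure_mono) auto
  also have "\<dots> \<le> prob E0 + prob (\<Union>k. E k)"
    using Em E0m by (intro measure_subadditive) auto
  also have "\<dots> \<le> card (N 0) * \<sigma> / R\<^sup>2 + 4 * C\<^sup>2 * x" using pE0 pU by linarith
  finally show ?thesis by (simp add: x_def)
qed

text \<open>Both expressions tend to 0 as R grows. Only K, \<sigma> and the nets enter, so one
  radius serves all processes that share these constants.\<close>

lemma exists_chain_radius:
  fixes \<sigma> :: real
  assumes "0 < K" "0 < e"
  shows "\<exists>R>0. q\<^sup>2 * exp (- R\<^sup>2 / (2 * K\<^sup>2)) \<le> 1 / 2 \<and>
    card (N 0) * \<sigma> / R\<^sup>2 + 4 * C\<^sup>2 * (q\<^sup>2 * exp (- R\<^sup>2 / (2 * K\<^sup>2))) \<le> e"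
proof -
  have sq: "LIM R at_top. R\<^sup>2 :> (at_top :: real filter)" by (intro filterlim_pow_at_top filterlim_ident) simp
  have "((\<lambda>R. card (N 0) * \<sigma> / R\<^sup>2) \<longlongrightarrow> 0) at_top"
    using sq by (intro tendsto_divide_0[OF tendsto_const]) (rule filterlim_at_top_imp_at_infinity)
  moreover have "((\<lambda>R. exp (- R\<^sup>2 / (2 * K\<^sup>2))) \<longlongrightarrow> 0) at_top"
  proof -
    have "LIM R at_top. (1 / (2 * K\<^sup>2)) * R\<^sup>2 :> at_top"
      using assms(1) by (intro filterlim_tendsto_pos_mult_at_top[OF tendsto_const _ sq]) simp
    then have "LIM R at_top. - ((1 / (2 * K\<^sup>2)) * R\<^sup>2) :> at_bot" by (simp add: filterlim_uminus_at_bot)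
    from filterlim_compose[OF exp_at_bot this] show ?thesis by simp
  qed
  note ex = this
  ultimately have "((\<lambda>R. card (N 0) * \<sigma> / R\<^sup>2 + 4 * C\<^sup>2 * (q\<^sup>2 * exp (- R\<^sup>2 / (2 * K\<^sup>2)))) \<longlongrightarrow> 0
    + 4 * C\<^sup>2 * (q\<^sup>2 * 0)) at_top"
    by (intro tendsto_intros)
  then have 1: "\<forall>\<^sub>F R in at_top. card (N 0) * \<sigma> / R\<^sup>2 + 4 * C\<^sup>2 * (q\<^sup>2 * exp (- R\<^sup>2 / (2 * K\<^sup>2))) < e"
    using assms(2) by (intro order_tendstoD) auto
  have "((\<lambda>R. q\<^sup>2 * exp (- R\<^sup>2 / (2 * K\<^sup>2))) \<longlongrightarrow> q\<^sup>2 * 0) at_top" by (intro tendsto_intros ex)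
  then have 2: "\<forall>\<^sub>F R in at_top. q\<^sup>2 * exp (- R\<^sup>2 / (2 * K\<^sup>2)) < 1 / 2"
    by (intro order_tendstoD) auto
  have "\<forall>\<^sub>F R in at_top. 0 < R \<and> q\<^sup>2 * exp (- R\<^sup>2 / (2 * K\<^sup>2)) \<le> 1 / 2 \<and>
    card (N 0) * \<sigma> / R\<^sup>2 + 4 * C\<^sup>2 * (q\<^sup>2 * exp (- R\<^sup>2 / (2 * K\<^sup>2))) \<le> e"
    using 1 2 eventually_gt_at_top[of 0] by eventually_elim auto
  then show ?thesis using eventually_happens[of _ at_top] by fastforce
qed

end

section \<open>Gaussian sequences with given covariance\<close>

fun gram_schmidt :: "'e measure \<Rightarrow> (nat \<Rightarrow> 'e \<Rightarrow> real) \<Rightarrow> nat \<Rightarrow> 'e \<Rightarrow> real" where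
  "gram_schmidt P h i = (\<lambda>x.
     (h i x - (\<Sum>j\<in>{..<i}. (\<integral>y. h i y * gram_schmidt P h j y \<partial>P) * gram_schmidt P h j x))
     / sqrt (\<integral>z. (h i z - (\<Sum>j\<in>{..<i}. (\<integral>y. h i y * gram_schmidt P h j y \<partial>P) * gram_schmidt P h j z))\<^sup>2 \<partial>P))"

declare gram_schmidt.simps [simp del]

definition square_integrable :: "'e measure \<Rightarrow> ('e \<Rightarrow> real) \<Rightarrow> bool"
  where "square_integrable P f \<longleftrightarrow> f \<in> borel_measurable P \<and> integrable P (\<lambda>x. (f x)\<^sup>2)"

lemma square_integrable_mult:
  assumes "square_integrable P f" "square_integrable P g"
  shows "integrable P (\<lambda>x. f x * g x)"
proof -
  have [measurable]: "f \<in> borel_measurable P" "g \<in> borel_measurable P"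
    using assms by (auto simp: square_integrable_def)
  have "integrable P (\<lambda>x. (f x)\<^sup>2 + (g x)\<^sup>2)"
    using assms by (auto simp: square_integrable_def)
  then show ?thesis
  proof (rule Bochner_Integration.integrable_bound)
    have "\<bar>f x * g x\<bar> \<le> (f x)\<^sup>2 + (g x)\<^sup>2" for x
    proof -
      have "2 * (\<bar>f x\<bar> * \<bar>g x\<bar>) \<le> \<bar>f x\<bar>\<^sup>2 + \<bar>g x\<bar>\<^sup>2" using sum_squares_bound[of "\<bar>f x\<bar>" "\<bar>g x\<bar>"]
        by (simp add: mult.assoc)
      moreover have "0 \<le> \<bar>f x\<bar> * \<bar>g x\<bar>" by simp
      ultimately show ?thesis unfolding abs_mult power2_abs by linarith
    qed
    then show "AE x in P. norm (f x * g x) \<le> norm ((f x)\<^sup>2 + (g x)\<^sup>2)" by simp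
  qed measurable
qed

lemma square_integrable_scale:
  "square_integrable P f \<Longrightarrow> square_integrable P (\<lambda>x. c * f x)"
  by (auto simp: square_integrable_def power_mult_distrib)

lemma square_integrable_add:
  assumes "square_integrable P f" "square_integrable P g"
  shows "square_integrable P (\<lambda>x. f x + g x)"
proof -
  have "integrable P (\<lambda>x. (f x)\<^sup>2 + (g x)\<^sup>2 + 2 * (f x * g x))"
    using assms square_integrable_mult[OF assms] by (auto simp: square_integrable_def)
  then show ?thesis using assms by (auto simp: square_integrable_def power2_sum mult.assoc)
qed

lemma square_integrable_diff:
  assumes "square_integrable P f" "square_integrable P g"
  shows "square_integrable P (\<lambda>x. f x - g x)"
  using square_integrable_add[OF assms(1) square_integrable_scale[OF assms(2), of "-1"]] by simp

lemma square_integrable_sum: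
  "(\<And>i. i \<in> I \<Longrightarrow> square_integrable P (f i)) \<Longrightarrow> square_integrable P (\<lambda>x. \<Sum>i\<in>I. f i x)"
proof (induction I rule: infinite_finite_induct)
  case (insert i I)
  then show ?case by (auto intro: square_integrable_add)
qed (auto simp: square_integrable_def)

lemma integral_mult_sum:
  assumes "square_integrable P g" "\<And>i. i \<in> I \<Longrightarrow> square_integrable P (f i)"
  shows "(\<integral>x. g x * (\<Sum>i\<in>I. a i * f i x) \<partial>P) = (\<Sum>i\<in>I. a i * (\<integral>x. g x * f i x \<partial>P))"
proof -
  have "(\<integral>x. g x * (\<Sum>i\<in>I. a i * f i x) \<partial>P) = (\<integral>x. (\<Sum>i\<in>I. a i * (g x * f i x)) \<partial>P)"
    by (simp add: sum_distrib_left mult_ac)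
  also have "\<dots> = (\<Sum>i\<in>I. \<integral>x. a i * (g x * f i x) \<partial>P)"
    using square_integrable_mult[OF assms(1)] assms(2) by (intro Bochner_Integration.integral_sum) auto
  finally show ?thesis by simp
qed

context
  fixes P :: "'e measure" and h :: "nat \<Rightarrow> 'e \<Rightarrow> real"
  assumes h: "\<And>i. square_integrable P (h i)"
begin

abbreviation "gs \<equiv> gram_schmidt P h"

definition gs_residual :: "nat \<Rightarrow> 'e \<Rightarrow> real"
  where "gs_residual i x = h i x - (\<Sum>j<i. (\<integral>y. h i y * gs j y \<partial>P) * gs j x)"

definition gs_norm :: "nat \<Rightarrow> real"
  where "gs_norm i = sqrt (\<integral>x. (gs_residual i x)\<^sup>2 \<partial>P)"

text \<open>The Cholesky factor of the Gram matrix of the functions \<open>h i\<close> in L2(P):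
  lower triangular, possibly with zeros on the diagonal.\<close>

definition gs_coeff :: "nat \<Rightarrow> nat \<Rightarrow> real"
  where "gs_coeff i j = (if j < i then \<integral>y. h i y * gs j y \<partial>P else if j = i then gs_norm i else 0)"

lemma gs_eq: "gs i = (\<lambda>x. gs_residual i x / gs_norm i)"
  by (subst gram_schmidt.simps) (simp add: gs_residual_def gs_norm_def fun_eq_iff)

lemma gs_square_integrable: "square_integrable P (gs i)"
proof (induction i rule: less_induct)
  case (less i)
  then have "square_integrable P (gs_residual i)"
    unfolding gs_residual_def
    by (intro square_integrable_diff h square_integrable_sum square_integrable_scale) auto
  from square_integrable_scale[OF this, of "1 / gs_norm i"] show ?case unfolding gs_eq by simp
qed

lemma residual_square_integrable: "square_integrable P (gs_residual i)"
  unfolding gs_residual_def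
  by (intro square_integrable_diff h square_integrable_sum square_integrable_scale gs_square_integrable)

lemma gs_norm_sq: "(gs_norm i)\<^sup>2 = (\<integral>x. (gs_residual i x)\<^sup>2 \<partial>P)"
  unfolding gs_norm_def by (rule real_sqrt_pow2) simp

lemma gs_norm_eq_0: "gs_norm i = 0 \<Longrightarrow> AE x in P. gs_residual i x = 0"
  using integral_nonneg_eq_0_iff_AE[of P "\<lambda>x. (gs_residual i x)\<^sup>2"] residual_square_integrable[of i]
  by (simp add: gs_norm_def square_integrable_def)

text \<open>At a degenerate step the residual vanishes only almost everywhere, whereas
  \<open>gs i\<close> is 0 everywhere.\<close>

lemma residual_eq: "AE x in P. gs_residual i x = gs_norm i * gs i x"
proof (cases "gs_norm i = 0")
  case True
  then show ?thesis using gs_norm_eq_0[OF True] by simp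
qed (simp add: gs_eq)

lemma gs_self: "(\<integral>x. gs i x * gs i x \<partial>P) = (if gs_norm i = 0 then 0 else 1)"
proof -
  have "(\<integral>x. gs i x * gs i x \<partial>P) = (\<integral>x. (gs_residual i x)\<^sup>2 / (gs_norm i)\<^sup>2 \<partial>P)"
    by (simp add: gs_eq power2_eq_square)
  then show ?thesis by (simp add: gs_norm_sq[symmetric])
qed

text \<open>If \<open>gs_norm j = 0\<close> then \<open>gs j\<close> is \<open>0\<close>, by division by zero, so degenerate steps do no harm.\<close>

lemma gs_orthogonal: "j < i \<Longrightarrow> (\<integral>x. gs i x * gs j x \<partial>P) = 0"
proof (induction i arbitrary: j rule: less_induct)
  case (less i)
  have orth: "(\<integral>x. gs j x * gs l x \<partial>P) = (if l = j then \<integral>x. gs j x * gs j x \<partial>P else 0)" if "l < i" for l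
  proof (cases l j rule: linorder_cases)
    case less
    then show ?thesis using \<open>j < i\<close> less.IH by auto
  next
    case greater
    then have "(\<integral>x. gs l x * gs j x \<partial>P) = 0" using that less.IH by auto
    then show ?thesis using greater by (simp add: mult.commute)
  qed simp
  have "(\<integral>x. gs_residual i x * gs j x \<partial>P)
    = (\<integral>x. h i x * gs j x \<partial>P) - (\<integral>x. gs j x * (\<Sum>l<i. (\<integral>y. h i y * gs l y \<partial>P) * gs l x) \<partial>P)"
    unfolding gs_residual_def left_diff_distrib
    by (subst Bochner_Integration.integral_diff)
      (auto simp: mult.commute[of "sum _ _"] intro!: square_integrable_mult h gs_square_integrable
        square_integrable_sum
         square_integrable_scale)
  also have "(\<integral>x. gs j x * (\<Sum>l<i. (\<integral>y. h i y * gs l y \<partial>P) * gs l x) \<partial>P)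
    = (\<Sum>l<i. (\<integral>y. h i y * gs l y \<partial>P) * (\<integral>x. gs j x * gs l x \<partial>P))"
    by (rule integral_mult_sum) (rule gs_square_integrable)+
  also have "\<dots> = (\<Sum>l<i. if l = j then (\<integral>y. h i y * gs j y \<partial>P) * (\<integral>x. gs j x * gs j x \<partial>P) else 0)"
  proof (rule sum.cong[OF refl])
    fix l assume "l \<in> {..<i}"
    then have "l < i" by simp
    show "(\<integral>y. h i y * gs l y \<partial>P) * (\<integral>x. gs j x * gs l x \<partial>P)
      = (if l = j then (\<integral>y. h i y * gs j y \<partial>P) * (\<integral>x. gs j x * gs j x \<partial>P) else 0)"
    proof (cases "l = j")
      case False
      then show ?thesis using orth[OF \<open>l < i\<close>] by simp
    qed simp
  qed
  also have "\<dots> = (\<integral>y. h i y * gs j y \<partial>P) * (\<integral>x. gs j x * gs j x \<partial>P)"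
    using less.prems by simp
  also have "\<dots> = (\<integral>y. h i y * gs j y \<partial>P)"
    by (cases "gs_norm j = 0") (simp add: gs_eq, simp add: gs_self)
  finally have "(\<integral>x. gs_residual i x * gs j x \<partial>P) = 0" by simp
  then show ?case by (subst gs_eq) simp
qed

lemma gs_inner_coeff: "j \<le> i \<Longrightarrow> (\<integral>x. h i x * gs j x \<partial>P) = gs_coeff i j"
proof (cases "j = i")
  case True
  have "(\<integral>x. gs i x * (\<Sum>l<i. (\<integral>y. h i y * gs l y \<partial>P) * gs l x) \<partial>P) = 0"
    by (subst integral_mult_sum) (auto intro: gs_square_integrable simp: gs_orthogonal)
  moreover have "(\<integral>x. h i x * gs i x \<partial>P)
    = (\<integral>x. gs_residual i x * gs i x \<partial>P) + (\<integral>x. gs i x * (\<Sum>l<i. (\<integral>y. h i y * gs l y \<partial>P) * gs l x) \<partial>P)"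
  proof -
    define S where "S x = (\<Sum>l<i. (\<integral>y. h i y * gs l y \<partial>P) * gs l x)" for x
    have "square_integrable P S"
      unfolding S_def by (intro square_integrable_sum square_integrable_scale gs_square_integrable)
    then have "integrable P (\<lambda>x. gs i x * S x)" by (intro square_integrable_mult gs_square_integrable)
    moreover have "integrable P (\<lambda>x. gs_residual i x * gs i x)"
      by (intro square_integrable_mult gs_square_integrable residual_square_integrable)
    moreover have "h i x * gs i x = gs_residual i x * gs i x + gs i x * S x" for x
      unfolding gs_residual_def S_def by (simp only: left_diff_distrib mult.commute[of "gs i x" "sum _ _"])
    ultimately show ?thesis unfolding S_def[symmetric] by simp
  qed
  moreover have "(\<integral>x. gs_residual i x * gs i x \<partial>P) = gs_norm i"
  proof -
    have "(\<integral>x. gs_residual i x * gs i x \<partial>P) = (\<integral>x. (gs_residual i x)\<^sup>2 / gs_norm i \<partial>P)"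
      by (simp add: gs_eq power2_eq_square)
    \<comment> \<open>For norm 0 the quotient is 0 as well, so the degenerate case needs no separate
      treatment.\<close>
    also have "\<dots> = (gs_norm i)\<^sup>2 / gs_norm i" by (simp add: gs_norm_sq)
    finally show ?thesis by (simp add: power2_eq_square)
  qed
  ultimately show ?thesis using True by (simp add: gs_coeff_def)
qed (simp add: gs_coeff_def)

lemma h_expansion: "AE x in P. h i x = (\<Sum>j\<le>i. gs_coeff i j * gs j x)"
  using residual_eq[of i]
proof eventually_elim
  case (elim x)
  have "(\<Sum>j\<le>i. gs_coeff i j * gs j x) = (\<Sum>j<i. gs_coeff i j * gs j x) + gs_norm i * gs i x"
    by (simp add: lessThan_Suc_atMost[symmetric] gs_coeff_def)
  also have "(\<Sum>j<i. gs_coeff i j * gs j x) = (\<Sum>j<i. (\<integral>y. h i y * gs j y \<partial>P) * gs j x)"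
    by (intro sum.cong) (auto simp: gs_coeff_def)
  finally show ?case using elim by (simp add: gs_residual_def)
qed

text \<open>Only the function of smaller index is expanded; its coefficients stop before the range
  in which the scalar products with the other function are unknown. The zeros above the diagonal
  allow a common range up to m.\<close>

lemma covariance_factorization:
  assumes "i \<le> m" "k \<le> m"
  shows "(\<integral>x. h i x * h k x \<partial>P) = (\<Sum>j\<le>m. gs_coeff i j * gs_coeff k j)"
proof -
  have le: "(\<integral>x. h i x * h k x \<partial>P) = (\<Sum>j\<le>m. gs_coeff i j * gs_coeff k j)" if "i \<le> k" "k \<le> m" for i k
  proof -
    have "(\<integral>x. h i x * h k x \<partial>P) = (\<integral>x. h k x * (\<Sum>j\<le>i. gs_coeff i j * gs j x) \<partial>P)"
    proof (rule integral_cong_AE)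
      show "AE x in P. h i x * h k x = h k x * (\<Sum>j\<le>i. gs_coeff i j * gs j x)"
        using h_expansion[of i] by eventually_elim simp
      have [measurable]: "h i \<in> borel_measurable P" "gs i \<in> borel_measurable P" for i
        using h gs_square_integrable by (auto simp: square_integrable_def)
      show "(\<lambda>x. h i x * h k x) \<in> borel_measurable P"
        "(\<lambda>x. h k x * (\<Sum>j\<le>i. gs_coeff i j * gs j x)) \<in> borel_measurable P" by measurable
    qed
    also have "\<dots> = (\<Sum>j\<le>i. gs_coeff i j * (\<integral>x. h k x * gs j x \<partial>P))"
      by (rule integral_mult_sum) (rule h gs_square_integrable)+
    also have "\<dots> = (\<Sum>j\<le>i. gs_coeff i j * gs_coeff k j)"
      using that by (intro sum.cong) (auto simp: gs_inner_coeff)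
    also have "\<dots> = (\<Sum>j\<le>m. gs_coeff i j * gs_coeff k j)"
      using that by (intro sum.mono_neutral_left) (auto simp: gs_coeff_def)
    finally show ?thesis .
  qed
  show ?thesis
  proof (cases "i \<le> k")
    case False
    then show ?thesis using le[of k i] assms by (simp add: mult.commute)
  qed (use le assms in auto)
qed

text \<open>The map \<iota> need not be injective, so that a combination may name the same function
  twice.\<close>

lemma variance_factorization:
  assumes F: "finite F" and m: "\<And>i. i \<in> F \<Longrightarrow> \<iota> i \<le> m"
  shows "(\<integral>x. (\<Sum>i\<in>F. t i * h (\<iota> i) x)\<^sup>2 \<partial>P) = (\<Sum>j\<le>m. (\<Sum>i\<in>F. t i * gs_coeff (\<iota> i) j)\<^sup>2)"
proof -
  have "(\<integral>x. (\<Sum>i\<in>F. t i * h (\<iota> i) x)\<^sup>2 \<partial>P) = (\<integral>x. (\<Sum>i\<in>F. t i * h (\<iota> i) x) * (\<Sum>i\<in>F. t i * h (\<iota> i) x) \<partial>P)"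
    by (simp add: power2_eq_square)
  also have "\<dots> = (\<Sum>i\<in>F. t i * (\<integral>x. (\<Sum>k\<in>F. t k * h (\<iota> k) x) * h (\<iota> i) x \<partial>P))"
    by (intro integral_mult_sum square_integrable_sum square_integrable_scale h)
  also have "\<dots> = (\<Sum>i\<in>F. t i * (\<Sum>k\<in>F. t k * (\<integral>x. h (\<iota> i) x * h (\<iota> k) x \<partial>P)))"
    by (simp only: mult.commute[of "sum _ _"] integral_mult_sum[OF h h])
  also have "\<dots> = (\<Sum>i\<in>F. t i * (\<Sum>k\<in>F. t k * (\<Sum>j\<le>m. gs_coeff (\<iota> i) j * gs_coeff (\<iota> k) j)))"
    using m by (intro sum.cong arg_cong2[where f="(*)"] covariance_factorization refl) auto
  also have "\<dots> = (\<Sum>i\<in>F. \<Sum>k\<in>F. \<Sum>j\<le>m. (t i * gs_coeff (\<iota> i) j) * (t k * gs_coeff (\<iota> k) j))"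
    by (simp add: sum_distrib_left mult_ac)
  also have "\<dots> = (\<Sum>i\<in>F. \<Sum>j\<le>m. \<Sum>k\<in>F. (t i * gs_coeff (\<iota> i) j) * (t k * gs_coeff (\<iota> k) j))"
    by (intro sum.cong refl sum.swap)
  also have "\<dots> = (\<Sum>j\<le>m. \<Sum>i\<in>F. \<Sum>k\<in>F. (t i * gs_coeff (\<iota> i) j) * (t k * gs_coeff (\<iota> k) j))"
    by (rule sum.swap)
  also have "\<dots> = (\<Sum>j\<le>m. (\<Sum>i\<in>F. t i * gs_coeff (\<iota> i) j)\<^sup>2)"
    by (simp add: power2_eq_square sum_product)
  finally show ?thesis .
qed

end

section \<open>Independent standard normal variables\<close>

abbreviation gaussian_sequence :: "(nat \<Rightarrow> real) measure"
  where "gaussian_sequence \<equiv> PiM UNIV (\<lambda>_. std_normal_distribution)"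

lemma prob_space_std_normal: "prob_space std_normal_distribution"
  by (rule prob_space_normal_density) simp

lemma prob_space_gaussian_sequence: "prob_space gaussian_sequence"
  by (intro prob_space_PiM prob_space_std_normal)

lemma gaussian_sequence_component [measurable]: "(\<lambda>\<omega>. \<omega> i) \<in> borel_measurable gaussian_sequence"
  using measurable_component_singleton[of i UNIV "\<lambda>_. std_normal_distribution"] by simp

lemma distr_gaussian_sequence_component: "distr gaussian_sequence borel (\<lambda>\<omega>. \<omega> i) = std_normal_distribution"
proof -
  have "distr gaussian_sequence borel (\<lambda>\<omega>. \<omega> i) = distr gaussian_sequence std_normal_distribution (\<lambda>\<omega>. \<omega> i)"
    by (rule distr_cong) auto
  also have "\<dots> = std_normal_distribution"
    by (rule distr_PiM_component) (auto intro: prob_space_std_normal)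
  finally show ?thesis .
qed

lemma indep_gaussian_sequence: "prob_space.indep_vars gaussian_sequence (\<lambda>_. borel) (\<lambda>i \<omega>. \<omega> i) UNIV"
proof -
  interpret prob_space gaussian_sequence by (rule prob_space_gaussian_sequence)
  have s: "sets (PiM UNIV (\<lambda>_. borel :: real measure)) = sets gaussian_sequence"
    by (intro sets_PiM_cong) auto
  have "distr gaussian_sequence (PiM UNIV (\<lambda>_. borel)) (\<lambda>x. \<lambda>i\<in>UNIV. x i)
    = distr gaussian_sequence gaussian_sequence (\<lambda>x. x)"
    using s by (intro distr_cong) auto
  also have "\<dots> = gaussian_sequence" by (rule distr_id)
  also have "\<dots> = PiM UNIV (\<lambda>i. distr gaussian_sequence borel (\<lambda>\<omega>. \<omega> i))"
    by (simp add: distr_gaussian_sequence_component)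
  finally show ?thesis
    by (subst indep_vars_iff_distr_eq_PiM) auto
qed

lemma char_gaussian_combination:
  "char (distr gaussian_sequence borel (\<lambda>\<omega>. \<Sum>j\<le>m. b j * \<omega> j)) 1 = complex_of_real (exp (- (\<Sum>j\<le>m. (b j)\<^sup>2) / 2))"
proof -
  interpret prob_space gaussian_sequence by (rule prob_space_gaussian_sequence)
  have "indep_vars (\<lambda>_. borel) (\<lambda>j \<omega>. b j * \<omega> j) {..m}"
    using indep_vars_compose2[OF indep_vars_subset[OF indep_gaussian_sequence, of "{..m}"],
        of "\<lambda>j x. b j * x" "\<lambda>_. borel"] by simp
  then have "char (distr gaussian_sequence borel (\<lambda>\<omega>. \<Sum>j\<le>m. b j * \<omega> j)) 1
    = (\<Prod>j\<le>m. char (distr gaussian_sequence borel (\<lambda>\<omega>. b j * \<omega> j)) 1)" by (rule char_distr_sum)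
  also have "\<dots> = (\<Prod>j\<le>m. complex_of_real (exp (- ((b j)\<^sup>2) / 2)))"
  proof (rule prod.cong)
    fix j
    have "distr gaussian_sequence borel (\<lambda>\<omega>. b j * \<omega> j) = distr std_normal_distribution borel (\<lambda>x. b j * x)"
    proof -
      have "distr (distr gaussian_sequence borel (\<lambda>\<omega>. \<omega> j)) borel (\<lambda>x. b j * x)
        = distr gaussian_sequence borel (\<lambda>\<omega>. b j * \<omega> j)"
        by (subst distr_distr) (auto simp: comp_def)
      then show ?thesis by (simp only: distr_gaussian_sequence_component)
    qed
    moreover have "char (distr std_normal_distribution borel (\<lambda>x. b j * x)) 1 = char std_normal_distribution (b j)"
      unfolding char_def by (subst integral_distr) (auto simp: mult.commute)
    ultimately show "char (distr gaussian_sequence borel (\<lambda>\<omega>. b j * \<omega> j)) 1 = complex_of_real (exp (- ((b j)\<^sup>2) / 2))"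
      by (simp add: char_std_normal_distribution)
  qed simp
  also have "\<dots> = complex_of_real (exp (- (\<Sum>j\<le>m. (b j)\<^sup>2) / 2))"
    by (simp add: exp_sum[symmetric] sum_negf sum_divide_distrib flip: of_real_prod)
  finally show ?thesis .
qed

lemma mgf_std_normal:
  "(\<integral>\<^sup>+x. ennreal (exp (s * x)) \<partial>std_normal_distribution) = ennreal (exp (s\<^sup>2 / 2))"
proof -
  have "(\<integral>\<^sup>+x. ennreal (exp (s * x)) \<partial>std_normal_distribution)
    = (\<integral>\<^sup>+x. ennreal (std_normal_density x) * ennreal (exp (s * x)) \<partial>lborel)"
    by (rule nn_integral_density) auto
  also have "\<dots> = (\<integral>\<^sup>+x. ennreal (exp (s\<^sup>2 / 2)) * ennreal (normal_density s 1 x) \<partial>lborel)"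
  proof (rule nn_integral_cong)
    fix x :: real
    \<comment> \<open>Completing the square: the tilted density is a multiple of that of the normal
      law with mean s.\<close>
    have "- x\<^sup>2 / 2 + s * x = s\<^sup>2 / 2 + - (x - s)\<^sup>2 / 2" by (simp add: power2_eq_square field_simps)
    then have "std_normal_density x * exp (s * x) = exp (s\<^sup>2 / 2) * normal_density s 1 x"
      unfolding normal_density_def by (simp add: exp_add[symmetric])
    then show "ennreal (std_normal_density x) * ennreal (exp (s * x))
      = ennreal (exp (s\<^sup>2 / 2)) * ennreal (normal_density s 1 x)"
      by (simp add: ennreal_mult[symmetric])
  qed
  also have "\<dots> = ennreal (exp (s\<^sup>2 / 2)) * (\<integral>\<^sup>+x. ennreal (normal_density s 1 x) \<partial>lborel)"
    by (rule nn_integral_cmult) simp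
  also have "(\<integral>\<^sup>+x. ennreal (normal_density s 1 x) \<partial>lborel) = 1"
  proof -
    interpret prob_space "density lborel (normal_density s 1)" by (rule prob_space_normal_density) simp
    show ?thesis using emeasure_space_1 by (simp add: emeasure_density)
  qed
  finally show ?thesis by simp
qed

lemma mgf_gaussian_combination:
  "(\<integral>\<^sup>+\<omega>. ennreal (exp (\<Sum>j\<le>m. b j * \<omega> j)) \<partial>gaussian_sequence) = ennreal (exp ((\<Sum>j\<le>m. (b j)\<^sup>2) / 2))"
proof -
  interpret prob_space gaussian_sequence by (rule prob_space_gaussian_sequence)
  have "indep_vars (\<lambda>_. borel) (\<lambda>j \<omega>. ennreal (exp (b j * \<omega> j))) {..m}"
    using indep_vars_compose2[OF indep_vars_subset[OF indep_gaussian_sequence, of "{..m}"],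
        of "\<lambda>j x. ennreal (exp (b j * x))" "\<lambda>_. borel"] by simp
  then have "(\<integral>\<^sup>+\<omega>. (\<Prod>j\<le>m. ennreal (exp (b j * \<omega> j))) \<partial>gaussian_sequence)
    = (\<Prod>j\<le>m. \<integral>\<^sup>+\<omega>. ennreal (exp (b j * \<omega> j)) \<partial>gaussian_sequence)"
    by (intro indep_vars_nn_integral) auto
  also have "\<dots> = (\<Prod>j\<le>m. ennreal (exp ((b j)\<^sup>2 / 2)))"
  proof (rule prod.cong)
    fix j
    have "(\<integral>\<^sup>+\<omega>. ennreal (exp (b j * \<omega> j)) \<partial>gaussian_sequence)
      = (\<integral>\<^sup>+x. ennreal (exp (b j * x)) \<partial>distr gaussian_sequence borel (\<lambda>\<omega>. \<omega> j))"
      by (subst nn_integral_distr) auto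
    then show "(\<integral>\<^sup>+\<omega>. ennreal (exp (b j * \<omega> j)) \<partial>gaussian_sequence) = ennreal (exp ((b j)\<^sup>2 / 2))"
      by (simp add: distr_gaussian_sequence_component mgf_std_normal)
  qed simp
  finally show ?thesis
    by (simp add: prod_ennreal exp_sum[symmetric] sum_divide_distrib)
qed

text \<open>Triangular combinations of independent normal variables with the Cholesky coefficients:
  every finite combination has as variance the squared L2 norm of the same combination of functions.
  The characteristic functions identify the limit, the exponential moments feed the chaining
  bound.\<close>

lemma exists_gaussian_sequence:
  assumes h: "\<And>i. square_integrable P (h i)"
  obtains V :: "nat \<Rightarrow> (nat \<Rightarrow> real) \<Rightarrow> real" where
    "\<And>i. V i \<in> borel_measurable gaussian_sequence"
    "\<And>F \<iota> t. finite (F :: nat set) \<Longrightarrow> char (distr gaussian_sequence borel (\<lambda>\<omega>. \<Sum>i\<in>F. t i * V (\<iota> i) \<omega>)) 1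
       = complex_of_real (exp (- (\<integral>x. (\<Sum>i\<in>F. t i * h (\<iota> i) x)\<^sup>2 \<partial>P) / 2))"
    "\<And>F \<iota> t. finite (F :: nat set) \<Longrightarrow> (\<integral>\<^sup>+\<omega>. ennreal (exp (\<Sum>i\<in>F. t i * V (\<iota> i) \<omega>)) \<partial>gaussian_sequence)
       = ennreal (exp ((\<integral>x. (\<Sum>i\<in>F. t i * h (\<iota> i) x)\<^sup>2 \<partial>P) / 2))"
proof -
  define V where "V i \<omega> = (\<Sum>j\<le>i. gs_coeff P h i j * \<omega> j)" for i and \<omega> :: "nat \<Rightarrow> real"
  have *: "\<exists>m. (\<integral>x. (\<Sum>i\<in>F. t i * h (\<iota> i) x)\<^sup>2 \<partial>P) = (\<Sum>j\<le>m. (\<Sum>i\<in>F. t i * gs_coeff P h (\<iota> i) j)\<^sup>2)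
      \<and> (\<forall>\<omega>. (\<Sum>i\<in>F. t i * V (\<iota> i) \<omega>) = (\<Sum>j\<le>m. (\<Sum>i\<in>F. t i * gs_coeff P h (\<iota> i) j) * \<omega> j))"
    if F: "finite F" for F :: "nat set" and \<iota> t
  proof -
    obtain m where m: "\<And>i. i \<in> F \<Longrightarrow> \<iota> i \<le> m"
      using F by (metis finite_imageI finite_nat_set_iff_bounded_le imageI)
    have "(\<Sum>i\<in>F. t i * V (\<iota> i) \<omega>) = (\<Sum>j\<le>m. (\<Sum>i\<in>F. t i * gs_coeff P h (\<iota> i) j) * \<omega> j)" for \<omega>
    proof -
      have "V (\<iota> i) \<omega> = (\<Sum>j\<le>m. gs_coeff P h (\<iota> i) j * \<omega> j)" if "i \<in> F" for i
        unfolding V_def using m[OF that] by (intro sum.mono_neutral_left) (auto simp: gs_coeff_def[OF h])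
      then have "(\<Sum>i\<in>F. t i * V (\<iota> i) \<omega>) = (\<Sum>i\<in>F. \<Sum>j\<le>m. t i * gs_coeff P h (\<iota> i) j * \<omega> j)"
        by (simp add: sum_distrib_left mult.assoc)
      also have "\<dots> = (\<Sum>j\<le>m. \<Sum>i\<in>F. t i * gs_coeff P h (\<iota> i) j * \<omega> j)" by (rule sum.swap)
      finally show ?thesis by (simp add: sum_distrib_right)
    qed
    moreover have "(\<integral>x. (\<Sum>i\<in>F. t i * h (\<iota> i) x)\<^sup>2 \<partial>P) = (\<Sum>j\<le>m. (\<Sum>i\<in>F. t i * gs_coeff P h (\<iota> i) j)\<^sup>2)"
      by (rule variance_factorization[OF h F m])
    ultimately show ?thesis by blast
  qed
  show ?thesis
  proof (rule that[of V])
    show "V i \<in> borel_measurable gaussian_sequence" for i unfolding V_def by measurable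
    show "char (distr gaussian_sequence borel (\<lambda>\<omega>. \<Sum>i\<in>F. t i * V (\<iota> i) \<omega>)) 1
       = complex_of_real (exp (- (\<integral>x. (\<Sum>i\<in>F. t i * h (\<iota> i) x)\<^sup>2 \<partial>P) / 2))" if "finite F" for F :: "nat set" and \<iota> t
      using *[OF that, of t \<iota>] char_gaussian_combination by auto
    show "(\<integral>\<^sup>+\<omega>. ennreal (exp (\<Sum>i\<in>F. t i * V (\<iota> i) \<omega>)) \<partial>gaussian_sequence)
       = ennreal (exp ((\<integral>x. (\<Sum>i\<in>F. t i * h (\<iota> i) x)\<^sup>2 \<partial>P) / 2))" if "finite F" for F :: "nat set" and \<iota> t
      using *[OF that, of t \<iota>] mgf_gaussian_combination by auto
  qed
qed

section \<open>A central limit theorem for Lipschitz classes\<close>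

lemma (in prob_space) expectation_sum_square:
  fixes X :: "nat \<Rightarrow> 'a \<Rightarrow> real"
  assumes ind: "indep_vars (\<lambda>_. borel) X UNIV" and zero: "\<And>i. expectation (X i) = 0"
    and sq: "\<And>i. square_integrable M (X i)"
  shows "expectation (\<lambda>\<omega>. (\<Sum>i<n. X i \<omega>)\<^sup>2) = (\<Sum>i<n. expectation (\<lambda>\<omega>. (X i \<omega>)\<^sup>2))"
proof (induction n)
  case (Suc n)
  let ?S = "\<lambda>\<omega>. \<Sum>i<n. X i \<omega>"
  have S: "square_integrable M ?S" by (intro square_integrable_sum sq)
  have iv: "indep_var borel (X n) borel ?S"
    by (rule indep_vars_sum) (auto intro: indep_vars_subset[OF ind])
  have int: "integrable M (X i)" for i
    by (rule square_integrable_imp_integrable) (use sq[of i] in \<open>auto simp: square_integrable_def\<close>)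
  have "expectation (\<lambda>\<omega>. X n \<omega> * ?S \<omega>) = expectation (X n) * expectation ?S"
    by (intro indep_var_lebesgue_integral iv int Bochner_Integration.integrable_sum)
  then have cross: "expectation (\<lambda>\<omega>. X n \<omega> * ?S \<omega>) = 0" by (simp add: zero)
  have "expectation (\<lambda>\<omega>. (\<Sum>i<Suc n. X i \<omega>)\<^sup>2)
    = expectation (\<lambda>\<omega>. ((?S \<omega>)\<^sup>2 + (X n \<omega>)\<^sup>2) + 2 * (X n \<omega> * ?S \<omega>))"
    by (intro Bochner_Integration.integral_cong) (auto simp: power2_sum algebra_simps)
  also have "\<dots> = expectation (\<lambda>\<omega>. (?S \<omega>)\<^sup>2) + expectation (\<lambda>\<omega>. (X n \<omega>)\<^sup>2)"
    using S sq[of n] square_integrable_mult[OF sq S, of n] cross by (simp add: square_integrable_def)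
  finally show ?case using Suc by simp
qed simp

text \<open>Connects the trigonometric test functions with characteristic functions: the phase
  becomes a rotation before the real part is taken.\<close>

lemma expectation_cos_char:
  assumes "prob_space M" and [measurable]: "X \<in> borel_measurable M"
  shows "(\<integral>\<omega>. cos (X \<omega> + \<theta>) \<partial>M) = Re (cis \<theta> * char (distr M borel X) 1)"
proof -
  interpret prob_space M by fact
  have "char (distr M borel X) 1 = (\<integral>\<omega>. iexp (X \<omega>) \<partial>M)"
    unfolding char_def by (subst integral_distr) auto
  then have "cis \<theta> * char (distr M borel X) 1 = (\<integral>\<omega>. cis \<theta> * iexp (X \<omega>) \<partial>M)" by simp
  moreover have "integrable M (\<lambda>\<omega>. cis \<theta> * iexp (X \<omega>))"
    by (intro integrable_const_bound[of _ 1]) (auto simp: norm_mult)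
  ultimately have "Re (cis \<theta> * char (distr M borel X) 1) = (\<integral>\<omega>. Re (cis \<theta> * iexp (X \<omega>)) \<partial>M)"
    by (simp only: integral_Re)
  also have "\<dots> = (\<integral>\<omega>. cos (X \<omega> + \<theta>) \<partial>M)"
  proof -
    have "cis \<theta> * iexp x = cis (x + \<theta>)" for x
      by (simp add: cis_conv_exp flip: exp_add) (simp add: algebra_simps)
    then show ?thesis by simp
  qed
  finally show ?thesis by simp
qed

lemma (in prob_space) char_clt:
  fixes X :: "nat \<Rightarrow> 'a \<Rightarrow> real"
  assumes ind: "indep_vars (\<lambda>_. borel) X UNIV" and zero: "\<And>i. expectation (X i) = 0"
    and sq: "\<And>i. square_integrable M (X i)" and distr: "\<And>i. distr M borel (X i) = \<mu>"
    and v: "\<And>i. expectation (\<lambda>\<omega>. (X i \<omega>)\<^sup>2) = v"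
  shows "(\<lambda>n. char (distr M borel (\<lambda>\<omega>. (\<Sum>i<n. X i \<omega>) / sqrt (real n))) 1) \<longlonglongrightarrow> complex_of_real (exp (- v / 2))"
proof -
  have [measurable]: "X i \<in> borel_measurable M" for i using sq by (simp add: square_integrable_def)
  have "0 \<le> v" using v[of 0, symmetric] by simp
  show ?thesis
  proof (cases "v = 0")
    \<comment> \<open>The normalized central limit theorem needs positive variance. For variance 0
      the variables vanish almost surely, and so do their sums.\<close>
    case True
    have "AE \<omega> in M. X i \<omega> = 0" for i
      using integral_nonneg_eq_0_iff_AE[of M "\<lambda>\<omega>. (X i \<omega>)\<^sup>2"] sq[of i] v[of i] True
      by (simp add: square_integrable_def)
    then have "AE \<omega> in M. \<forall>i. X i \<omega> = 0" by (simp add: AE_all_countable)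
    then have "AE \<omega> in M. (\<Sum>i<n. X i \<omega>) / sqrt (real n) = 0" for n by eventually_elim simp
    then have "distr M borel (\<lambda>\<omega>. (\<Sum>i<n. X i \<omega>) / sqrt (real n)) = distr M borel (\<lambda>_. 0)" for n
      by (intro distr_cong_AE) auto
    moreover have "char (distr M borel (\<lambda>_. 0)) 1 = 1"
      unfolding char_def by (subst integral_distr) (auto simp: prob_space)
    ultimately show ?thesis using True by simp
  next
    case False
    define \<sigma> where "\<sigma> = sqrt v"
    have \<sigma>: "0 < \<sigma>" "\<sigma>\<^sup>2 = v" using False \<open>0 \<le> v\<close> by (auto simp: \<sigma>_def)
    let ?S = "\<lambda>n \<omega>. (\<Sum>i<n. X i \<omega>) / sqrt (real n * \<sigma>\<^sup>2)"
    have "weak_conv_m (\<lambda>n. distr M borel (?S n)) std_normal_distribution"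
      using ind zero \<sigma> sq distr v by (intro central_limit_theorem_zero_mean) (auto simp: square_integrable_def)
    \<comment> \<open>Evaluating the characteristic function at \<sigma> instead of 1 undoes the
      division by \<sigma>.\<close>
    then have "(\<lambda>n. char (distr M borel (?S n)) \<sigma>) \<longlonglongrightarrow> char std_normal_distribution \<sigma>"
      by (intro levy_continuity1 real_distribution_distr real_dist_normal_dist) auto
    moreover have "char (distr M borel (?S n)) \<sigma> = char (distr M borel (\<lambda>\<omega>. (\<Sum>i<n. X i \<omega>) / sqrt (real n))) 1" for n
    proof -
      have "\<sigma> * ?S n \<omega> = (\<Sum>i<n. X i \<omega>) / sqrt (real n)" for \<omega>
        using \<sigma>(1) by (simp add: real_sqrt_mult)
      then show ?thesis unfolding char_def
        by (subst (1 2) integral_distr) (auto simp flip: of_real_mult)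
    qed
    ultimately show ?thesis by (simp add: char_std_normal_distribution \<sigma>)
  qed
qed

section \<open>The empirical process of a Lipschitz class of functions\<close>

locale lipschitz_class = prob_space M for M :: "'b measure" +
  fixes P :: "'e::topological_space measure" and err :: "nat \<Rightarrow> 'b \<Rightarrow> 'e"
    and Z :: "'z::euclidean_space set" and q :: "'z \<Rightarrow> 'e \<Rightarrow> real" and L :: real
  assumes indep_err: "indep_vars (\<lambda>_. borel) err UNIV" and distr_err: "distr M borel (err i) = P"
    and compact_Z: "compact Z" and Z_nonempty: "Z \<noteq> {}"
    and q_meas: "z \<in> Z \<Longrightarrow> q z \<in> borel_measurable borel"
    and q_lipschitz: "z \<in> Z \<Longrightarrow> z' \<in> Z \<Longrightarrow> \<bar>q z e - q z' e\<bar> \<le> L * dist z z'" and L_pos: "0 < L"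
    and q_square_integrable: "z \<in> Z \<Longrightarrow> integrable P (\<lambda>e. (q z e)\<^sup>2)"
begin

definition m :: "'z \<Rightarrow> real" where "m z = (\<integral>e. q z e \<partial>P)"

definition h :: "'z \<Rightarrow> 'e \<Rightarrow> real" where "h z e = q z e - m z"

definition G :: "nat \<Rightarrow> 'b \<Rightarrow> 'z \<Rightarrow> real"
  where "G n \<omega> z = (\<Sum>i<n. h z (err i \<omega>)) / sqrt (real n)"

lemma err_meas [measurable]: "err i \<in> borel_measurable M"
  using indep_err by (simp add: indep_vars_def2)

lemma sets_P: "sets P = sets borel"
  unfolding distr_err[of 0, symmetric] by simp

lemma prob_space_P: "prob_space P"
  unfolding distr_err[of 0, symmetric] by (rule prob_space_distr) simp

lemma q_meas_P: "z \<in> Z \<Longrightarrow> q z \<in> borel_measurable P"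
  using q_meas by (simp add: measurable_cong_sets[OF sets_P refl])

lemma q_sq: "z \<in> Z \<Longrightarrow> square_integrable P (q z)"
  using q_meas_P q_square_integrable by (simp add: square_integrable_def)

lemma q_integrable: "z \<in> Z \<Longrightarrow> integrable P (q z)"
proof -
  interpret P: prob_space P by (rule prob_space_P)
  show "z \<in> Z \<Longrightarrow> integrable P (q z)"
    by (rule P.square_integrable_imp_integrable) (auto intro: q_meas_P q_square_integrable)
qed

lemma m_lipschitz:
  assumes "z \<in> Z" "z' \<in> Z"
  shows "\<bar>m z - m z'\<bar> \<le> L * dist z z'"
proof -
  interpret P: prob_space P by (rule prob_space_P)
  have "\<bar>m z - m z'\<bar> = \<bar>\<integral>e. q z e - q z' e \<partial>P\<bar>"
    using q_integrable assms by (simp add: m_def)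
  also have "\<dots> \<le> (\<integral>e. \<bar>q z e - q z' e\<bar> \<partial>P)" by (rule integral_abs_bound)
  also have "\<dots> \<le> (\<integral>e. L * dist z z' \<partial>P)"
    using q_integrable q_lipschitz assms by (intro integral_mono) auto
  finally show ?thesis by (simp add: P.prob_space)
qed

lemma h_lipschitz: "z \<in> Z \<Longrightarrow> z' \<in> Z \<Longrightarrow> \<bar>h z e - h z' e\<bar> \<le> 2 * L * dist z z'"
  using q_lipschitz[of z z' e] m_lipschitz[of z z'] unfolding h_def by linarith

lemma h_meas: "z \<in> Z \<Longrightarrow> h z \<in> borel_measurable borel"
  unfolding h_def using q_meas by (intro borel_measurable_diff) auto

lemma h_sq: "z \<in> Z \<Longrightarrow> square_integrable P (h z)"
proof -
  interpret P: prob_space P by (rule prob_space_P)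
  have "square_integrable P (\<lambda>_. m z)" by (simp add: square_integrable_def)
  then show "z \<in> Z \<Longrightarrow> square_integrable P (h z)" unfolding h_def by (intro square_integrable_diff q_sq)
qed

lemma integral_P: "f \<in> borel_measurable borel \<Longrightarrow> (\<integral>\<omega>. f (err i \<omega>) \<partial>M) = (\<integral>e. f e \<partial>P)" for f :: "'e \<Rightarrow> real"
  unfolding distr_err[of i, symmetric] by (subst integral_distr) auto

lemma integrable_P: "f \<in> borel_measurable borel \<Longrightarrow> integrable M (\<lambda>\<omega>. f (err i \<omega>)) = integrable P f" for f ::
  "'e \<Rightarrow> real"
  unfolding distr_err[of i, symmetric] by (subst integrable_distr_eq) auto

lemma h_mean: "z \<in> Z \<Longrightarrow> (\<integral>e. h z e \<partial>P) = 0"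
proof -
  interpret P: prob_space P by (rule prob_space_P)
  show "z \<in> Z \<Longrightarrow> (\<integral>e. h z e \<partial>P) = 0"
    unfolding h_def using q_integrable by (simp add: P.prob_space m_def)
qed

lemma indep_compose:
  assumes "\<And>i. f i \<in> borel_measurable borel"
  shows "indep_vars (\<lambda>_. borel) (\<lambda>i \<omega>. f i (err i \<omega>)) UNIV"
  by (rule indep_vars_compose2[OF indep_err]) (use assms in auto)

lemma G_meas: "z \<in> Z \<Longrightarrow> (\<lambda>\<omega>. G n \<omega> z) \<in> borel_measurable M"
proof -
  assume "z \<in> Z"
  have [measurable]: "h z \<in> borel_measurable borel" using h_meas \<open>z \<in> Z\<close> by blast
  show ?thesis unfolding G_def by measurable
qed

text \<open>The Lipschitz constant does not depend on the error, so the increment is a bounded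
  centred variable and Hoeffding's lemma applies: an interval of length 2B gives (2B)^2 / 8 = B^2 /
  2. That lemma takes a positive parameter; for a negative one a and b are exchanged.\<close>

lemma h_increment_mgf:
  assumes "a \<in> Z" "b \<in> Z"
  shows "(\<integral>\<^sup>+\<omega>. ennreal (exp (l * (h a (err i \<omega>) - h b (err i \<omega>)))) \<partial>M)
    \<le> ennreal (exp (l\<^sup>2 * (2 * L * dist a b)\<^sup>2 / 2))"
proof -
  have pos: "(\<integral>\<^sup>+\<omega>. ennreal (exp (l * (h a (err i \<omega>) - h b (err i \<omega>)))) \<partial>M)
    \<le> ennreal (exp (l\<^sup>2 * (2 * L * dist a b)\<^sup>2 / 2))"
    if l: "0 < l" and ab: "a \<in> Z" "b \<in> Z" for l a b
  proof -
    define B where "B = 2 * L * dist a b"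
    have [measurable]: "h a \<in> borel_measurable borel" "h b \<in> borel_measurable borel" using h_meas ab by auto
    have "\<bar>h a e - h b e\<bar> \<le> B" for e using h_lipschitz ab by (simp add: B_def)
    then have bound: "h a e - h b e \<in> {- B..B}" for e by (simp only: abs_le_iff atLeastAtMost_iff) (metis
      minus_le_iff)
    interpret I: interval_bounded_random_variable M "\<lambda>\<omega>. h a (err i \<omega>) - h b (err i \<omega>)" "- B" B
    proof
      show "(\<lambda>\<omega>. h a (err i \<omega>) - h b (err i \<omega>)) \<in> borel_measurable M" by measurable
      show "AE \<omega> in M. h a (err i \<omega>) - h b (err i \<omega>) \<in> {- B..B}" using bound by (rule AE_I2)
    qed
    have int: "integrable M (\<lambda>\<omega>. h a (err i \<omega>))" "integrable M (\<lambda>\<omega>. h b (err i \<omega>))"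
    proof -
      interpret P: prob_space P by (rule prob_space_P)
      have "integrable P (h a)" "integrable P (h b)"
        by (rule P.square_integrable_imp_integrable, use h_sq ab in \<open>auto simp: square_integrable_def\<close>)+
      then show "integrable M (\<lambda>\<omega>. h a (err i \<omega>))" "integrable M (\<lambda>\<omega>. h b (err i \<omega>))"
        using integrable_P h_meas ab by auto
    qed
    have "(\<integral>\<^sup>+\<omega>. ennreal (exp (l * (h a (err i \<omega>) - h b (err i \<omega>)))) \<partial>M) \<le> ennreal (exp (l\<^sup>2 * (B - - B)\<^sup>2 / 8))"
    proof (rule I.Hoeffdings_lemma_nn_integral_0[OF l])
      show "expectation (\<lambda>\<omega>. h a (err i \<omega>) - h b (err i \<omega>)) = 0"
        using int integral_P h_meas h_mean ab by simp
    qed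
    also have "l\<^sup>2 * (B - - B)\<^sup>2 / 8 = l\<^sup>2 * B\<^sup>2 / 2" by (simp add: power2_eq_square)
    finally show ?thesis by (simp add: B_def)
  qed
  consider "l = 0" | "0 < l" | "0 < - l" by linarith
  then show ?thesis
  proof cases
    case 1
    then show ?thesis by (simp add: emeasure_space_1)
  next
    case 2
    then show ?thesis using pos assms by blast
  next
    case 3
    have "l * (h a e - h b e) = - l * (h b e - h a e)" for e by (simp add: algebra_simps)
    then show ?thesis using pos[OF 3, of b a] assms by (simp add: dist_commute)
  qed
qed

lemma G_increment_mgf:
  assumes ab: "a \<in> Z" "b \<in> Z"
  shows "(\<integral>\<^sup>+\<omega>. ennreal (exp (s * (G n \<omega> a - G n \<omega> b))) \<partial>M) \<le> ennreal (exp (s\<^sup>2 * (2 * L * dist a b)\<^sup>2 / 2))"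
proof (cases "n = 0")
  case True
  then show ?thesis by (simp add: G_def emeasure_space_1 ennreal_ge_1)
next
  case False
  \<comment> \<open>With the parameter divided by the square root of n, the n factors multiply to a
    bound free of n. This is what makes the tightness uniform in n.\<close>
  define l where "l = s / sqrt (real n)"
  have [measurable]: "h a \<in> borel_measurable borel" "h b \<in> borel_measurable borel" using h_meas ab by auto
  have "s * (G n \<omega> a - G n \<omega> b) = (\<Sum>i<n. l * (h a (err i \<omega>) - h b (err i \<omega>)))" for \<omega>
    unfolding G_def l_def sum_distrib_left[symmetric] sum_subtractf by (simp add: diff_divide_distrib[symmetric])
  then have "(\<integral>\<^sup>+\<omega>. ennreal (exp (s * (G n \<omega> a - G n \<omega> b))) \<partial>M)
    = (\<integral>\<^sup>+\<omega>. (\<Prod>i<n. ennreal (exp (l * (h a (err i \<omega>) - h b (err i \<omega>))))) \<partial>M)"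
    by (simp add: exp_sum prod_ennreal)
  also have "\<dots> = (\<Prod>i<n. \<integral>\<^sup>+\<omega>. ennreal (exp (l * (h a (err i \<omega>) - h b (err i \<omega>)))) \<partial>M)"
    by (intro indep_vars_nn_integral indep_vars_subset[OF indep_compose[of
      "\<lambda>_ e. ennreal (exp (l * (h a e - h b e)))"]]) auto
  also have "\<dots> \<le> (\<Prod>i<n. ennreal (exp (l\<^sup>2 * (2 * L * dist a b)\<^sup>2 / 2)))"
    by (rule prod_mono_ennreal) (rule h_increment_mgf[OF ab])
  also have "\<dots> = ennreal (exp (real n * (l\<^sup>2 * (2 * L * dist a b)\<^sup>2 / 2)))"
    by (simp only: prod_constant card_lessThan ennreal_power[OF exp_ge_zero] exp_of_nat_mult)
  also have "real n * (l\<^sup>2 * (2 * L * dist a b)\<^sup>2 / 2) = s\<^sup>2 * (2 * L * dist a b)\<^sup>2 / 2"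
    using False by (simp add: l_def power_divide)
  finally show ?thesis .
qed

lemma G_second_moment:
  assumes "a \<in> Z"
  shows "(\<integral>\<^sup>+\<omega>. ennreal ((G n \<omega> a)\<^sup>2) \<partial>M) \<le> ennreal (\<integral>e. (h a e)\<^sup>2 \<partial>P)"
proof (cases "n = 0")
  case True
  then show ?thesis by (simp add: G_def)
next
  case False
  have [measurable]: "h a \<in> borel_measurable borel" using h_meas assms by auto
  let ?X = "\<lambda>i \<omega>. h a (err i \<omega>)"
  have sq: "square_integrable M (?X i)" for i
    using integrable_P[of "\<lambda>e. (h a e)\<^sup>2" i] h_sq[OF assms] by (simp add: square_integrable_def)
  have "expectation (\<lambda>\<omega>. (\<Sum>i<n. ?X i \<omega>)\<^sup>2) = (\<Sum>i<n. expectation (\<lambda>\<omega>. (?X i \<omega>)\<^sup>2))"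
    using sq integral_P[of "h a"] h_mean[OF assms]
    by (intro expectation_sum_square indep_compose) auto
  also have "\<dots> = real n * (\<integral>e. (h a e)\<^sup>2 \<partial>P)"
    using integral_P[of "\<lambda>e. (h a e)\<^sup>2"] by simp
  finally have E: "expectation (\<lambda>\<omega>. (\<Sum>i<n. ?X i \<omega>)\<^sup>2) = real n * (\<integral>e. (h a e)\<^sup>2 \<partial>P)" .
  have GS: "(G n \<omega> a)\<^sup>2 = (\<Sum>i<n. ?X i \<omega>)\<^sup>2 / real n" for \<omega>
    by (simp add: G_def power_divide)
  have "integrable M (\<lambda>\<omega>. (\<Sum>i<n. ?X i \<omega>)\<^sup>2)"
    using square_integrable_sum[of "{..<n}" M ?X] sq by (simp add: square_integrable_def)
  then have "(\<integral>\<^sup>+\<omega>. ennreal ((G n \<omega> a)\<^sup>2) \<partial>M) = ennreal (expectation (\<lambda>\<omega>. (G n \<omega> a)\<^sup>2))"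
    unfolding GS by (intro nn_integral_eq_integral) auto
  also have "expectation (\<lambda>\<omega>. (G n \<omega> a)\<^sup>2) = (\<integral>e. (h a e)\<^sup>2 \<partial>P)"
    unfolding GS using E False by simp
  finally show ?thesis by simp
qed

text \<open>Cramer-Wold device: a linear combination of coordinates is itself a normalized sum of
  i.i.d. centred square integrable variables, to which the one-dimensional theorem applies.\<close>

lemma G_char:
  fixes d :: "nat \<Rightarrow> 'z"
  assumes "\<And>i. d i \<in> Z"
  shows "(\<lambda>n. char (distr M borel (\<lambda>\<omega>. \<Sum>i\<in>F. t i * G n \<omega> (d i))) 1)
    \<longlonglongrightarrow> complex_of_real (exp (- (\<integral>e. (\<Sum>i\<in>F. t i * h (d i) e)\<^sup>2 \<partial>P) / 2))"
proof -
  define H where "H e = (\<Sum>i\<in>F. t i * h (d i) e)" for e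
  have H_meas [measurable]: "H \<in> borel_measurable borel"
    unfolding H_def using h_meas assms by (intro borel_measurable_sum borel_measurable_times) auto
  have H_sq: "square_integrable P H"
    unfolding H_def using h_sq assms by (intro square_integrable_sum square_integrable_scale) auto
  interpret P: prob_space P by (rule prob_space_P)
  have "(\<integral>e. H e \<partial>P) = (\<Sum>i\<in>F. t i * (\<integral>e. h (d i) e \<partial>P))"
  proof -
    have "integrable P (h (d i))" for i
      by (rule P.square_integrable_imp_integrable) (use h_sq assms in \<open>auto simp: square_integrable_def\<close>)
    then show ?thesis unfolding H_def by (subst Bochner_Integration.integral_sum) auto
  qed
  then have H_mean: "(\<integral>e. H e \<partial>P) = 0" using h_mean assms by simp
  have sum_eq: "(\<Sum>i\<in>F. t i * G n \<omega> (d i)) = (\<Sum>k<n. H (err k \<omega>)) / sqrt (real n)" for n \<omega>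
  proof -
    have "(\<Sum>i\<in>F. t i * G n \<omega> (d i)) = (\<Sum>i\<in>F. \<Sum>k<n. t i * h (d i) (err k \<omega>)) / sqrt (real n)"
      by (simp add: G_def sum_divide_distrib sum_distrib_left)
    also have "(\<Sum>i\<in>F. \<Sum>k<n. t i * h (d i) (err k \<omega>)) = (\<Sum>k<n. H (err k \<omega>))"
      unfolding H_def by (rule sum.swap)
    finally show ?thesis .
  qed
  show ?thesis unfolding sum_eq H_def[symmetric]
  proof (rule char_clt)
    show "indep_vars (\<lambda>_. borel) (\<lambda>k \<omega>. H (err k \<omega>)) UNIV" by (rule indep_compose) simp
    show "expectation (\<lambda>\<omega>. H (err i \<omega>)) = 0" for i by (simp add: integral_P H_mean)
    show "square_integrable M (\<lambda>\<omega>. H (err i \<omega>))" for i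
      using H_sq integrable_P[of "\<lambda>e. (H e)\<^sup>2" i] by (simp add: square_integrable_def)
    show "distr M borel (\<lambda>\<omega>. H (err i \<omega>)) = distr P borel H" for i
      unfolding distr_err[of i, symmetric] by (subst distr_distr) (auto simp: comp_def)
    show "expectation (\<lambda>\<omega>. (H (err i \<omega>))\<^sup>2) = (\<integral>e. (H e)\<^sup>2 \<partial>P)" for i
      using integral_P[of "\<lambda>e. (H e)\<^sup>2" i] by simp
  qed
qed

lemma G_in_C_space: "restrict (G n \<omega>) Z \<in> mspace (C_space Z)"
proof -
  have "(2 * L)-lipschitz_on Z (\<lambda>z. h z e)" for e
    using h_lipschitz L_pos by (intro lipschitz_onI) (auto simp: dist_real_def)
  then have "continuous_on Z (\<lambda>z. h z e)" for e by (rule lipschitz_on_continuous_on)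
  then have "continuous_on Z (G n \<omega>)"
    unfolding G_def divide_inverse by (intro continuous_intros) auto
  then have "continuous_on Z (restrict (G n \<omega>) Z)" by (rule continuous_on_eq) auto
  then show ?thesis unfolding mspace_C_space_iff[OF compact_Z] by auto
qed

theorem C_space_clt:
  "\<exists>(N' :: ('z \<Rightarrow> real) measure) V. prob_space N' \<and>
    V \<in> N' \<rightarrow>\<^sub>M borel_sigma (mtopology_of (C_space Z)) \<and>
    (\<forall>n. (\<lambda>\<omega>. restrict (G n \<omega>) Z) \<in> M \<rightarrow>\<^sub>M borel_sigma (mtopology_of (C_space Z))) \<and>
    (\<forall>\<phi>. continuous_map (mtopology_of (C_space Z)) euclideanreal \<phi> \<and>
      bounded (\<phi> ` topspace (mtopology_of (C_space Z))) \<longrightarrow>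
      (\<lambda>n. \<integral>\<omega>. \<phi> (restrict (G n \<omega>) Z) \<partial>M) \<longlonglongrightarrow> (\<integral>\<omega>. \<phi> (V \<omega>) \<partial>N'))"
proof -
  obtain N :: "nat \<Rightarrow> 'z set" and C qq where NN: "nested_nets Z N C qq"
    using exists_nested_nets[OF compact_Z Z_nonempty] by blast
  interpret nested_nets Z N C qq by (rule NN)
  let ?T = "mtopology_of (C_space Z)"
  let ?W = gaussian_sequence
  interpret W: prob_space ?W by (rule prob_space_gaussian_sequence)
  define d where "d = from_nat_into D"
  have range_d: "range d = D" unfolding d_def using countable_D D_nonempty by (simp add: range_from_nat_into)
  have dD: "d i \<in> D" for i using range_d by auto
  have dZ: "d i \<in> Z" for i using dD D_subset by blast
  \<comment> \<open>If D is finite the enumeration d repeats points; \<iota> assigns one number to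
    each point, so that the limit is well defined as a function on D.\<close>
  define \<iota> where "\<iota> = to_nat_on D"
  have d\<iota>: "d (\<iota> a) = a" if "a \<in> D" for a
    unfolding d_def \<iota>_def using countable_D that by simp
  obtain V0 where V0: "\<And>i. V0 i \<in> borel_measurable ?W"
    "\<And>F \<iota> t. finite (F :: nat set) \<Longrightarrow> char (distr ?W borel (\<lambda>\<omega>. \<Sum>i\<in>F. t i * V0 (\<iota> i) \<omega>)) 1
       = complex_of_real (exp (- (\<integral>x. (\<Sum>i\<in>F. t i * h (d (\<iota> i)) x)\<^sup>2 \<partial>P) / 2))"
    "\<And>F \<iota> t. finite (F :: nat set) \<Longrightarrow> (\<integral>\<^sup>+\<omega>. ennreal (exp (\<Sum>i\<in>F. t i * V0 (\<iota> i) \<omega>)) \<partial>?W)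
       = ennreal (exp ((\<integral>x. (\<Sum>i\<in>F. t i * h (d (\<iota> i)) x)\<^sup>2 \<partial>P) / 2))"
    by (rule exists_gaussian_sequence[of P "\<lambda>i. h (d i)", OF h_sq[OF dZ]]) blast
  define u where "u \<omega> a = V0 (\<iota> a) \<omega>" for \<omega> a
  have u_meas [measurable]: "(\<lambda>\<omega>. u \<omega> a) \<in> borel_measurable ?W" for a unfolding u_def by (rule V0(1))
  interpret P: prob_space P by (rule prob_space_P)
  have u_mgf: "(\<integral>\<^sup>+\<omega>. ennreal (exp (s * (u \<omega> a - u \<omega> b))) \<partial>?W) \<le> ennreal (exp (s\<^sup>2 * (2 * L * dist a b)\<^sup>2 / 2))"
    if ab: "a \<in> D" "b \<in> D" for a b s
  proof -
    \<comment> \<open>The increment is written as a combination of two terms, to which the moment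
      formula applies, also when a = b.\<close>
    define ab :: "nat \<Rightarrow> nat" where "ab i = (if i = 0 then \<iota> a else \<iota> b)" for i
    define t :: "nat \<Rightarrow> real" where "t i = (if i = 0 then s else - s)" for i
    have "(\<integral>\<^sup>+\<omega>. ennreal (exp (s * (u \<omega> a - u \<omega> b))) \<partial>?W) = (\<integral>\<^sup>+\<omega>. ennreal (exp (\<Sum>i\<in>{0,1}. t i * V0 (ab i) \<omega>)) \<partial>?W)"
      by (simp add: u_def t_def ab_def right_diff_distrib)
    also have "\<dots> = ennreal (exp ((\<integral>x. (\<Sum>i\<in>{0,1}. t i * h (d (ab i)) x)\<^sup>2 \<partial>P) / 2))"
      by (rule V0(3)) simp
    also have "(\<integral>x. (\<Sum>i\<in>{0,1}. t i * h (d (ab i)) x)\<^sup>2 \<partial>P) = (\<integral>x. (s * (h a x - h b x))\<^sup>2 \<partial>P)"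
      using d\<iota> \<open>a \<in> D\<close> \<open>b \<in> D\<close> by (simp add: t_def ab_def right_diff_distrib)
    also have "\<dots> \<le> (\<integral>x. s\<^sup>2 * (2 * L * dist a b)\<^sup>2 \<partial>P)"
    proof (rule integral_mono)
      have aZ: "a \<in> Z" "b \<in> Z" using \<open>a \<in> D\<close> \<open>b \<in> D\<close> D_subset by auto
      show "integrable P (\<lambda>x. (s * (h a x - h b x))\<^sup>2)"
        using square_integrable_scale[OF square_integrable_diff[OF h_sq[OF aZ(1)] h_sq[OF aZ(2)]], of s]
        by (simp add: square_integrable_def)
      show "(s * (h a x - h b x))\<^sup>2 \<le> s\<^sup>2 * (2 * L * dist a b)\<^sup>2" for x
      proof -
        have "\<bar>h a x - h b x\<bar>\<^sup>2 \<le> (2 * L * dist a b)\<^sup>2"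
          using h_lipschitz[OF aZ] by (intro power_mono) auto
        then show ?thesis by (simp add: power_mult_distrib mult_left_mono)
      qed
    qed simp
    also have "\<dots> = s\<^sup>2 * (2 * L * dist a b)\<^sup>2" by (simp add: P.prob_space)
    finally show ?thesis by (simp add: ennreal_leI)
  qed
  have u_second: "(\<integral>\<^sup>+\<omega>. ennreal ((u \<omega> a)\<^sup>2) \<partial>?W) \<le> ennreal (4 * exp ((\<integral>e. (h a e)\<^sup>2 \<partial>P) / 2))"
    if a: "a \<in> D" for a
  proof -
    have one: "(\<integral>\<^sup>+\<omega>. ennreal (exp (r * u \<omega> a)) \<partial>?W) = ennreal (exp ((\<integral>e. (h a e)\<^sup>2 \<partial>P) / 2))" if "r\<^sup>2 = 1"
      for r :: real
      using V0(3)[of "{0}" "\<lambda>_. r" "\<lambda>_. \<iota> a"] d\<iota>[OF a] that by (simp add: u_def power_mult_distrib)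
    \<comment> \<open>The second moment is read off the exponential moments at 1 and -1, since x^2 /
      2 is at most exp |x|; the two equal moments account for the factor 4.\<close>
    have exp_ge: "x\<^sup>2 \<le> 2 * (exp (1 * x) + exp ((-1) * x))" for x :: real
    proof -
      have "1 + \<bar>x\<bar> + \<bar>x\<bar>\<^sup>2 / 2 \<le> exp \<bar>x\<bar>" by (rule exp_lower_Taylor_quadratic) simp
      moreover have "exp \<bar>x\<bar> \<le> exp x + exp (- x)" by (cases "0 \<le> x") auto
      ultimately show ?thesis by simp
    qed
    have two: "2 * (ennreal x + ennreal y) = ennreal (2 * (x + y))" if "0 \<le> x" "0 \<le> y" for x y
      using ennreal_mult[of 2 "x + y"] that by simp
    have "(\<integral>\<^sup>+\<omega>. ennreal ((u \<omega> a)\<^sup>2) \<partial>?W)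
      \<le> (\<integral>\<^sup>+\<omega>. 2 * (ennreal (exp (1 * u \<omega> a)) + ennreal (exp ((-1) * u \<omega> a))) \<partial>?W)"
    proof (rule nn_integral_mono)
      fix \<omega>
      show "ennreal ((u \<omega> a)\<^sup>2) \<le> 2 * (ennreal (exp (1 * u \<omega> a)) + ennreal (exp ((-1) * u \<omega> a)))"
        unfolding two[OF exp_ge_zero exp_ge_zero] using exp_ge by (rule ennreal_leI)
    qed
    also have "\<dots> = 2 * ((\<integral>\<^sup>+\<omega>. ennreal (exp (1 * u \<omega> a)) \<partial>?W) + (\<integral>\<^sup>+\<omega>. ennreal (exp ((-1) * u \<omega> a)) \<partial>?W))"
      by (subst nn_integral_cmult, measurable, subst nn_integral_add) auto
    also have "\<dots> = ennreal (4 * exp ((\<integral>e. (h a e)\<^sup>2 \<partial>P) / 2))"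
      unfolding one[of 1, simplified one_power2, OF refl] one[of "-1", simplified power2_minus one_power2, OF refl]
      by (simp add: ennreal_plus[symmetric] ennreal_mult del: ennreal_plus)
    finally show ?thesis .
  qed
  \<comment> \<open>One constant bounds the second moments of the empirical processes and of the
    limit on the coarsest net, so that a single radius R serves both.\<close>
  define \<sigma> where "\<sigma> = (\<Sum>a\<in>N 0. (\<integral>e. (h a e)\<^sup>2 \<partial>P) + 4 * exp ((\<integral>e. (h a e)\<^sup>2 \<partial>P) / 2))"
  have \<sigma>: "0 \<le> \<sigma>" unfolding \<sigma>_def by (intro sum_nonneg add_nonneg_nonneg) auto
  have \<sigma>_ge: "(\<integral>e. (h a e)\<^sup>2 \<partial>P) \<le> \<sigma>" "4 * exp ((\<integral>e. (h a e)\<^sup>2 \<partial>P) / 2) \<le> \<sigma>" if "a \<in> N 0" for a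
  proof -
    have "(\<integral>e. (h a e)\<^sup>2 \<partial>P) + 4 * exp ((\<integral>e. (h a e)\<^sup>2 \<partial>P) / 2) \<le> \<sigma>"
      unfolding \<sigma>_def using that finite_net by (intro member_le_sum add_nonneg_nonneg) auto
    moreover have "0 \<le> (\<integral>e. (h a e)\<^sup>2 \<partial>P)" by simp
    moreover have "0 \<le> 4 * exp ((\<integral>e. (h a e)\<^sup>2 \<partial>P) / 2)" by simp
    ultimately show "(\<integral>e. (h a e)\<^sup>2 \<partial>P) \<le> \<sigma>" "4 * exp ((\<integral>e. (h a e)\<^sup>2 \<partial>P) / 2) \<le> \<sigma>" by linarith+
  qed
  have N0D: "a \<in> N 0 \<Longrightarrow> a \<in> D" for a by (auto simp: D_def)
  have tight: "\<exists>R>0. (\<forall>n. measure M {\<omega> \<in> space M. \<not> chain_ok N R (G n \<omega>)} \<le> e) \<and>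
     measure ?W {\<omega> \<in> space ?W. \<not> chain_ok N R (u \<omega>)} \<le> e" if e: "0 < e" for e
  proof -
    have K: "0 < 2 * L" using L_pos by simp
    obtain R where R: "R > 0" "qq\<^sup>2 * exp (- R\<^sup>2 / (2 * (2 * L)\<^sup>2)) \<le> 1 / 2"
      "card (N 0) * \<sigma> / R\<^sup>2 + 4 * C\<^sup>2 * (qq\<^sup>2 * exp (- R\<^sup>2 / (2 * (2 * L)\<^sup>2))) \<le> e"
      using exists_chain_radius[OF K e, of \<sigma>] by blast
    have "measure M {\<omega> \<in> space M. \<not> chain_ok N R (G n \<omega>)} \<le> e" for n
    proof (rule order_trans[OF prob_not_chain_ok R(3)])
      show "(\<integral>\<^sup>+\<omega>. ennreal ((G n \<omega> a)\<^sup>2) \<partial>M) \<le> ennreal \<sigma>" if "a \<in> N 0" for a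
        using G_second_moment[of a n] \<sigma>_ge(1)[OF that] net_subset that
        by (meson ennreal_leI order_trans subsetD)
      show "(\<integral>\<^sup>+\<omega>. ennreal (exp (s * (G n \<omega> a - G n \<omega> b))) \<partial>M) \<le> ennreal (exp (s\<^sup>2 * (2 * L * dist a b)\<^sup>2 / 2))"
        if "a \<in> D" "b \<in> D" for a b s using that D_subset by (intro G_increment_mgf) auto
      show "(\<lambda>\<omega>. G n \<omega> a) \<in> borel_measurable M" if "a \<in> D" for a using that D_subset by (intro G_meas) auto
    qed (use R K \<sigma> prob_space_axioms in auto)
    moreover have "measure ?W {\<omega> \<in> space ?W. \<not> chain_ok N R (u \<omega>)} \<le> e"
    proof (rule order_trans[OF prob_not_chain_ok R(3)])
      show "(\<integral>\<^sup>+\<omega>. ennreal ((u \<omega> a)\<^sup>2) \<partial>?W) \<le> ennreal \<sigma>" if "a \<in> N 0" for a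
        using u_second[OF N0D[OF that]] \<sigma>_ge(2)[OF that] by (meson ennreal_leI order_trans)
      show "(\<integral>\<^sup>+\<omega>. ennreal (exp (s * (u \<omega> a - u \<omega> b))) \<partial>?W) \<le> ennreal (exp (s\<^sup>2 * (2 * L * dist a b)\<^sup>2 / 2))"
        if "a \<in> D" "b \<in> D" for a b s using that by (rule u_mgf)
    qed (use R K \<sigma> u_meas W.prob_space_axioms in auto)
    ultimately show ?thesis using R(1) by blast
  qed
  \<comment> \<open>Restricting to natural radii makes this a countable union of measurable events
    and loses nothing, by monotonicity in R.\<close>
  define good where "good \<omega> \<longleftrightarrow> (\<exists>R::nat. chain_ok N (real R) (u \<omega>))" for \<omega>
  have goodI: "good \<omega>" if "chain_ok N R (u \<omega>)" for R \<omega>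
  proof -
    obtain r :: nat where "R \<le> real r" using real_arch_simple by blast
    then show ?thesis unfolding good_def using chain_ok_mono[OF that] by blast
  qed
  have good_meas [measurable]: "{\<omega> \<in> space ?W. good \<omega>} \<in> sets ?W"
    unfolding good_def by (intro sets.sets_Collect_countable_Ex measurable_chain_ok) simp
  have good_AE: "AE \<omega> in ?W. good \<omega>"
  proof -
    \<comment> \<open>A path that is not good fails the chaining condition for every radius, so such
      paths have probability below every e.\<close>
    have "measure ?W {\<omega> \<in> space ?W. \<not> good \<omega>} \<le> e" if e: "0 < e" for e
    proof -
      obtain R where R: "measure ?W {\<omega> \<in> space ?W. \<not> chain_ok N R (u \<omega>)} \<le> e" using tight[OF e] by blast
      have "measure ?W {\<omega> \<in> space ?W. \<not> good \<omega>} \<le> measure ?W {\<omega> \<in> space ?W. \<not> chain_ok N R (u \<omega>)}"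
        using goodI
        by (intro W.finite_measure_mono sets.sets_Collect_neg measurable_chain_ok) auto
      then show ?thesis using R by linarith
    qed
    then have "measure ?W {\<omega> \<in> space ?W. \<not> good \<omega>} \<le> 0" by (rule field_le_epsilon) simp
    then have "measure ?W {\<omega> \<in> space ?W. \<not> good \<omega>} = 0" by (simp add: measure_le_0_iff)
    then show ?thesis
      by (intro AE_I[of _ _ "{\<omega> \<in> space ?W. \<not> good \<omega>}"]) (auto simp: W.emeasure_eq_measure)
  qed
  \<comment> \<open>The chosen extension is unique because D is dense, so its values on D make V
    measurable; off the good event the zero function keeps V in C(Z).\<close>
  define V where "V \<omega> = (if good \<omega> then SOME v. v \<in> extensional Z \<and> continuous_on Z v \<and> (\<forall>a\<in>D. v a = u \<omega> a)
    else restrict (\<lambda>_. 0) Z)" for \<omega>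
  have V: "V \<omega> \<in> extensional Z" "continuous_on Z (V \<omega>)" "\<And>a. a \<in> D \<Longrightarrow> V \<omega> a = u \<omega> a" if "good \<omega>" for \<omega>
  proof -
    obtain R :: nat where "chain_ok N (real R) (u \<omega>)" using \<open>good \<omega>\<close> by (auto simp: good_def)
    from someI_ex[OF chain_ok_extension[OF this]] that
    show "V \<omega> \<in> extensional Z" "continuous_on Z (V \<omega>)" "\<And>a. a \<in> D \<Longrightarrow> V \<omega> a = u \<omega> a"
      by (auto simp: V_def)
  qed
  have VC: "V \<omega> \<in> mspace (C_space Z)" for \<omega>
  proof (cases "good \<omega>")
    case True
    then show ?thesis unfolding mspace_C_space_iff[OF compact_Z] using V by blast
  next
    case False
    have "continuous_on Z (restrict (\<lambda>_. 0 :: real) Z)" by (rule continuous_on_eq[OF continuous_on_const[of _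
      0]]) auto
    then show ?thesis unfolding mspace_C_space_iff[OF compact_Z] V_def using False by simp
  qed
  have V_coord: "(\<lambda>\<omega>. V \<omega> a) \<in> borel_measurable ?W" if "a \<in> D" for a
  proof -
    have "(\<lambda>\<omega>. V \<omega> a) = (\<lambda>\<omega>. if good \<omega> then u \<omega> a else 0)"
      using V(3) that D_subset by (auto simp: fun_eq_iff V_def)
    moreover have "(\<lambda>\<omega>. if good \<omega> then u \<omega> a else 0) \<in> borel_measurable ?W"
      by (rule measurable_If) (use good_meas in auto)
    ultimately show ?thesis by simp
  qed
  have V_meas: "V \<in> ?W \<rightarrow>\<^sub>M borel_sigma ?T"
    by (rule measurable_C_space[OF compact_Z Z_nonempty countable_D D_subset D_dense VC V_coord])
  have G_coord: "(\<lambda>\<omega>. restrict (G n \<omega>) Z a) \<in> borel_measurable M" if "a \<in> D" for n a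
    using G_meas[of a n] that D_subset by auto
  have U_meas: "(\<lambda>\<omega>. restrict (G n \<omega>) Z) \<in> M \<rightarrow>\<^sub>M borel_sigma ?T" for n
    by (rule measurable_C_space[OF compact_Z Z_nonempty countable_D D_subset D_dense G_in_C_space G_coord])
  have conv: "(\<lambda>n. \<integral>\<omega>. \<phi> (restrict (G n \<omega>) Z) \<partial>M) \<longlonglongrightarrow> (\<integral>\<omega>. \<phi> (V \<omega>) \<partial>?W)"
    if \<phi>: "continuous_map ?T euclideanreal \<phi>" "bounded (\<phi> ` topspace ?T)" for \<phi>
  proof (rule convergence_from_tightness[OF compact_Z Z_nonempty, where d = d and U =
    "\<lambda>n \<omega>. restrict (G n \<omega>) Z" and V = V])
    show "range d \<subseteq> Z" "Z \<subseteq> closure (range d)" using range_d D_subset D_dense by auto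
    show "prob_space M" by (rule prob_space_axioms)
    show "prob_space ?W" by (rule W.prob_space_axioms)
    show "(\<lambda>\<omega>. restrict (G n \<omega>) Z) \<in> M \<rightarrow>\<^sub>M borel_sigma ?T" for n by (rule U_meas)
    show "V \<in> ?W \<rightarrow>\<^sub>M borel_sigma ?T" by (rule V_meas)
    show "(\<lambda>\<omega>. restrict (G n \<omega>) Z (d i)) \<in> borel_measurable M" for n i by (rule G_coord[OF dD])
    show "(\<lambda>\<omega>. V \<omega> (d i)) \<in> borel_measurable ?W" for i by (rule V_coord[OF dD])
    fix F :: "nat set" and t \<theta> assume F: "finite F"
    have [measurable]: "(\<lambda>\<omega>. V \<omega> (d i)) \<in> borel_measurable ?W" "(\<lambda>\<omega>. G n \<omega> (d i)) \<in> borel_measurable M" for n i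
      using V_coord[OF dD] G_meas[OF dZ] by auto
    define v where "v = (\<integral>e. (\<Sum>i\<in>F. t i * h (d i) e)\<^sup>2 \<partial>P)"
    \<comment> \<open>V agrees with the Gaussian variables on D only on the good event. That event
      has probability one, so the formula for the characteristic function carries over.\<close>
    have "distr ?W borel (\<lambda>\<omega>. \<Sum>i\<in>F. t i * V \<omega> (d i)) = distr ?W borel (\<lambda>\<omega>. \<Sum>i\<in>F. t i * V0 (\<iota> (d i)) \<omega>)"
    proof (rule distr_cong_AE)
      show "AE \<omega> in ?W. (\<Sum>i\<in>F. t i * V \<omega> (d i)) = (\<Sum>i\<in>F. t i * V0 (\<iota> (d i)) \<omega>)"
        using good_AE by eventually_elim (simp add: V(3)[OF _ dD] u_def)
      note [measurable] = V0(1)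
      show "(\<lambda>\<omega>. \<Sum>i\<in>F. t i * V0 (\<iota> (d i)) \<omega>) \<in> borel_measurable ?W" by measurable
    qed simp_all
    then have charV: "char (distr ?W borel (\<lambda>\<omega>. \<Sum>i\<in>F. t i * V \<omega> (d i))) 1 = complex_of_real (exp (- v / 2))"
      using V0(2)[OF F, of t "\<lambda>i. \<iota> (d i)"] by (simp add: v_def d\<iota>[OF dD])
    have "(\<lambda>n. Re (cis \<theta> * char (distr M borel (\<lambda>\<omega>. \<Sum>i\<in>F. t i * G n \<omega> (d i))) 1)) \<longlonglongrightarrow> Re (cis \<theta> * complex_of_real
      (exp (- v / 2)))"
      unfolding v_def by (intro tendsto_intros G_char dZ)
    then have "(\<lambda>n. \<integral>\<omega>. cos ((\<Sum>i\<in>F. t i * G n \<omega> (d i)) + \<theta>) \<partial>M) \<longlonglongrightarrow> (\<integral>\<omega>. cos ((\<Sum>i\<in>F. t i * V \<omega> (d i)) + \<theta>) \<partial>?W)"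
      unfolding charV[symmetric]
      by (subst (1 2) expectation_cos_char) (auto intro: prob_space_axioms W.prob_space_axioms)
    then show "(\<lambda>n. \<integral>\<omega>. cos ((\<Sum>i\<in>F. t i * restrict (G n \<omega>) Z (d i)) + \<theta>) \<partial>M) \<longlonglongrightarrow> (\<integral>\<omega>. cos ((\<Sum>i\<in>F. t i * V \<omega> (d i))
      + \<theta>) \<partial>?W)"
      using dZ by simp
  next
    fix e :: real assume "0 < e"
    then obtain R where R: "R > 0" "\<And>n. measure M {\<omega> \<in> space M. \<not> chain_ok N R (G n \<omega>)} \<le> e"
      "measure ?W {\<omega> \<in> space ?W. \<not> chain_ok N R (u \<omega>)} \<le> e" using tight by blast
    have cong: "chain_ok N R x \<longleftrightarrow> chain_ok N R y" if "\<And>a. a \<in> D \<Longrightarrow> x a = y a" for x y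
    proof -
      have "x a = y a" if "a \<in> N k" for a k using that \<open>\<And>a. a \<in> D \<Longrightarrow> x a = y a\<close> by (auto simp: D_def)
      then show ?thesis unfolding chain_ok_def by (metis (no_types, lifting))
    qed
    let ?\<delta> = "\<lambda>k. (1 :: real) / 4 ^ Suc k" and ?\<eta> = "\<lambda>k. 8 * R / 2 ^ k"
    have "?\<eta> \<longlonglongrightarrow> 0"
    proof -
      have "(\<lambda>k. 8 * R * (1 / 2) ^ k) \<longlonglongrightarrow> 8 * R * 0" by (intro tendsto_mult_left LIMSEQ_realpow_zero) auto
      then show ?thesis by (simp add: power_one_over)
    qed
    moreover have "\<exists>E\<in>sets M. measure M E \<le> e \<and> (\<forall>\<omega>\<in>space M - E. restrict (G n \<omega>) Z \<in> equicont_set Z (3 * R) ?\<delta>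
      ?\<eta>)" for n
    proof (intro bexI conjI ballI)
      show "measure M {\<omega> \<in> space M. \<not> chain_ok N R (G n \<omega>)} \<le> e" by (rule R(2))
      show "{\<omega> \<in> space M. \<not> chain_ok N R (G n \<omega>)} \<in> sets M"
        using G_meas D_subset by (intro sets.sets_Collect_neg measurable_chain_ok) auto
      fix \<omega> assume "\<omega> \<in> space M - {\<omega> \<in> space M. \<not> chain_ok N R (G n \<omega>)}"
      then have "chain_ok N R (G n \<omega>)" by blast
      moreover have "G n \<omega> a = restrict (G n \<omega>) Z a" if "a \<in> D" for a using that D_subset by auto
      ultimately have "chain_ok N R (restrict (G n \<omega>) Z)" using cong[of "G n \<omega>" "restrict (G n \<omega>) Z"] by blast
      moreover have "continuous_on Z (restrict (G n \<omega>) Z)"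
        using G_in_C_space unfolding mspace_C_space_iff[OF compact_Z] by blast
      ultimately show "restrict (G n \<omega>) Z \<in> equicont_set Z (3 * R) ?\<delta> ?\<eta>"
        using R(1) by (intro chain_ok_imp_equicont_set) auto
    qed
    moreover have "\<exists>E\<in>sets ?W. measure ?W E \<le> e \<and> (\<forall>\<omega>\<in>space ?W - E. V \<omega> \<in> equicont_set Z (3 * R) ?\<delta> ?\<eta>)"
    proof (intro bexI conjI ballI)
      show "measure ?W {\<omega> \<in> space ?W. \<not> chain_ok N R (u \<omega>)} \<le> e" by (rule R(3))
      show "{\<omega> \<in> space ?W. \<not> chain_ok N R (u \<omega>)} \<in> sets ?W"
        by (intro sets.sets_Collect_neg measurable_chain_ok) auto
      fix \<omega> assume "\<omega> \<in> space ?W - {\<omega> \<in> space ?W. \<not> chain_ok N R (u \<omega>)}"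
      then have ok: "chain_ok N R (u \<omega>)" by blast
      note g = goodI[OF ok]
      have "chain_ok N R (V \<omega>)" using ok cong[of "V \<omega>" "u \<omega>"] V(3)[OF g] by blast
      then show "V \<omega> \<in> equicont_set Z (3 * R) ?\<delta> ?\<eta>"
        using R(1) V[OF g] by (intro chain_ok_imp_equicont_set) auto
    qed
    moreover have "0 < ?\<delta> k" for k by simp
    ultimately show "\<exists>R \<delta> \<eta>. (\<forall>k. 0 < \<delta> k) \<and> \<eta> \<longlonglongrightarrow> 0 \<and>
      (\<forall>n. \<exists>E\<in>sets M. measure M E \<le> e \<and> (\<forall>\<omega>\<in>space M - E. restrict (G n \<omega>) Z \<in> equicont_set Z R \<delta> \<eta>)) \<and>
      (\<exists>E\<in>sets ?W. measure ?W E \<le> e \<and> (\<forall>\<omega>\<in>space ?W - E. V \<omega> \<in> equicont_set Z R \<delta> \<eta>))"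
      by (intro exI[of _ "3 * R"] exI[of _ ?\<delta>] exI[of _ ?\<eta>] conjI allI)
  qed (use \<phi> in auto)
  \<comment> \<open>Passing to the law of V moves the limit to a measure on the function space
    itself, with the identity as random element, which is the type that the statement asks
    for.\<close>
  define N' where "N' = distr ?W (borel_sigma ?T) V"
  have "prob_space N'" unfolding N'_def by (rule W.prob_space_distr[OF V_meas])
  moreover have "(\<lambda>u. u) \<in> N' \<rightarrow>\<^sub>M borel_sigma ?T" by (simp add: N'_def)
  moreover have "(\<integral>u. \<phi> u \<partial>N') = (\<integral>\<omega>. \<phi> (V \<omega>) \<partial>?W)" if "continuous_map ?T euclideanreal \<phi>" for \<phi> ::
    "('z \<Rightarrow> real) \<Rightarrow> real"
    unfolding N'_def using V_meas measurable_continuous_map_borel_sigma[OF that] by (rule integral_distr)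
  ultimately show ?thesis using conv U_meas by (intro exI[of _ N'] exI[of _ "\<lambda>u. u"]) simp
qed

end

section \<open>Exponential bounds and measurability\<close>

text \<open>Taylor's formula of second order. One half of the exponent |x| pays for the factor exp t
  of the remainder, which is where s \<le> 1/2 enters, and the other half pays for x^2.\<close>

lemma exp_le_quadratic:
  fixes x s :: real
  assumes "0 \<le> s" "s \<le> 1 / 2"
  shows "exp (s * x) \<le> 1 + s * x + 4 * s\<^sup>2 * exp \<bar>x\<bar>"
proof -
  obtain t where t: "\<bar>t\<bar> \<le> \<bar>s * x\<bar>" "exp (s * x) = (\<Sum>m<2. (s * x) ^ m / fact m) + (exp t / fact 2) * (s * x) ^ 2"
    using Maclaurin_exp_le[of "s * x" 2] by blast
  have "\<bar>s * x\<bar> \<le> \<bar>x\<bar> / 2"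
    unfolding abs_mult using assms mult_right_mono[of "\<bar>s\<bar>" "1/2" "\<bar>x\<bar>"] by simp
  then have "exp t \<le> exp (\<bar>x\<bar> / 2)" using t(1) by simp
  moreover have "x\<^sup>2 \<le> 8 * exp (\<bar>x\<bar> / 2)"
  proof -
    have "1 + \<bar>x\<bar> / 2 + (\<bar>x\<bar> / 2)\<^sup>2 / 2 \<le> exp (\<bar>x\<bar> / 2)" by (rule exp_lower_Taylor_quadratic) simp
    moreover have "(\<bar>x\<bar> / 2)\<^sup>2 / 2 = x\<^sup>2 / 8" by (simp add: power_divide)
    moreover have "0 \<le> \<bar>x\<bar> / 2" by simp
    ultimately show ?thesis by linarith
  qed
  ultimately have "exp t * x\<^sup>2 \<le> exp (\<bar>x\<bar> / 2) * (8 * exp (\<bar>x\<bar> / 2))" by (intro mult_mono) auto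
  also have "\<dots> = 8 * exp \<bar>x\<bar>" by (simp flip: exp_add)
  finally have "s\<^sup>2 / 2 * (exp t * x\<^sup>2) \<le> s\<^sup>2 / 2 * (8 * exp \<bar>x\<bar>)" by (intro mult_left_mono) auto
  moreover have "(exp t / fact 2) * (s * x) ^ 2 = s\<^sup>2 / 2 * (exp t * x\<^sup>2)"
    by (simp add: power_mult_distrib)
  moreover have "(\<Sum>m<2. (s * x) ^ m / fact m) = 1 + s * x" by (simp add: numeral_2_eq_2)
  ultimately show ?thesis unfolding t(2) by (simp add: mult_ac)
qed

text \<open>Only an exponential moment at rate 1 is available, so the moment generating function is
  controlled for small s alone. This suffices, because only some positive rate is claimed.\<close>

lemma (in prob_space) chernoff_iid_one_sided:
  fixes X :: "nat \<Rightarrow> 'a \<Rightarrow> real"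
  assumes ind: "indep_vars (\<lambda>_. borel) X UNIV" and zero: "\<And>i. expectation (X i) = 0"
    and mom: "\<And>i. (\<integral>\<^sup>+\<omega>. ennreal (exp \<bar>X i \<omega>\<bar>) \<partial>M) \<le> ennreal A" and A: "1 \<le> A" and \<kappa>: "0 < \<kappa>"
  shows "\<exists>\<beta>>0. \<forall>n. prob {\<omega> \<in> space M. real n * \<kappa> < (\<Sum>i<n. X i \<omega>)} \<le> exp (- real n * \<beta>)"
proof -
  \<comment> \<open>With this s the second-order term 4 s^2 A is at most half of s \<kappa>; the
    rate \<beta> is the remaining half.\<close>
  define s where "s = min (1 / 2) (\<kappa> / (8 * A))"
  have s: "0 < s" "s \<le> 1 / 2" "8 * A * s \<le> \<kappa>"
    using A \<kappa> by (auto simp: s_def min_def field_simps)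
  define \<beta> where "\<beta> = s * \<kappa> / 2"
  have [measurable]: "X i \<in> borel_measurable M" for i using ind by (simp add: indep_vars_def2)
  have int_exp: "integrable M (\<lambda>\<omega>. exp \<bar>X i \<omega>\<bar>)" for i
    using mom[of i] by (intro integrableI_nonneg) (auto intro: le_less_trans)
  have int: "integrable M (X i)" for i
  proof (rule Bochner_Integration.integrable_bound[OF int_exp])
    show "AE \<omega> in M. norm (X i \<omega>) \<le> norm (exp \<bar>X i \<omega>\<bar>)"
    proof (rule AE_I2)
      fix \<omega>
      show "norm (X i \<omega>) \<le> norm (exp \<bar>X i \<omega>\<bar>)" using exp_ge_add_one_self[of "\<bar>X i \<omega>\<bar>"]
        by (simp del: exp_ge_add_one_self)
    qed
  qed simp
  have E_exp: "expectation (\<lambda>\<omega>. exp \<bar>X i \<omega>\<bar>) \<le> A" for i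
    using mom[of i] A by (subst (asm) nn_integral_eq_integral[OF int_exp]) auto
  have mgf: "(\<integral>\<^sup>+\<omega>. ennreal (exp (s * X i \<omega>)) \<partial>M) \<le> ennreal (exp (4 * s\<^sup>2 * A))" for i
  proof -
    have "(\<integral>\<^sup>+\<omega>. ennreal (exp (s * X i \<omega>)) \<partial>M) \<le> (\<integral>\<^sup>+\<omega>. ennreal (1 + s * X i \<omega> + 4 * s\<^sup>2 * exp \<bar>X i \<omega>\<bar>) \<partial>M)"
      using exp_le_quadratic s by (intro nn_integral_mono ennreal_leI) auto
    also have "\<dots> = ennreal (expectation (\<lambda>\<omega>. 1 + s * X i \<omega> + 4 * s\<^sup>2 * exp \<bar>X i \<omega>\<bar>))"
      using int int_exp exp_le_quadratic[of s] s
      by (intro nn_integral_eq_integral AE_I2) (auto intro: order_trans[OF exp_ge_zero])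
    also have "expectation (\<lambda>\<omega>. 1 + s * X i \<omega> + 4 * s\<^sup>2 * exp \<bar>X i \<omega>\<bar>) = 1 + 4 * s\<^sup>2 * expectation (\<lambda>\<omega>. exp \<bar>X i \<omega>\<bar>)"
      using int int_exp zero by (simp add: prob_space)
    also have "\<dots> \<le> 1 + 4 * s\<^sup>2 * A" using E_exp by (intro add_left_mono mult_left_mono) auto
    also have "\<dots> \<le> exp (4 * s\<^sup>2 * A)" by (rule exp_ge_add_one_self)
    finally show ?thesis by (simp add: ennreal_leI)
  qed
  have "prob {\<omega> \<in> space M. real n * \<kappa> < (\<Sum>i<n. X i \<omega>)} \<le> exp (- real n * \<beta>)" for n
  proof -
    have "(\<integral>\<^sup>+\<omega>. ennreal (exp (s * (\<Sum>i<n. X i \<omega>))) \<partial>M) = (\<integral>\<^sup>+\<omega>. (\<Prod>i<n. ennreal (exp (s * X i \<omega>))) \<partial>M)"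
      by (simp add: sum_distrib_left exp_sum prod_ennreal)
    also have "\<dots> = (\<Prod>i<n. \<integral>\<^sup>+\<omega>. ennreal (exp (s * X i \<omega>)) \<partial>M)"
    proof (rule indep_vars_nn_integral)
      show "indep_vars (\<lambda>_. borel) (\<lambda>i \<omega>. ennreal (exp (s * X i \<omega>))) {..<n}"
        by (rule indep_vars_compose2[OF indep_vars_subset[OF ind]]) auto
    qed auto
    also have "\<dots> \<le> (\<Prod>i<n. ennreal (exp (4 * s\<^sup>2 * A)))" by (rule prod_mono_ennreal) (rule mgf)
    also have "\<dots> = ennreal (exp (real n * (4 * s\<^sup>2 * A)))"
      by (simp only: prod_constant card_lessThan ennreal_power[OF exp_ge_zero] exp_of_nat_mult)
    finally have "prob {\<omega> \<in> space M. real n * \<kappa> < (\<Sum>i<n. X i \<omega>)}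
      \<le> exp (- s * (real n * \<kappa>)) * exp (real n * (4 * s\<^sup>2 * A))"
      using s by (intro chernoff_bound) auto
    also have "\<dots> = exp (- real n * (s * \<kappa> - s * (4 * A * s)))"
      by (simp add: power2_eq_square algebra_simps flip: exp_add)
    also have "\<dots> \<le> exp (- real n * \<beta>)"
    proof -
      have "s * (4 * A * s) \<le> s * (\<kappa> / 2)" using s by (intro mult_left_mono) auto
      then have "\<beta> \<le> s * \<kappa> - s * (4 * A * s)" by (simp add: \<beta>_def algebra_simps)
      then show ?thesis by (simp add: mult_left_mono)
    qed
    finally show ?thesis .
  qed
  moreover have "0 < \<beta>" using s \<kappa> by (simp add: \<beta>_def)
  ultimately show ?thesis by blast
qed

lemma (in prob_space) chernoff_iid:
  fixes X :: "nat \<Rightarrow> 'a \<Rightarrow> real"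
  assumes ind: "indep_vars (\<lambda>_. borel) X UNIV" and zero: "\<And>i. expectation (X i) = 0"
    and mom: "\<And>i. (\<integral>\<^sup>+\<omega>. ennreal (exp \<bar>X i \<omega>\<bar>) \<partial>M) \<le> ennreal A" and A: "1 \<le> A" and \<kappa>: "0 < \<kappa>"
  shows "\<exists>\<beta>>0. \<forall>n. prob {\<omega> \<in> space M. real n * \<kappa> < \<bar>\<Sum>i<n. X i \<omega>\<bar>} \<le> 2 * exp (- real n * \<beta>)"
proof -
  have [measurable]: "X i \<in> borel_measurable M" for i using ind by (simp add: indep_vars_def2)
  obtain b1 where b1: "b1 > 0" "\<And>n. prob {\<omega> \<in> space M. real n * \<kappa> < (\<Sum>i<n. X i \<omega>)} \<le> exp (- real n * b1)"
    using chernoff_iid_one_sided[OF assms] by blast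
  have "indep_vars (\<lambda>_. borel) (\<lambda>i \<omega>. - X i \<omega>) UNIV" by (rule indep_vars_compose2[OF ind]) auto
  from chernoff_iid_one_sided[OF this, of A \<kappa>] obtain b2 where b2: "b2 > 0"
    "\<And>n. prob {\<omega> \<in> space M. real n * \<kappa> < (\<Sum>i<n. - X i \<omega>)} \<le> exp (- real n * b2)"
    using zero mom A \<kappa> by auto
  have "prob {\<omega> \<in> space M. real n * \<kappa> < \<bar>\<Sum>i<n. X i \<omega>\<bar>} \<le> 2 * exp (- real n * min b1 b2)" for n
  proof -
    have "prob {\<omega> \<in> space M. real n * \<kappa> < \<bar>\<Sum>i<n. X i \<omega>\<bar>}
      \<le> prob ({\<omega> \<in> space M. real n * \<kappa> < (\<Sum>i<n. X i \<omega>)} \<union> {\<omega> \<in> space M. real n * \<kappa> < (\<Sum>i<n. - X i \<omega>)})"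
      by (intro finite_measure_mono) (auto simp: sum_negf abs_if split: if_splits)
    also have "\<dots> \<le> prob {\<omega> \<in> space M. real n * \<kappa> < (\<Sum>i<n. X i \<omega>)} + prob {\<omega> \<in> space M. real n * \<kappa> < (\<Sum>i<n. - X i \<omega>)}"
      by (rule measure_subadditive) auto
    also have "\<dots> \<le> exp (- real n * b1) + exp (- real n * b2)" using b1(2) b2(2) by (rule add_mono)
    also have "\<dots> \<le> exp (- real n * min b1 b2) + exp (- real n * min b1 b2)"
      by (intro add_mono) (auto simp: mult_left_mono)
    finally show ?thesis by simp
  qed
  then show ?thesis using b1(1) b2(1) by (intro exI[of _ "min b1 b2"]) auto
qed

section \<open>Exponential bounds uniform over Z\<close>

context lipschitz_class
begin

definition mean_dev :: "nat \<Rightarrow> 'b \<Rightarrow> 'z \<Rightarrow> real"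
  where "mean_dev n \<omega> z = (\<Sum>i<n. h z (err i \<omega>)) / real n"

lemma mean_dev_eq: "0 < n \<Longrightarrow> mean_dev n \<omega> z = (1 / real n) * (\<Sum>i<n. q z (err i \<omega>)) - m z"
  by (simp add: mean_dev_def h_def sum_subtractf field_simps)

lemma G_eq_mean_dev: "G n \<omega> z = sqrt (real n) * mean_dev n \<omega> z"
  using sqrt_divide_self_eq[of "real n"] by (simp add: G_def mean_dev_def divide_inverse)

lemma mean_dev_lipschitz:
  assumes "z \<in> Z" "z' \<in> Z"
  shows "\<bar>mean_dev n \<omega> z - mean_dev n \<omega> z'\<bar> \<le> 2 * L * dist z z'"
proof -
  have "mean_dev n \<omega> z - mean_dev n \<omega> z' = (\<Sum>i<n. h z (err i \<omega>) - h z' (err i \<omega>)) / real n"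
    by (simp add: mean_dev_def sum_subtractf diff_divide_distrib)
  also have "\<bar>\<dots>\<bar> \<le> (\<Sum>i<n. 2 * L * dist z z') / real n"
    unfolding abs_divide abs_of_nat
    by (intro divide_right_mono order_trans[OF sum_abs] sum_mono h_lipschitz assms) auto
  also have "\<dots> \<le> 2 * L * dist z z'" using L_pos by (cases "n = 0") auto
  finally show ?thesis .
qed

text \<open>The conclusion provides a measurable event instead of speaking of the supremum over Z,
  so no question of measurability arises. Moments are required on D only, since the net points can
  be chosen there.\<close>

lemma uniform_chernoff:
  assumes D: "D \<subseteq> Z" "Z \<subseteq> closure D" and \<kappa>: "0 < \<kappa>"
    and mom: "\<And>z. z \<in> D \<Longrightarrow> (\<integral>\<^sup>+e. ennreal (exp \<bar>h z e\<bar>) \<partial>P) < \<infinity>"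
  shows "\<exists>K>0. \<exists>\<beta>>0. \<forall>n. \<exists>E\<in>sets M. prob E \<le> K * exp (- real n * \<beta>) \<and>
    (\<forall>\<omega>\<in>space M - E. \<forall>z\<in>Z. \<bar>mean_dev n \<omega> z\<bar> \<le> \<kappa>)"
proof -
  \<comment> \<open>The deviation is Lipschitz with constant 2L, one L from q and one from its mean.
    The radius r limits its oscillation to \<kappa> / 2 and leaves the other half to the net
    points.\<close>
  define r where "r = \<kappa> / (4 * L)"
  have r: "0 < r" "2 * L * r = \<kappa> / 2" using L_pos \<kappa> by (auto simp: r_def)
  obtain F where F: "finite F" "F \<subseteq> D" "Z \<subseteq> (\<Union>d\<in>F. ball d r)"
    using compact_finite_net_of_dense[OF compact_Z D r(1)] by blast
  have "F \<noteq> {}" using F(3) Z_nonempty by auto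
  have "\<exists>\<beta>>0. \<forall>n. prob {\<omega> \<in> space M. real n * (\<kappa> / 2) < \<bar>\<Sum>i<n. h z (err i \<omega>)\<bar>} \<le> 2 * exp (- real n * \<beta>)" if z:
    "z \<in> F" for z
  proof -
    have zZ: "z \<in> Z" using z F(2) D(1) by blast
    have [measurable]: "h z \<in> borel_measurable borel" using h_meas zZ by blast
    have eq: "(\<integral>\<^sup>+\<omega>. ennreal (exp \<bar>h z (err i \<omega>)\<bar>) \<partial>M) = (\<integral>\<^sup>+e. ennreal (exp \<bar>h z e\<bar>) \<partial>P)" for i
    proof -
      have "(\<integral>\<^sup>+e. ennreal (exp \<bar>h z e\<bar>) \<partial>distr M borel (err i)) = (\<integral>\<^sup>+\<omega>. ennreal (exp \<bar>h z (err i \<omega>)\<bar>) \<partial>M)"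
        by (rule nn_integral_distr) measurable
      then show ?thesis by (simp add: distr_err)
    qed
    obtain A where A: "(\<integral>\<^sup>+e. ennreal (exp \<bar>h z e\<bar>) \<partial>P) = ennreal A" "0 \<le> A"
      using mom[of z] z F(2) by (cases "\<integral>\<^sup>+e. ennreal (exp \<bar>h z e\<bar>) \<partial>P") auto
    show ?thesis
    proof (rule chernoff_iid[where A = "max 1 A"])
      show "indep_vars (\<lambda>_. borel) (\<lambda>i \<omega>. h z (err i \<omega>)) UNIV" by (rule indep_compose) simp
      show "expectation (\<lambda>\<omega>. h z (err i \<omega>)) = 0" for i using integral_P h_mean zZ by simp
      show "(\<integral>\<^sup>+\<omega>. ennreal (exp \<bar>h z (err i \<omega>)\<bar>) \<partial>M) \<le> ennreal (max 1 A)" for i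
        unfolding eq A(1) by (rule ennreal_leI) simp
    qed (use \<kappa> in auto)
  qed
  then obtain b where b: "\<And>z. z \<in> F \<Longrightarrow> 0 < b z"
    "\<And>z n. z \<in> F \<Longrightarrow> prob {\<omega> \<in> space M. real n * (\<kappa> / 2) < \<bar>\<Sum>i<n. h z (err i \<omega>)\<bar>} \<le> 2 * exp (- real n * b z)"
    using bchoice[of F "\<lambda>z \<beta>. 0 < \<beta> \<and> (\<forall>n. prob {\<omega> \<in> space M. real n * (\<kappa> / 2) < \<bar>\<Sum>i<n. h z (err i \<omega>)\<bar>}
      \<le> 2 * exp (- real n * \<beta>))"]
    by blast
  define \<beta> where "\<beta> = Min (b ` F)"
  have \<beta>: "0 < \<beta>" "\<And>z. z \<in> F \<Longrightarrow> \<beta> \<le> b z"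
    using b(1) F(1) \<open>F \<noteq> {}\<close> by (auto simp: \<beta>_def)
  define E where "E n = (\<Union>z\<in>F. {\<omega> \<in> space M. real n * (\<kappa> / 2) < \<bar>\<Sum>i<n. h z (err i \<omega>)\<bar>})" for n
  have meas: "{\<omega> \<in> space M. real n * (\<kappa> / 2) < \<bar>\<Sum>i<n. h z (err i \<omega>)\<bar>} \<in> sets M" if "z \<in> F" for z n
  proof -
    have [measurable]: "h z \<in> borel_measurable borel" using h_meas that F(2) D(1) by blast
    show ?thesis by measurable
  qed
  have "\<exists>E\<in>sets M. prob E \<le> (2 * card F) * exp (- real n * \<beta>) \<and>
    (\<forall>\<omega>\<in>space M - E. \<forall>z\<in>Z. \<bar>mean_dev n \<omega> z\<bar> \<le> \<kappa>)" for n
  proof (intro bexI[of _ "E n"] conjI ballI)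
    show "E n \<in> sets M" unfolding E_def using F(1) meas by (intro sets.finite_UN) auto
    have "prob (E n) \<le> (\<Sum>z\<in>F. prob {\<omega> \<in> space M. real n * (\<kappa> / 2) < \<bar>\<Sum>i<n. h z (err i \<omega>)\<bar>})"
      unfolding E_def using F(1) meas by (intro measure_UNION_le) auto
    also have "\<dots> \<le> (\<Sum>z\<in>F. 2 * exp (- real n * \<beta>))"
    proof (rule sum_mono)
      fix z assume z: "z \<in> F"
      have "2 * exp (- real n * b z) \<le> 2 * exp (- real n * \<beta>)" using \<beta>(2)[OF z] by (simp add: mult_left_mono)
      with b(2)[OF z, of n]
      show "prob {\<omega> \<in> space M. real n * (\<kappa> / 2) < \<bar>\<Sum>i<n. h z (err i \<omega>)\<bar>} \<le> 2 * exp (- real n * \<beta>)" by linarith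
    qed
    finally show "prob (E n) \<le> (2 * card F) * exp (- real n * \<beta>)" by simp
    fix \<omega> z assume \<omega>: "\<omega> \<in> space M - E n" and z: "z \<in> Z"
    obtain f where f: "f \<in> F" "dist f z < r" using F(3) z by auto
    have fZ: "f \<in> Z" using f(1) F(2) D(1) by blast
    have "\<bar>\<Sum>i<n. h f (err i \<omega>)\<bar> \<le> real n * (\<kappa> / 2)" using \<omega> f(1) by (auto simp: E_def not_less)
    then have "\<bar>mean_dev n \<omega> f\<bar> \<le> \<kappa> / 2"
      using \<kappa> by (cases "n = 0") (auto simp: mean_dev_def abs_divide field_simps)
    moreover have "\<bar>mean_dev n \<omega> f - mean_dev n \<omega> z\<bar> \<le> 2 * L * r"
      using mean_dev_lipschitz[OF fZ z, of n \<omega>] f(2) L_pos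
      by (meson less_imp_le mult_left_mono mult_nonneg_nonneg order_trans zero_le_numeral)
    ultimately show "\<bar>mean_dev n \<omega> z\<bar> \<le> \<kappa>" using r(2) by linarith
  qed
  moreover have "0 < 2 * real (card F)" using F(1) \<open>F \<noteq> {}\<close> by (simp add: card_gt_0_iff)
  ultimately show ?thesis using \<beta>(1) by (metis of_nat_mult of_nat_numeral)
qed

end

section \<open>Supports of measures\<close>

lemma closed_support_of: "closed (support_of \<mu>)"
proof -
  have "- support_of \<mu> = \<Union>{U. open U \<and> emeasure \<mu> U = 0}"
    by (auto simp: support_of_def not_gr_zero)
  then have "open (- support_of \<mu>)" by auto
  then show ?thesis by (simp add: closed_def)
qed

text \<open>Second countability: the complement of the support is covered by countably many null
  sets taken from a basis.\<close>

lemma AE_support_of: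
  fixes \<mu> :: "'a::second_countable_topology measure"
  assumes sets: "sets \<mu> = sets borel"
  shows "AE x in \<mu>. x \<in> support_of \<mu>"
proof -
  obtain B :: "'a set set" where B: "countable B" "topological_basis B" using ex_countable_basis by blast
  let ?N = "\<Union>{U \<in> B. emeasure \<mu> U = 0}"
  have "{U \<in> B. emeasure \<mu> U = 0} \<subseteq> null_sets \<mu>"
    using topological_basis_open[OF B(2)] by (auto simp: sets)
  then have "?N \<in> null_sets \<mu>"
    using B(1) by (intro null_sets_UN'[of _ id, simplified] countable_subset[OF _ B(1)]) auto
  moreover have "- support_of \<mu> \<subseteq> ?N"
  proof
    fix x assume "x \<in> - support_of \<mu>"
    then obtain U where U: "open U" "x \<in> U" "emeasure \<mu> U = 0" by (auto simp: support_of_def not_gr_zero)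
    then obtain V where V: "V \<in> B" "x \<in> V" "V \<subseteq> U" using topological_basisE[OF B(2)] by blast
    have "emeasure \<mu> V \<le> emeasure \<mu> U" using V U by (intro emeasure_mono) (auto simp: sets)
    then show "x \<in> ?N" using U(3) V by auto
  qed
  ultimately show ?thesis by (intro AE_I') auto
qed

text \<open>An open set without points of property P in the support would be null, which no
  neighbourhood of a point of the support is. So a property valid almost everywhere holds on a dense
  part of the support.\<close>

lemma support_of_subset_closure:
  fixes \<mu> :: "'a::second_countable_topology measure"
  assumes sets: "sets \<mu> = sets borel" and AE: "AE x in \<mu>. P x"
  shows "support_of \<mu> \<subseteq> closure {x \<in> support_of \<mu>. P x}"
proof
  fix x assume x: "x \<in> support_of \<mu>"
  let ?A = "{x \<in> support_of \<mu>. P x}"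
  show "x \<in> closure ?A"
  proof (rule ccontr)
    assume nx: "x \<notin> closure ?A"
    let ?U = "- closure ?A"
    have U: "open ?U" "x \<in> ?U" using nx by auto
    have "AE y in \<mu>. y \<notin> ?U"
      using AE AE_support_of[OF sets]
    proof eventually_elim
      case (elim y)
      then have "y \<in> ?A" by simp
      then have "y \<in> closure ?A" by (rule subsetD[OF closure_subset])
      then show ?case by simp
    qed
    then have "emeasure \<mu> ?U = 0"
      using U(1) by (subst (asm) AE_iff_measurable[of ?U]) (auto simp: sets sets_eq_imp_space_eq[OF sets])
    then show False using x U by (auto simp: support_of_def)
  qed
qed

section \<open>Measurable solution of linear systems\<close>

lemma pos_definite_det_nonzero:
  fixes A :: "real^'n^'n"
  assumes "pos_definite A"
  shows "det A \<noteq> 0"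
proof -
  have "u = 0" if "A *v u = 0" for u
    using assms that by (cases "u = 0") (auto simp: pos_definite_def)
  then have "\<exists>B. B ** A = mat 1" by (simp add: matrix_left_invertible_ker)
  then show ?thesis using invertible_det_nz invertible_left_inverse by blast
qed

text \<open>Agrees with \<open>matrix_inv A *v b\<close> for regular \<open>A\<close>, and is a measurable function of \<open>A\<close> and \<open>b\<close> by its form;
  \<open>matrix_inv\<close> is a choice without an explicit formula.\<close>

definition cramer_solution :: "real^'n^'n \<Rightarrow> real^'n \<Rightarrow> real^'n"
  where "cramer_solution A b = (\<chi> k. det (\<chi> i j. if j = k then b $ i else A $ i $ j) / det A)"

lemma cramer_solution_unique:
  assumes "det A \<noteq> 0" "A *v x = b"
  shows "cramer_solution A b = x"
  using cramer[OF assms(1), of x b] assms(2) by (simp add: cramer_solution_def)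

lemma matrix_inv_eq_cramer_solution:
  fixes A :: "real^'n^'n"
  assumes "det A \<noteq> 0"
  shows "matrix_inv A *v b = cramer_solution A b"
proof -
  have "invertible A" using assms by (simp add: invertible_det_nz)
  then have "A ** matrix_inv A = mat 1"
    unfolding invertible_def matrix_inv_def by (metis (mono_tags, lifting) someI_ex)
  then have "A *v (matrix_inv A *v b) = b" by (simp add: matrix_vector_mul_assoc)
  then show ?thesis by (rule cramer_solution_unique[OF assms, symmetric])
qed

lemma borel_measurable_vec_nth [measurable (raw)]:
  fixes f :: "'a \<Rightarrow> ('b::euclidean_space)^'n"
  assumes "f \<in> borel_measurable M"
  shows "(\<lambda>x. f x $ i) \<in> borel_measurable M"
  by (rule measurable_compose[OF assms borel_measurable_continuous_onI]) (intro continuous_intros)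

lemma borel_measurable_vec_lambda:
  fixes f :: "'a \<Rightarrow> 'n::finite \<Rightarrow> real"
  assumes "\<And>i. (\<lambda>x. f x i) \<in> borel_measurable M"
  shows "(\<lambda>x. \<chi> i. f x i) \<in> borel_measurable M"
proof (subst borel_measurable_euclidean_space, rule ballI)
  fix b :: "real^'n" assume "b \<in> Basis"
  then obtain k where "b = axis k 1" by (auto simp: Basis_vec_def)
  then show "(\<lambda>x. (\<chi> i. f x i) \<bullet> b) \<in> borel_measurable M" using assms by (simp add: inner_axis)
qed

lemma borel_measurable_cramer_solution:
  fixes A :: "'a \<Rightarrow> real^'n^'n"
  assumes [measurable]: "A \<in> borel_measurable M" "b \<in> borel_measurable M"
  shows "(\<lambda>x. cramer_solution (A x) (b x)) \<in> borel_measurable M"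
proof -
  have det: "(\<lambda>x. det (B x)) \<in> borel_measurable M" if B: "\<And>i j. (\<lambda>x. B x $ i $ j) \<in> borel_measurable M"
    for B :: "'a \<Rightarrow> real^'n^'n"
    unfolding det_def using B by (intro borel_measurable_sum borel_measurable_times borel_measurable_prod) auto
  have "(\<lambda>x. (\<chi> i j. if j = k then b x $ i else A x $ i $ j) $ i $ j) \<in> borel_measurable M" for k i j
    by (cases "j = k") auto
  then show ?thesis unfolding cramer_solution_def
    by (intro borel_measurable_vec_lambda borel_measurable_divide det) auto
qed

lemma borel_measurable_matrix_vector_mult [measurable (raw)]:
  fixes A :: "'a \<Rightarrow> real^'n^'m"
  assumes [measurable]: "A \<in> borel_measurable M" "b \<in> borel_measurable M"
  shows "(\<lambda>x. A x *v b x) \<in> borel_measurable M"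
  unfolding matrix_vector_mult_def by (intro borel_measurable_vec_lambda) measurable

lemma matrix_vector_mult_norm_bound:
  obtains K where "0 < K" "\<And>(A :: real^'n^'m) v. norm (A *v v) \<le> K * norm A * norm v"
proof -
  have "bilinear ((*v) :: real^'n^'m \<Rightarrow> real^'n \<Rightarrow> real^'m)"
    by (auto simp: bilinear_def linear_iff matrix_vector_mult_add_rdistrib matrix_vector_right_distrib
        matrix_vector_mult_scaleR scaleR_matrix_vector_assoc)
  then have "bounded_bilinear ((*v) :: real^'n^'m \<Rightarrow> real^'n \<Rightarrow> real^'m)"
    by (simp add: bilinear_conv_bounded_bilinear)
  from bounded_bilinear.pos_bounded[OF this] show ?thesis using that by (auto simp: mult_ac)
qed

section \<open>Outer measure and norms of order q\<close>

lemma outer_measure_of_le: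
  assumes "A \<subseteq> B" "B \<in> sets M"
  shows "outer_measure_of M A \<le> emeasure M B"
  unfolding outer_measure_of_def using assms by (intro INF_lower) auto

lemma ennreal_powr_mono: "a \<le> b \<Longrightarrow> 0 \<le> r \<Longrightarrow> ennreal_powr a r \<le> ennreal_powr b r"
  by (cases a; cases b) (auto simp: ennreal_powr_def top_unique intro!: ennreal_leI powr_mono2)

lemma Lq_norm_le_const:
  assumes "prob_space \<mu>" and F: "F \<in> borel_measurable \<mu>" "\<And>x. x \<in> space \<mu> \<Longrightarrow> F x \<le> ennreal a"
    and q: "1 \<le> q" and a: "0 \<le> a"
  shows "Lq_norm \<mu> q F \<le> ennreal a"
proof -
  interpret prob_space \<mu> by fact
  show ?thesis
  proof (cases "q = \<infinity>")
    case True
    then show ?thesis using F by (auto simp: Lq_norm_def)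
  next
    case False
    then obtain r where r: "q = ennreal r" "0 \<le> r" by (cases q) auto
    then have r1: "1 \<le> r" using q by simp
    have "(\<integral>\<^sup>+x. ennreal_powr (F x) r \<partial>\<mu>) \<le> (\<integral>\<^sup>+x. ennreal_powr (ennreal a) r \<partial>\<mu>)"
      using F(2) r1 by (intro nn_integral_mono ennreal_powr_mono) auto
    also have "\<dots> = ennreal_powr (ennreal a) r" by (simp add: emeasure_space_1)
    finally have "ennreal_powr (\<integral>\<^sup>+x. ennreal_powr (F x) r \<partial>\<mu>) (1 / r)
      \<le> ennreal_powr (ennreal_powr (ennreal a) r) (1 / r)"
      using r1 by (intro ennreal_powr_mono) auto
    also have "\<dots> = ennreal a" using a r1 by (simp add: ennreal_powr_def powr_powr)
    finally show ?thesis using False r by (simp add: Lq_norm_def)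
  qed
qed

section \<open>Uniform convergence of residual averages\<close>

lemma square_integrable_of_exp_moment:
  fixes X :: "'a \<Rightarrow> real"
  assumes [measurable]: "X \<in> borel_measurable P" and mom: "(\<integral>\<^sup>+e. ennreal (exp \<bar>X e\<bar>) \<partial>P) < \<infinity>"
  shows "square_integrable P X"
proof -
  have "integrable P (\<lambda>e. 2 * exp \<bar>X e\<bar>)"
    using mom by (intro integrable_mult_right integrableI_nonneg) auto
  moreover have "\<bar>(X e)\<^sup>2\<bar> \<le> 2 * exp \<bar>X e\<bar>" for e
    using exp_lower_Taylor_quadratic[of "\<bar>X e\<bar>"] by simp
  note bound = this
  ultimately have "integrable P (\<lambda>e. (X e)\<^sup>2)"
  proof (elim Bochner_Integration.integrable_bound)
    show "AE e in P. norm ((X e)\<^sup>2) \<le> norm (2 * exp \<bar>X e\<bar>)" using bound by (intro AE_I2) simp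
  qed simp
  then show ?thesis by (simp add: square_integrable_def)
qed

text \<open>\<open>XX\<close> is the support of the covariates, \<open>GG\<close> the set of those for which exponential moments are known on a
  countable dense part \<open>D\<close> of \<open>Z\<close>, and \<open>\<phi> x z e\<close> stands for \<open>c z (f x + Q x *v e)\<close>.\<close>

locale residual_process = prob_space M for M :: "'b measure" +
  fixes P :: "'e::euclidean_space measure" and err :: "nat \<Rightarrow> 'b \<Rightarrow> 'e"
    and Z D :: "'z::euclidean_space set" and XX GG :: "'x::metric_space set" and S :: "'e set"
    and \<phi> :: "'x \<Rightarrow> 'z \<Rightarrow> 'e \<Rightarrow> real" and L :: real
  assumes indep_err: "indep_vars (\<lambda>_. borel) err UNIV" and distr_err: "distr M borel (err i) = P"
    and norm_integrable: "integrable P norm"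
    and compact_Z: "compact Z" and Z_nonempty: "Z \<noteq> {}" and compact_XX: "compact XX"
    and D: "D \<subseteq> Z" "Z \<subseteq> closure D" and GG: "GG \<subseteq> XX" "XX \<subseteq> closure GG"
    and S_meas: "S \<in> sets borel" and S_AE: "AE e in P. e \<in> S"
    and \<phi>_meas: "x \<in> XX \<Longrightarrow> z \<in> Z \<Longrightarrow> \<phi> x z \<in> borel_measurable borel"
    and \<phi>_lipschitz: "x \<in> XX \<Longrightarrow> z \<in> Z \<Longrightarrow> z' \<in> Z \<Longrightarrow> e \<in> S \<Longrightarrow> \<bar>\<phi> x z e - \<phi> x z' e\<bar> \<le> L * dist z z'"
    and L_pos: "0 < L"
    and \<phi>_equicont: "0 < \<eta> \<Longrightarrow> \<exists>\<delta>>0. \<forall>x\<in>XX. \<forall>x'\<in>XX. dist x x' < \<delta> \<longrightarrow>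
      (\<forall>z\<in>Z. \<forall>e\<in>S. \<bar>\<phi> x z e - \<phi> x' z e\<bar> \<le> \<eta> * (1 + norm e))"
    and exp_moment: "x \<in> GG \<Longrightarrow> z \<in> D \<Longrightarrow> (\<integral>\<^sup>+e. ennreal (exp \<bar>\<phi> x z e\<bar>) \<partial>P) < \<infinity>"
begin

definition \<gamma> :: "'x \<Rightarrow> 'z \<Rightarrow> real" where "\<gamma> x z = (\<integral>e. \<phi> x z e \<partial>P)"

definition \<gamma>n :: "nat \<Rightarrow> 'b \<Rightarrow> 'x \<Rightarrow> 'z \<Rightarrow> real"
  where "\<gamma>n n \<omega> x z = (1 / real n) * (\<Sum>i<n. \<phi> x z (err i \<omega>))"

text \<open>Off the almost sure event \<open>S\<close> the map \<open>\<phi> x\<close> need not be Lipschitz; the truncation \<open>\<psi>\<close> is Lipschitz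
  for every error.\<close>

definition \<psi> :: "'x \<Rightarrow> 'z \<Rightarrow> 'e \<Rightarrow> real" where "\<psi> x z e = (if e \<in> S then \<phi> x z e else 0)"

text \<open>A null event. Off it \<phi> and \<psi> agree along the data for all x and z, so almost
  sure statements become pointwise ones.\<close>

definition bad :: "'b set" where "bad = {\<omega> \<in> space M. \<exists>i. err i \<omega> \<notin> S}"

lemma err_meas [measurable]: "err i \<in> borel_measurable M"
  using indep_err by (simp add: indep_vars_def2)

lemma sets_P [measurable_cong]: "sets P = sets borel"
  unfolding distr_err[of 0, symmetric] by simp

lemma prob_space_P: "prob_space P"
  unfolding distr_err[of 0, symmetric] by (rule prob_space_distr) simp

lemma bad_null: "bad \<in> null_sets M"
proof -
  have "AE \<omega> in M. err i \<omega> \<in> S" for i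
    by (rule AE_distrD[OF err_meas]) (unfold distr_err, rule S_AE)
  then have "AE \<omega> in M. \<forall>i. err i \<omega> \<in> S" by (simp add: AE_all_countable)
  moreover have "bad \<in> sets M"
    unfolding bad_def using S_meas by measurable
  ultimately show ?thesis
    by (subst AE_iff_null_sets) (auto simp: bad_def elim: eventually_mono)
qed

lemma \<phi>_meas_P: "x \<in> XX \<Longrightarrow> z \<in> Z \<Longrightarrow> \<phi> x z \<in> borel_measurable P"
  using \<phi>_meas by (simp add: measurable_cong_sets[OF sets_P refl])

text \<open>Differences in z are bounded almost surely, so square integrability passes from the
  points of D, where exponential moments are known, to all of Z.\<close>

lemma \<phi>_z_bounded_diff:
  assumes "x \<in> XX" "z \<in> Z" "z' \<in> Z"
  shows "square_integrable P (\<phi> x z) \<Longrightarrow> square_integrable P (\<phi> x z')"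
proof -
  assume sq: "square_integrable P (\<phi> x z)"
  interpret P: prob_space P by (rule prob_space_P)
  have [measurable]: "\<phi> x z \<in> borel_measurable P" "\<phi> x z' \<in> borel_measurable P" using \<phi>_meas_P assms by auto
  have "integrable P (\<lambda>e. (\<phi> x z' e - \<phi> x z e)\<^sup>2)"
  proof (rule P.integrable_const_bound)
    show "AE e in P. norm ((\<phi> x z' e - \<phi> x z e)\<^sup>2) \<le> (L * dist z' z)\<^sup>2"
      using S_AE
    proof eventually_elim
      case (elim e)
      have "\<bar>\<phi> x z' e - \<phi> x z e\<bar>\<^sup>2 \<le> (L * dist z' z)\<^sup>2"
        using \<phi>_lipschitz[OF assms(1,3,2) elim] by (intro power_mono) auto
      then show ?case by simp
    qed
  qed simp
  then have "square_integrable P (\<lambda>e. \<phi> x z' e - \<phi> x z e)" by (simp add: square_integrable_def)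
  from square_integrable_add[OF sq this] show ?thesis by simp
qed

lemma \<phi>_sq: "x \<in> GG \<Longrightarrow> z \<in> Z \<Longrightarrow> square_integrable P (\<phi> x z)"
proof -
  assume x: "x \<in> GG" and z: "z \<in> Z"
  obtain d where d: "d \<in> D" using D(2) z by fastforce
  have "x \<in> XX" "d \<in> Z" using x d D GG by auto
  then have "square_integrable P (\<phi> x d)"
    by (intro square_integrable_of_exp_moment \<phi>_meas_P exp_moment x d)
  then show ?thesis using x z d D GG \<phi>_z_bounded_diff[of x d z] by blast
qed

lemma \<psi>_AE: "AE e in P. \<psi> x z e = \<phi> x z e"
  using S_AE by eventually_elim (simp add: \<psi>_def)

lemma \<psi>_meas: "x \<in> XX \<Longrightarrow> z \<in> Z \<Longrightarrow> \<psi> x z \<in> borel_measurable borel"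
  unfolding \<psi>_def using S_meas \<phi>_meas by measurable

lemma \<psi>_meas_P: "x \<in> XX \<Longrightarrow> z \<in> Z \<Longrightarrow> \<psi> x z \<in> borel_measurable P"
  using \<psi>_meas by (simp add: measurable_cong_sets[OF sets_P refl])

lemma lipschitz_class_\<psi>:
  assumes x: "x \<in> GG"
  shows "lipschitz_class M P err Z (\<psi> x) L"
proof
  have xX: "x \<in> XX" using x GG by blast
  show "indep_vars (\<lambda>_. borel) err UNIV" by (rule indep_err)
  show "distr M borel (err i) = P" for i by (rule distr_err)
  show "compact Z" "Z \<noteq> {}" "0 < L" by (fact compact_Z Z_nonempty L_pos)+
  show "\<psi> x z \<in> borel_measurable borel" if "z \<in> Z" for z using \<psi>_meas xX that by blast
  show "\<bar>\<psi> x z e - \<psi> x z' e\<bar> \<le> L * dist z z'" if "z \<in> Z" "z' \<in> Z" for z z' e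
    using \<phi>_lipschitz[OF xX that, of e] L_pos by (auto simp: \<psi>_def)
  show "integrable P (\<lambda>e. (\<psi> x z e)\<^sup>2)" if z: "z \<in> Z" for z
  proof -
    have [measurable]: "\<phi> x z \<in> borel_measurable P" "\<psi> x z \<in> borel_measurable P"
      using \<phi>_meas_P \<psi>_meas_P xX z by auto
    have "integrable P (\<lambda>e. (\<phi> x z e)\<^sup>2)" using \<phi>_sq[OF x z] by (simp add: square_integrable_def)
    moreover have "AE e in P. (\<psi> x z e)\<^sup>2 = (\<phi> x z e)\<^sup>2" using \<psi>_AE[of x z] by eventually_elim simp
    ultimately show ?thesis by (subst integrable_cong_AE) auto
  qed
qed

lemma m_eq_\<gamma>: "x \<in> XX \<Longrightarrow> z \<in> Z \<Longrightarrow> (\<integral>e. \<psi> x z e \<partial>P) = \<gamma> x z"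
  unfolding \<gamma>_def using \<phi>_meas_P \<psi>_meas_P \<psi>_AE by (intro integral_cong_AE) auto

lemma mean_dev_eq_\<gamma>:
  assumes "x \<in> GG" "z \<in> Z" "\<omega> \<in> space M - bad" "0 < n"
  shows "lipschitz_class.mean_dev P err (\<psi> x) n \<omega> z = \<gamma>n n \<omega> x z - \<gamma> x z"
proof -
  interpret lipschitz_class M P err Z "\<psi> x" L using assms(1) by (rule lipschitz_class_\<psi>)
  have "\<psi> x z (err i \<omega>) = \<phi> x z (err i \<omega>)" for i using assms(3) by (auto simp: bad_def \<psi>_def)
  moreover have "m z = \<gamma> x z" using m_eq_\<gamma>[of x z] assms GG by (auto simp: m_def)
  ultimately show ?thesis using assms(4) by (simp add: mean_dev_eq \<gamma>n_def)
qed

lemma pointwise_chernoff: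
  assumes x: "x \<in> GG" and \<kappa>: "0 < \<kappa>"
  shows "\<exists>K>0. \<exists>\<beta>>0. \<forall>n>0. \<exists>E\<in>sets M. bad \<subseteq> E \<and> prob E \<le> K * exp (- real n * \<beta>) \<and>
    (\<forall>\<omega>\<in>space M - E. \<forall>z\<in>Z. \<bar>\<gamma>n n \<omega> x z - \<gamma> x z\<bar> \<le> \<kappa>)"
proof -
  interpret lc: lipschitz_class M P err Z "\<psi> x" L using x by (rule lipschitz_class_\<psi>)
  have xX: "x \<in> XX" using x GG by blast
  have mom: "(\<integral>\<^sup>+e. ennreal (exp \<bar>lc.h z e\<bar>) \<partial>P) < \<infinity>" if z: "z \<in> D" for z
  proof -
    have zZ: "z \<in> Z" using z D by blast
    have [measurable]: "\<phi> x z \<in> borel_measurable P" using \<phi>_meas_P xX zZ by blast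
    have "(\<integral>\<^sup>+e. ennreal (exp \<bar>lc.h z e\<bar>) \<partial>P) \<le> (\<integral>\<^sup>+e. ennreal (exp \<bar>lc.m z\<bar>) * ennreal (exp \<bar>\<phi> x z e\<bar>) \<partial>P)"
    proof (rule nn_integral_mono_AE)
      show "AE e in P. ennreal (exp \<bar>lc.h z e\<bar>) \<le> ennreal (exp \<bar>lc.m z\<bar>) * ennreal (exp \<bar>\<phi> x z e\<bar>)"
        using \<psi>_AE[of x z]
      proof eventually_elim
        case (elim e)
        have "exp \<bar>lc.h z e\<bar> \<le> exp (\<bar>lc.m z\<bar> + \<bar>\<phi> x z e\<bar>)" by (simp add: lc.h_def elim)
        then show ?case by (simp add: exp_add ennreal_leI flip: ennreal_mult)
      qed
    qed
    also have "\<dots> = ennreal (exp \<bar>lc.m z\<bar>) * (\<integral>\<^sup>+e. ennreal (exp \<bar>\<phi> x z e\<bar>) \<partial>P)"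
      by (rule nn_integral_cmult) measurable
    also have "\<dots> < \<infinity>" using exp_moment[OF x z] by (simp add: ennreal_mult_less_top)
    finally show ?thesis .
  qed
  obtain K \<beta> where K: "K > 0" "\<beta> > 0" "\<And>n. \<exists>E\<in>sets M. prob E \<le> K * exp (- real n * \<beta>) \<and>
    (\<forall>\<omega>\<in>space M - E. \<forall>z\<in>Z. \<bar>lc.mean_dev n \<omega> z\<bar> \<le> \<kappa>)"
    using lc.uniform_chernoff[OF D \<kappa> mom] by blast
  \<comment> \<open>For n = 0 division by zero makes both the empty average and
    \<open>lc.mean_dev\<close> equal to 0, and \<open>\<gamma>n - \<gamma>\<close> is then
    -\<gamma>; the two deviations agree from n = 1 on.\<close>
  have main: "\<exists>E\<in>sets M. bad \<subseteq> E \<and> prob E \<le> K * exp (- real n * \<beta>) \<and>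
    (\<forall>\<omega>\<in>space M - E. \<forall>z\<in>Z. \<bar>\<gamma>n n \<omega> x z - \<gamma> x z\<bar> \<le> \<kappa>)" if n: "0 < n" for n
  proof -
    from K(3)[of n] obtain E where E: "E \<in> sets M" "prob E \<le> K * exp (- real n * \<beta>)"
      "\<forall>\<omega>\<in>space M - E. \<forall>z\<in>Z. \<bar>lc.mean_dev n \<omega> z\<bar> \<le> \<kappa>" by (elim bexE conjE)
    have "prob (E \<union> bad) = prob E" using bad_null E(1) by (simp add: measure_Un_null_set)
    moreover have "\<bar>\<gamma>n n \<omega> x z - \<gamma> x z\<bar> \<le> \<kappa>" if "\<omega> \<in> space M - (E \<union> bad)" "z \<in> Z" for \<omega> z
    proof -
      have "\<bar>lc.mean_dev n \<omega> z\<bar> \<le> \<kappa>" using E(3) that by blast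
      then show ?thesis using mean_dev_eq_\<gamma>[OF x that(2) _ n, of \<omega>] that(1) by simp
    qed
    moreover have "E \<union> bad \<in> sets M" "bad \<subseteq> E \<union> bad" using E(1) bad_null by auto
    ultimately show ?thesis using E(2) by (metis (no_types, lifting))
  qed
  show ?thesis by (intro exI[of _ K] exI[of _ \<beta>] conjI allI impI K(1,2) main)
qed

text \<open>For x outside GG no moment is known directly. A nearby point of GG and equicontinuity
  with \<eta> = 1 give a dominating function, integrable because the norm of the error is.\<close>

lemma \<phi>_integrable:
  assumes "x \<in> XX" "z \<in> Z"
  shows "integrable P (\<phi> x z)"
proof -
  interpret P: prob_space P by (rule prob_space_P)
  obtain \<delta> where \<delta>: "\<delta> > 0" "\<And>x x'. x \<in> XX \<Longrightarrow> x' \<in> XX \<Longrightarrow> dist x x' < \<delta> \<Longrightarrow>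
      (\<forall>z\<in>Z. \<forall>e\<in>S. \<bar>\<phi> x z e - \<phi> x' z e\<bar> \<le> 1 * (1 + norm e))"
    using \<phi>_equicont[of 1] by auto
  obtain x' where x': "x' \<in> GG" "dist x' x < \<delta>"
    using assms(1) GG(2) \<delta>(1) by (meson closure_approachable subsetD)
  have "x' \<in> XX" using x' GG by blast
  have [measurable]: "\<phi> x z \<in> borel_measurable P" "\<phi> x' z \<in> borel_measurable P"
    using \<phi>_meas_P assms \<open>x' \<in> XX\<close> by auto
  have i': "integrable P (\<phi> x' z)"
    by (rule P.square_integrable_imp_integrable) (use \<phi>_sq[OF x'(1) assms(2)] in \<open>auto simp: square_integrable_def\<close>)
  have "integrable P (\<lambda>e. \<bar>\<phi> x' z e\<bar> + (1 + norm e))" using i' norm_integrable by auto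
  then show ?thesis
  proof (rule Bochner_Integration.integrable_bound)
    show "AE e in P. norm (\<phi> x z e) \<le> norm (\<bar>\<phi> x' z e\<bar> + (1 + norm e))"
      using S_AE
    proof eventually_elim
      case (elim e)
      have "\<bar>\<phi> x' z e - \<phi> x z e\<bar> \<le> 1 * (1 + norm e)"
        using \<delta>(2)[OF \<open>x' \<in> XX\<close> assms(1) x'(2)] assms(2) elim by blast
      then show ?case by simp
    qed
  qed simp
qed

lemma \<gamma>_lipschitz:
  assumes x: "x \<in> XX" and z: "z \<in> Z" "z' \<in> Z"
  shows "\<bar>\<gamma> x z - \<gamma> x z'\<bar> \<le> L * dist z z'"
proof -
  interpret P: prob_space P by (rule prob_space_P)
  have "\<bar>\<gamma> x z - \<gamma> x z'\<bar> = \<bar>\<integral>e. \<phi> x z e - \<phi> x z' e \<partial>P\<bar>"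
    using \<phi>_integrable assms by (simp add: \<gamma>_def)
  also have "\<dots> \<le> (\<integral>e. \<bar>\<phi> x z e - \<phi> x z' e\<bar> \<partial>P)" by (rule integral_abs_bound)
  also have "\<dots> \<le> (\<integral>e. L * dist z z' \<partial>P)"
  proof (rule integral_mono_AE)
    show "AE e in P. \<bar>\<phi> x z e - \<phi> x z' e\<bar> \<le> L * dist z z'"
      using S_AE by eventually_elim (rule \<phi>_lipschitz[OF x z])
  qed (use \<phi>_integrable assms in auto)
  finally show ?thesis by (simp add: P.prob_space)
qed

lemma \<gamma>n_lipschitz:
  assumes x: "x \<in> XX" and z: "z \<in> Z" "z' \<in> Z" and \<omega>: "\<omega> \<in> space M - bad"
  shows "\<bar>\<gamma>n n \<omega> x z - \<gamma>n n \<omega> x z'\<bar> \<le> L * dist z z'"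
proof -
  have "\<gamma>n n \<omega> x z - \<gamma>n n \<omega> x z' = (\<Sum>i<n. \<phi> x z (err i \<omega>) - \<phi> x z' (err i \<omega>)) / real n"
    by (simp add: \<gamma>n_def sum_subtractf diff_divide_distrib)
  also have "\<bar>\<dots>\<bar> \<le> (\<Sum>i<n. L * dist z z') / real n"
    unfolding abs_divide abs_of_nat using \<omega>
    by (intro divide_right_mono order_trans[OF sum_abs] sum_mono \<phi>_lipschitz x z) (auto simp: bad_def)
  also have "\<dots> \<le> L * dist z z'" using L_pos by (cases "n = 0") auto
  finally show ?thesis .
qed

lemma continuous_on_dev:
  assumes "x \<in> XX" "\<omega> \<in> space M - bad"
  shows "continuous_on Z (\<gamma>n n \<omega> x)" "continuous_on Z (\<gamma> x)"
  using assms L_pos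
  by (auto intro!: lipschitz_on_continuous_on[of L] lipschitz_onI \<gamma>n_lipschitz \<gamma>_lipschitz simp: dist_real_def)

lemma \<gamma>_x_equicont:
  assumes x: "x \<in> XX" "x' \<in> XX" and z: "z \<in> Z" and "0 \<le> \<eta>"
    and le: "\<And>e. e \<in> S \<Longrightarrow> \<bar>\<phi> x z e - \<phi> x' z e\<bar> \<le> \<eta> * (1 + norm e)"
  shows "\<bar>\<gamma> x z - \<gamma> x' z\<bar> \<le> \<eta> * (1 + (\<integral>e. norm e \<partial>P))"
proof -
  interpret P: prob_space P by (rule prob_space_P)
  have "\<bar>\<gamma> x z - \<gamma> x' z\<bar> = \<bar>\<integral>e. \<phi> x z e - \<phi> x' z e \<partial>P\<bar>"
    using \<phi>_integrable assms by (simp add: \<gamma>_def)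
  also have "\<dots> \<le> (\<integral>e. \<bar>\<phi> x z e - \<phi> x' z e\<bar> \<partial>P)" by (rule integral_abs_bound)
  also have "\<dots> \<le> (\<integral>e. \<eta> * (1 + norm e) \<partial>P)"
  proof (rule integral_mono_AE)
    show "AE e in P. \<bar>\<phi> x z e - \<phi> x' z e\<bar> \<le> \<eta> * (1 + norm e)"
      using S_AE by eventually_elim (rule le)
  qed (use \<phi>_integrable norm_integrable x z in auto)
  also have "\<dots> = \<eta> * (1 + (\<integral>e. norm e \<partial>P))" using norm_integrable by (simp add: P.prob_space)
  finally show ?thesis .
qed

text \<open>The modulus of continuity in x is random only through the mean norm of the errors, which
  Markov's inequality bounds with high probability.\<close>

lemma \<gamma>n_x_equicont:
  assumes \<omega>: "\<omega> \<in> space M - bad" and "0 \<le> \<eta>" and n: "0 < n"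
    and le: "\<And>e. e \<in> S \<Longrightarrow> \<bar>\<phi> x z e - \<phi> x' z e\<bar> \<le> \<eta> * (1 + norm e)"
  shows "\<bar>\<gamma>n n \<omega> x z - \<gamma>n n \<omega> x' z\<bar> \<le> \<eta> * (1 + (\<Sum>i<n. norm (err i \<omega>)) / real n)"
proof -
  have "\<gamma>n n \<omega> x z - \<gamma>n n \<omega> x' z = (\<Sum>i<n. \<phi> x z (err i \<omega>) - \<phi> x' z (err i \<omega>)) / real n"
    by (simp add: \<gamma>n_def sum_subtractf diff_divide_distrib)
  also have "\<bar>\<dots>\<bar> \<le> (\<Sum>i<n. \<eta> * (1 + norm (err i \<omega>))) / real n"
    unfolding abs_divide abs_of_nat using \<omega>
    by (intro divide_right_mono order_trans[OF sum_abs] sum_mono le) (auto simp: bad_def)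
  also have "\<dots> = \<eta> * (1 + (\<Sum>i<n. norm (err i \<omega>)) / real n)"
    using n by (simp add: sum_distrib_left[symmetric] sum.distrib field_simps)
  finally show ?thesis .
qed

lemma mean_norm_tail:
  assumes "0 < R" "0 < n"
  shows "prob {\<omega> \<in> space M. R < (\<Sum>i<n. norm (err i \<omega>)) / real n} \<le> (\<integral>e. norm e \<partial>P) / R"
proof -
  have eq: "expectation (\<lambda>\<omega>. norm (err i \<omega>)) = (\<integral>e. norm e \<partial>P)" "integrable M (\<lambda>\<omega>. norm (err i \<omega>))" for i
  proof -
    have "(\<integral>e. norm e \<partial>distr M borel (err i)) = expectation (\<lambda>\<omega>. norm (err i \<omega>))"
      by (rule integral_distr) auto
    then show "expectation (\<lambda>\<omega>. norm (err i \<omega>)) = (\<integral>e. norm e \<partial>P)" by (simp add: distr_err)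
    have "integrable (distr M borel (err i)) norm \<longleftrightarrow> integrable M (\<lambda>\<omega>. norm (err i \<omega>))"
      by (rule integrable_distr_eq) auto
    then show "integrable M (\<lambda>\<omega>. norm (err i \<omega>))" using norm_integrable by (simp add: distr_err)
  qed
  let ?A = "\<lambda>\<omega>. (\<Sum>i<n. norm (err i \<omega>)) / real n"
  have int: "integrable M ?A" using eq(2) by simp
  have E: "expectation ?A = (\<integral>e. norm e \<partial>P)" using eq assms(2) by simp
  have "prob {\<omega> \<in> space M. R < ?A \<omega>} \<le> prob {\<omega> \<in> space M. R \<le> ?A \<omega>}"
    by (intro finite_measure_mono) auto
  also have "\<dots> \<le> expectation ?A / R"
    using int assms(1) by (intro integral_Markov_inequality_measure[where A = "{}"])
      (auto intro!: divide_nonneg_nonneg sum_nonneg)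
  finally show ?thesis unfolding E .
qed

text \<open>A finite net of the support inside GG carries the pointwise bounds, and equicontinuity
  in x spreads them to the whole support. The event contains \<open>bad\<close>, because
  measurability of the supremum as a function of x is established only off it.\<close>

lemma uniform_consistency:
  assumes \<kappa>: "0 < \<kappa>" and \<tau>: "0 < \<tau>"
  shows "\<exists>n0. \<forall>n\<ge>n0. \<exists>E\<in>sets M. bad \<subseteq> E \<and> prob E \<le> \<tau> \<and>
    (\<forall>\<omega>\<in>space M - E. \<forall>x\<in>XX. \<forall>z\<in>Z. \<bar>\<gamma>n n \<omega> x z - \<gamma> x z\<bar> \<le> \<kappa>)"
proof -
  define a where "a = (\<integral>e. norm e \<partial>P)"
  have a: "0 \<le> a" by (simp add: a_def)
  \<comment> \<open>R makes the Markov bound for the mean norm at most \<tau> / 2, and \<eta> makes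
    each of the two changes of x cost at most \<kappa> / 4; the net points contribute a third
    quarter.\<close>
  define R where "R = 2 * (a + 1) / \<tau>"
  have R: "0 < R" "a / R \<le> \<tau> / 2" using a \<tau> by (auto simp: R_def field_simps)
  define \<eta> where "\<eta> = \<kappa> / (4 * (1 + R + a))"
  have \<eta>: "0 < \<eta>" "\<eta> * (1 + R) \<le> \<kappa> / 4" "\<eta> * (1 + a) \<le> \<kappa> / 4"
  proof -
    have p: "0 < 1 + R + a" using R(1) a by simp
    then show 1: "0 < \<eta>" using \<kappa> by (simp add: \<eta>_def)
    have "\<eta> * (1 + R + a) = \<kappa> / 4"
      unfolding \<eta>_def using p by (metis divide_divide_eq_left mult.commute nonzero_eq_divide_eq less_numeral_extra(3))
    moreover have "\<eta> * (1 + R) \<le> \<eta> * (1 + R + a)" "\<eta> * (1 + a) \<le> \<eta> * (1 + R + a)"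
      using 1 R(1) a by (auto intro!: mult_left_mono)
    ultimately show "\<eta> * (1 + R) \<le> \<kappa> / 4" "\<eta> * (1 + a) \<le> \<kappa> / 4" by linarith+
  qed
  obtain \<delta> where \<delta>: "\<delta> > 0" "\<And>x x' z e. x \<in> XX \<Longrightarrow> x' \<in> XX \<Longrightarrow> dist x x' < \<delta> \<Longrightarrow>
      z \<in> Z \<Longrightarrow> e \<in> S \<Longrightarrow> \<bar>\<phi> x z e - \<phi> x' z e\<bar> \<le> \<eta> * (1 + norm e)"
    using \<phi>_equicont[OF \<eta>(1)] by blast
  obtain F where F: "finite F" "F \<subseteq> GG" "XX \<subseteq> (\<Union>x\<in>F. ball x \<delta>)"
    using compact_finite_net_of_dense[OF compact_XX GG \<delta>(1)] by blast
  \<comment> \<open>The other half of \<tau> is split among the net points; the added 1 avoids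
    division by zero for an empty net.\<close>
  define \<tau>' where "\<tau>' = \<tau> / (2 * (real (card F) + 1))"
  have \<tau>': "0 < \<tau>'" "card F * \<tau>' \<le> \<tau> / 2"
    using \<tau> by (auto simp: \<tau>'_def field_simps add_pos_nonneg)
  define ok where "ok n t x E \<longleftrightarrow> E \<in> sets M \<and> prob E \<le> t \<and>
    (\<forall>\<omega>\<in>space M - E. \<forall>z\<in>Z. \<bar>\<gamma>n n \<omega> x z - \<gamma> x z\<bar> \<le> \<kappa> / 4)" for n t x E
  have "\<exists>n1. \<forall>n\<ge>n1. \<exists>E. ok n \<tau>' x E" if x: "x \<in> GG" for x
  proof -
    have "\<exists>K>0. \<exists>\<beta>>0. \<forall>n>0. \<exists>E\<in>sets M. bad \<subseteq> E \<and> prob E \<le> K * exp (- real n * \<beta>) \<and>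
      (\<forall>\<omega>\<in>space M - E. \<forall>z\<in>Z. \<bar>\<gamma>n n \<omega> x z - \<gamma> x z\<bar> \<le> \<kappa> / 4)"
      using \<kappa> by (intro pointwise_chernoff[OF x]) simp
    then obtain K \<beta> where K: "K > 0" "\<beta> > 0" and KE: "\<forall>n>0. \<exists>E\<in>sets M. bad \<subseteq> E \<and> prob E \<le> K * exp (- real n * \<beta>) \<and>
      (\<forall>\<omega>\<in>space M - E. \<forall>z\<in>Z. \<bar>\<gamma>n n \<omega> x z - \<gamma> x z\<bar> \<le> \<kappa> / 4)" by (elim exE conjE)
    have okK: "\<exists>E. ok n (K * exp (- real n * \<beta>)) x E" if "0 < n" for n
    proof -
      from KE[rule_format, OF that] obtain E where "E \<in> sets M" "prob E \<le> K * exp (- real n * \<beta>)"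
        "\<forall>\<omega>\<in>space M - E. \<forall>z\<in>Z. \<bar>\<gamma>n n \<omega> x z - \<gamma> x z\<bar> \<le> \<kappa> / 4" by (elim bexE conjE)
      then show ?thesis unfolding ok_def by (intro exI[of _ E] conjI)
    qed
    have "(\<lambda>n. K * exp (- \<beta>) ^ n) \<longlonglongrightarrow> K * 0"
      using K(2) by (intro tendsto_mult_left LIMSEQ_realpow_zero) auto
    then have "\<forall>\<^sub>F n in sequentially. K * exp (- \<beta>) ^ n < \<tau>'"
      using \<tau>'(1) by (intro order_tendstoD) auto
    then obtain n1 where n1: "\<And>n. n \<ge> n1 \<Longrightarrow> K * exp (- \<beta>) ^ n < \<tau>'" by (auto simp: eventually_sequentially)
    have "\<exists>E. ok n \<tau>' x E" if n: "n \<ge> max 1 n1" for n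
    proof -
      obtain E where E: "ok n (K * exp (- real n * \<beta>)) x E" using okK[of n] n by auto
      have "K * exp (- real n * \<beta>) \<le> \<tau>'" using n1[of n] n by (simp add: exp_of_nat_mult[symmetric])
      then have "ok n \<tau>' x E" using E by (auto simp: ok_def)
      then show ?thesis by blast
    qed
    then show ?thesis by blast
  qed
  then have "\<forall>x\<in>F. \<exists>n1. \<forall>n\<ge>n1. \<exists>E. ok n \<tau>' x E" using F(2) by blast
  then obtain n1 where n1: "\<forall>x\<in>F. \<forall>n\<ge>n1 x. \<exists>E. ok n \<tau>' x E" using bchoice by metis
  \<comment> \<open>The sum dominates each threshold \<open>n1 x\<close>, and \<open>Suc\<close>
    ensures that n is positive.\<close>
  define n0 where "n0 = Suc (\<Sum>x\<in>F. n1 x)"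
  have "\<exists>E\<in>sets M. bad \<subseteq> E \<and> prob E \<le> \<tau> \<and>
    (\<forall>\<omega>\<in>space M - E. \<forall>x\<in>XX. \<forall>z\<in>Z. \<bar>\<gamma>n n \<omega> x z - \<gamma> x z\<bar> \<le> \<kappa>)" if n: "n \<ge> n0" for n
  proof -
    have n_pos: "0 < n" using n by (simp add: n0_def)
    have nx: "n \<ge> n1 x" if "x \<in> F" for x
      using n member_le_sum[OF that, of n1] F(1) by (simp add: n0_def)
    have "\<forall>x\<in>F. \<exists>E. ok n \<tau>' x E" using n1 nx by blast
    then obtain E where okE: "\<forall>x\<in>F. ok n \<tau>' x (E x)" using bchoice by metis
    have E: "E x \<in> sets M" "prob (E x) \<le> \<tau>'"
      "\<forall>\<omega>\<in>space M - E x. \<forall>z\<in>Z. \<bar>\<gamma>n n \<omega> x z - \<gamma> x z\<bar> \<le> \<kappa> / 4" if "x \<in> F" for x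
      using bspec[OF okE that] unfolding ok_def by simp_all
    define A where "A = {\<omega> \<in> space M. R < (\<Sum>i<n. norm (err i \<omega>)) / real n}"
    have A: "A \<in> sets M" unfolding A_def by measurable
    have UE: "(\<Union>x\<in>F. E x) \<in> sets M" using F(1) E(1) by (intro sets.finite_UN) auto
    have "prob (A \<union> (\<Union>x\<in>F. E x)) \<le> prob A + prob (\<Union>x\<in>F. E x)"
      using A UE by (intro measure_subadditive) auto
    also have "prob A \<le> \<tau> / 2"
      using order_trans[OF mean_norm_tail[OF R(1) n_pos] R(2)[unfolded a_def]] unfolding A_def .
    also have "prob (\<Union>x\<in>F. E x) \<le> (\<Sum>x\<in>F. prob (E x))" using F(1) E(1) by (intro measure_UNION_le) auto
    also have "\<dots> \<le> (\<Sum>x\<in>F. \<tau>')" by (intro sum_mono E(2))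
    also have "\<dots> \<le> \<tau> / 2" using \<tau>'(2) by simp
    finally have "prob (A \<union> (\<Union>x\<in>F. E x)) \<le> \<tau>" by simp
    then have "prob (A \<union> (\<Union>x\<in>F. E x) \<union> bad) \<le> \<tau>"
      using bad_null A UE by (subst measure_Un_null_set) auto
    moreover have "\<bar>\<gamma>n n \<omega> x z - \<gamma> x z\<bar> \<le> \<kappa>"
      if \<omega>: "\<omega> \<in> space M - (A \<union> (\<Union>x\<in>F. E x) \<union> bad)" and x: "x \<in> XX" and z: "z \<in> Z" for \<omega> x z
    proof -
      obtain x' where x': "x' \<in> F" "dist x' x < \<delta>" using F(3) x by auto
      have x'X: "x' \<in> XX" using x' F(2) GG by blast
      note le = \<delta>(2)[OF x'X x x'(2) z]
      have "(\<Sum>i<n. norm (err i \<omega>)) / real n \<le> R" using \<omega> by (auto simp: A_def not_less)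
      then have "\<eta> * (1 + (\<Sum>i<n. norm (err i \<omega>)) / real n) \<le> \<eta> * (1 + R)"
        using \<eta>(1) by (intro mult_left_mono) auto
      moreover have "\<bar>\<gamma>n n \<omega> x' z - \<gamma>n n \<omega> x z\<bar> \<le> \<eta> * (1 + (\<Sum>i<n. norm (err i \<omega>)) / real n)"
        using \<omega> \<eta>(1) n_pos le by (intro \<gamma>n_x_equicont) auto
      moreover have "\<bar>\<gamma> x' z - \<gamma> x z\<bar> \<le> \<eta> * (1 + a)"
        unfolding a_def using \<eta>(1) le x x'X z by (intro \<gamma>_x_equicont) auto
      moreover have "\<bar>\<gamma>n n \<omega> x' z - \<gamma> x' z\<bar> \<le> \<kappa> / 4" using E(3)[OF x'(1)] \<omega> x'(1) z by blast
      ultimately show ?thesis using \<eta> \<kappa> by linarith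
    qed
    ultimately show ?thesis using A UE bad_null by (intro bexI[of _ "A \<union> (\<Union>x\<in>F. E x) \<union> bad"]) auto
  qed
  then show ?thesis by blast
qed

lemma functional_clt:
  assumes x: "x \<in> GG"
  shows "\<exists>(N' :: ('z \<Rightarrow> real) measure) V. prob_space N' \<and>
    tends_in_distribution M (mtopology_of (C_space Z))
      (\<lambda>n \<omega>. restrict (\<lambda>z. sqrt (real n) * (\<gamma>n n \<omega> x z - \<gamma> x z)) Z) N' V"
proof -
  interpret lc: lipschitz_class M P err Z "\<psi> x" L using x by (rule lipschitz_class_\<psi>)
  obtain N' :: "('z \<Rightarrow> real) measure" and V where N': "prob_space N'"
    "V \<in> N' \<rightarrow>\<^sub>M borel_sigma (mtopology_of (C_space Z))"
    "\<And>n. (\<lambda>\<omega>. restrict (lc.G n \<omega>) Z) \<in> M \<rightarrow>\<^sub>M borel_sigma (mtopology_of (C_space Z))"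
    "\<And>f. continuous_map (mtopology_of (C_space Z)) euclideanreal f \<Longrightarrow>
      bounded (f ` topspace (mtopology_of (C_space Z))) \<Longrightarrow>
      (\<lambda>n. \<integral>\<omega>. f (restrict (lc.G n \<omega>) Z) \<partial>M) \<longlonglongrightarrow> (\<integral>\<omega>. f (V \<omega>) \<partial>N')"
    using lc.C_space_clt by blast
  have "AE \<omega> in M. restrict (\<lambda>z. sqrt (real n) * (\<gamma>n n \<omega> x z - \<gamma> x z)) Z = restrict (lc.G n \<omega>) Z" for n
    using AE_not_in[OF bad_null] AE_space
  proof eventually_elim
    case (elim \<omega>)
    show ?case
    \<comment> \<open>At n = 0 the factor sqrt 0 on one side and the division by 0 on the other make
      both the zero function.\<close>
    proof (cases "n = 0")
      case False
      then show ?thesis using mean_dev_eq_\<gamma>[OF x] elim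
        by (intro restrict_ext) (simp add: lc.G_eq_mean_dev)
    qed (simp add: lc.G_def cong: restrict_cong)
  qed
  then show ?thesis
    unfolding tends_in_distribution_def random_element_version_def
    using N' by (intro exI[of _ N'] exI[of _ V] conjI exI[of _ "\<lambda>n \<omega>. restrict (lc.G n \<omega>) Z"]) auto
qed

lemma \<gamma>_in_C_space:
  assumes "x \<in> XX"
  shows "restrict (\<gamma> x) Z \<in> mspace (C_space Z)"
proof -
  have "continuous_on Z (\<gamma> x)"
    using L_pos \<gamma>_lipschitz[OF assms]
    by (auto intro!: lipschitz_on_continuous_on[of L] lipschitz_onI simp: dist_real_def)
  then have "continuous_on Z (restrict (\<gamma> x) Z)" by (rule continuous_on_eq) auto
  then show ?thesis unfolding mspace_C_space_iff[OF compact_Z] by auto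
qed

lemma \<gamma>n_version:
  assumes x: "x \<in> XX" and "countable D"
  shows "\<exists>G. random_element_version M (mtopology_of (C_space Z)) (\<lambda>\<omega>. restrict (\<gamma>n n \<omega> x) Z) G"
proof -
  \<comment> \<open>For errors outside S continuity of \<phi> in z is not known, so on
    \<open>bad\<close> the average is replaced by the zero function; only a version is claimed for
    this reason.\<close>
  let ?G = "\<lambda>\<omega>. if \<omega> \<in> bad then restrict (\<lambda>_. 0) Z else restrict (\<gamma>n n \<omega> x) Z"
  have "?G \<in> M \<rightarrow>\<^sub>M borel_sigma (mtopology_of (C_space Z))"
  proof (rule measurable_C_space[OF compact_Z Z_nonempty assms(2) D])
    fix \<omega> assume \<omega>: "\<omega> \<in> space M"
    have "continuous_on Z (restrict u Z)" if "continuous_on Z u" for u :: "'z \<Rightarrow> real"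
      using that by (rule continuous_on_eq) auto
    then show "?G \<omega> \<in> mspace (C_space Z)"
      unfolding mspace_C_space_iff[OF compact_Z] using continuous_on_dev(1)[OF x] \<omega> by auto
  next
    fix d assume "d \<in> D"
    then have d: "d \<in> Z" using D by blast
    have [measurable]: "\<phi> x d \<in> borel_measurable borel" "bad \<in> sets M" using \<phi>_meas x d bad_null by auto
    have "(\<lambda>\<omega>. ?G \<omega> d) = (\<lambda>\<omega>. if \<omega> \<in> bad then 0 else (1 / real n) * (\<Sum>i<n. \<phi> x d (err i \<omega>)))"
      using d by (auto simp: \<gamma>n_def)
    then show "(\<lambda>\<omega>. ?G \<omega> d) \<in> borel_measurable M" by simp
  qed
  moreover have "AE \<omega> in M. restrict (\<gamma>n n \<omega> x) Z = ?G \<omega>"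
    using AE_not_in[OF bad_null] by eventually_elim simp
  ultimately show ?thesis unfolding random_element_version_def by blast
qed

text \<open>Reduces the supremum to one over D. For countable D this makes it a measurable function
  of x once the data are fixed.\<close>

lemma SUP_dev_eq_dense:
  assumes x: "x \<in> XX" and \<omega>: "\<omega> \<in> space M - bad"
  shows "(SUP z\<in>Z. ennreal \<bar>\<gamma>n n \<omega> x z - \<gamma> x z\<bar>) = (SUP z\<in>D. ennreal \<bar>\<gamma>n n \<omega> x z - \<gamma> x z\<bar>)"
proof (rule antisym)
  show "(SUP z\<in>D. ennreal \<bar>\<gamma>n n \<omega> x z - \<gamma> x z\<bar>) \<le> (SUP z\<in>Z. ennreal \<bar>\<gamma>n n \<omega> x z - \<gamma> x z\<bar>)"
    using D(1) by (rule SUP_subset_mono) simp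
  show "(SUP z\<in>Z. ennreal \<bar>\<gamma>n n \<omega> x z - \<gamma> x z\<bar>) \<le> (SUP z\<in>D. ennreal \<bar>\<gamma>n n \<omega> x z - \<gamma> x z\<bar>)" (is "_ \<le> ?s")
  proof (cases ?s)
    case top
    then show ?thesis by (simp only: top_greatest)
  next
    case (real r)
    have "\<bar>\<gamma>n n \<omega> x z - \<gamma> x z\<bar> \<le> r" if "z \<in> Z" for z
    proof (rule abs_diff_le_on_closure[OF continuous_on_dev[OF x \<omega>] D _ that])
      fix d assume "d \<in> D"
      then have "ennreal \<bar>\<gamma>n n \<omega> x d - \<gamma> x d\<bar> \<le> ?s" by (rule SUP_upper)
      then show "\<bar>\<gamma>n n \<omega> x d - \<gamma> x d\<bar> \<le> r" using real by simp
    qed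
    then have "(SUP z\<in>Z. ennreal \<bar>\<gamma>n n \<omega> x z - \<gamma> x z\<bar>) \<le> ennreal r" by (intro SUP_least ennreal_leI)
    then show ?thesis by (simp only: real)
  qed
qed

end

section \<open>The two-stage program\<close>

lemma tends_to_0_in_probI:
  assumes "prob_space M"
    and "\<And>e \<tau>. 0 < e \<Longrightarrow> 0 < \<tau> \<Longrightarrow> \<exists>n0. \<forall>n\<ge>n0. \<exists>E\<in>sets M. measure M E \<le> \<tau> \<and>
      {\<omega> \<in> space M. ennreal e < U n \<omega>} \<subseteq> E"
  shows "tends_to_0_in_prob M U"
  unfolding tends_to_0_in_prob_def
proof (intro allI impI tendsto_zero_ennreal)
  interpret prob_space M by fact
  fix e r :: real assume "0 < e" "0 < r"
  then obtain n0 where n0: "\<And>n. n \<ge> n0 \<Longrightarrow> \<exists>E\<in>sets M. measure M E \<le> r / 2 \<and>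
      {\<omega> \<in> space M. ennreal e < U n \<omega>} \<subseteq> E" using assms(2)[of e "r / 2"] by auto
  have "outer_measure_of M {\<omega> \<in> space M. ennreal e < U n \<omega>} < ennreal r" if "n \<ge> n0" for n
  proof -
    from n0[OF that] obtain E where E: "E \<in> sets M" "measure M E \<le> r / 2" "{\<omega> \<in> space M. ennreal e < U n \<omega>} \<subseteq> E"
      by blast
    have "outer_measure_of M {\<omega> \<in> space M. ennreal e < U n \<omega>} \<le> emeasure M E"
      using E by (intro outer_measure_of_le)
    also have "\<dots> < ennreal r" using E(2) \<open>0 < r\<close> by (simp add: emeasure_eq_measure ennreal_less_iff)
    finally show ?thesis .
  qed
  then show "\<forall>\<^sub>F n in sequentially. outer_measure_of M {\<omega> \<in> space M. ennreal e < U n \<omega>} < ennreal r"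
    by (auto simp: eventually_sequentially)
qed

section \<open>Law of the errors and support of the response\<close>

text \<open>Almost surely the observed error is a fixed measurable function of an observation (x,
  y), and the true error is the same function of (X, Y). Equal joint laws of the observations
  therefore give equal laws of the errors.\<close>

lemma distr_residual:
  fixes X :: "'a \<Rightarrow> real^'dx" and Y \<epsilon> :: "'a \<Rightarrow> real^'dy" and Xs :: "'b \<Rightarrow> real^'dx" and Ys :: "'b \<Rightarrow> real^'dy"
    and Q :: "real^'dx \<Rightarrow> real^'dy^'dy"
  assumes [measurable]: "X \<in> borel_measurable N" "Y \<in> borel_measurable N" "\<epsilon> \<in> borel_measurable N"
      "f \<in> borel_measurable borel" "Q \<in> borel_measurable borel"
      "Xs \<in> borel_measurable M" "Ys \<in> borel_measurable M" "err \<in> borel_measurable M"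
    and model: "AE \<omega> in N. Y \<omega> = f (X \<omega>) + Q (X \<omega>) *v \<epsilon> \<omega>"
    and det: "AE x in distr N borel X. det (Q x) \<noteq> 0"
    and obs: "distr M (borel \<Otimes>\<^sub>M borel) (\<lambda>\<omega>. (Xs \<omega>, Ys \<omega>)) = distr N (borel \<Otimes>\<^sub>M borel) (\<lambda>\<omega>. (X \<omega>, Y \<omega>))"
    and err: "\<And>\<omega>. err \<omega> = matrix_inv (Q (Xs \<omega>)) *v (Ys \<omega> - f (Xs \<omega>))"
  shows "distr M borel err = distr N borel \<epsilon>"
proof -
  define r where "r = (\<lambda>(x, y). cramer_solution (Q x) (y - f x))"
  have r [measurable]: "r \<in> borel_measurable (borel \<Otimes>\<^sub>M borel)"
    unfolding r_def case_prod_beta by (intro borel_measurable_cramer_solution) measurable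
  have "distr M borel Xs = distr (distr M (borel \<Otimes>\<^sub>M borel) (\<lambda>\<omega>. (Xs \<omega>, Ys \<omega>))) borel fst"
    by (subst distr_distr) (auto simp: comp_def)
  also have "\<dots> = distr N borel X"
    unfolding obs by (subst distr_distr) (auto simp: comp_def)
  finally have eq: "distr M borel Xs = distr N borel X" .
  have "AE x in distr M borel Xs. det (Q x) \<noteq> 0" unfolding eq by (rule det)
  then have "AE \<omega> in M. det (Q (Xs \<omega>)) \<noteq> 0" by (intro AE_distrD[where f = Xs and M' = borel]) auto
  then have "AE \<omega> in M. err \<omega> = r (Xs \<omega>, Ys \<omega>)"
    by eventually_elim (simp add: err r_def matrix_inv_eq_cramer_solution)
  then have "distr M borel err = distr M borel (\<lambda>\<omega>. r (Xs \<omega>, Ys \<omega>))"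
    by (intro distr_cong_AE) auto
  also have "\<dots> = distr (distr M (borel \<Otimes>\<^sub>M borel) (\<lambda>\<omega>. (Xs \<omega>, Ys \<omega>))) borel r"
    by (subst distr_distr) (auto simp: comp_def)
  also have "\<dots> = distr N borel (\<lambda>\<omega>. r (X \<omega>, Y \<omega>))"
    unfolding obs by (subst distr_distr) (auto simp: comp_def)
  also have "\<dots> = distr N borel \<epsilon>"
  proof (rule distr_cong_AE)
    have "AE \<omega> in N. det (Q (X \<omega>)) \<noteq> 0" using det by (intro AE_distrD[where f = X and M' = borel]) auto
    then show "AE \<omega> in N. r (X \<omega>, Y \<omega>) = \<epsilon> \<omega>"
      using model by eventually_elim (auto simp: r_def intro!: cramer_solution_unique)
  qed auto
  finally show ?thesis .
qed

lemma continuous_on_matrix_vector_mult: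
  fixes Q :: "'a::topological_space \<Rightarrow> real^'n^'m"
  assumes "continuous_on A Q"
  shows "continuous_on A (\<lambda>x. Q x *v e)"
proof -
  have "linear (\<lambda>B :: real^'n^'m. B *v e)"
    by (auto simp: linear_iff matrix_vector_mult_add_rdistrib scaleR_matrix_vector_assoc)
  then have "bounded_linear (\<lambda>B :: real^'n^'m. B *v e)" by (simp add: linear_conv_bounded_linear)
  from bounded_linear.continuous_on[OF this assms] show ?thesis .
qed

text \<open>Independence makes the law of (X, \<epsilon>) a product, so for almost every x almost
  every e puts \<open>f x + Q x *v e\<close> into the support of Y. The null set of e depends on x.
  A countable dense set of such x has a common one, and continuity of f and Q with closedness of the
  support extends the membership to all x.\<close>

lemma AE_all_in_support:
  fixes X :: "'a \<Rightarrow> real^'dx" and Y \<epsilon> :: "'a \<Rightarrow> real^'dy" and Q :: "real^'dx \<Rightarrow> real^'dy^'dy"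
  assumes "prob_space N"
    and [measurable]: "X \<in> borel_measurable N" "Y \<in> borel_measurable N" "\<epsilon> \<in> borel_measurable N"
      "f \<in> borel_measurable borel" "Q \<in> borel_measurable borel"
    and indep: "prob_space.indep_set N (sets (vimage_algebra (space N) X borel)) (sets (vimage_algebra (space N)
      \<epsilon> borel))"
    and model: "AE \<omega> in N. Y \<omega> = f (X \<omega>) + Q (X \<omega>) *v \<epsilon> \<omega>"
    and cont: "continuous_on (support_of (distr N borel X)) f" "continuous_on (support_of (distr N borel X)) Q"
  shows "\<exists>S\<in>sets borel. (AE e in distr N borel \<epsilon>. e \<in> S) \<and>
    (\<forall>e\<in>S. \<forall>x\<in>support_of (distr N borel X). f x + Q x *v e \<in> support_of (distr N borel Y))"
proof -
  interpret N: prob_space N by fact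
  let ?PX = "distr N borel X" and ?P\<epsilon> = "distr N borel \<epsilon>"
  let ?X = "support_of ?PX" and ?Y = "support_of (distr N borel Y)"
  interpret PX: prob_space ?PX by (rule N.prob_space_distr) simp
  interpret P\<epsilon>: prob_space ?P\<epsilon> by (rule N.prob_space_distr) simp
  interpret pair: pair_sigma_finite ?PX ?P\<epsilon> by unfold_locales
  have Y_closed: "closed ?Y" by (rule closed_support_of)
  have [measurable]: "?Y \<in> sets borel" using Y_closed by (rule borel_closed)
  have joint: "?PX \<Otimes>\<^sub>M ?P\<epsilon> = distr N (borel \<Otimes>\<^sub>M borel) (\<lambda>\<omega>. (X \<omega>, \<epsilon> \<omega>))"
  proof (rule pair_measure_eqI)
    fix A B assume "A \<in> sets ?PX" "B \<in> sets ?P\<epsilon>"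
    then have [measurable]: "A \<in> sets borel" "B \<in> sets borel" by auto
    have "X -` A \<inter> space N \<in> sets (vimage_algebra (space N) X borel)"
      "\<epsilon> -` B \<inter> space N \<in> sets (vimage_algebra (space N) \<epsilon> borel)"
      by (rule in_vimage_algebra; simp)+
    then have "N.prob ((X -` A \<inter> space N) \<inter> (\<epsilon> -` B \<inter> space N))
      = N.prob (X -` A \<inter> space N) * N.prob (\<epsilon> -` B \<inter> space N)"
      by (rule N.indep_setD[OF indep])
    moreover have "(\<lambda>\<omega>. (X \<omega>, \<epsilon> \<omega>)) -` (A \<times> B) \<inter> space N = (X -` A \<inter> space N) \<inter> (\<epsilon> -` B \<inter> space N)"
      by auto
    ultimately show "emeasure ?PX A * emeasure ?P\<epsilon> B = emeasure (distr N (borel \<Otimes>\<^sub>M borel) (\<lambda>\<omega>. (X \<omega>, \<epsilon> \<omega>))) (A \<times> B)"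
      by (simp add: emeasure_distr N.emeasure_eq_measure ennreal_mult)
  qed (auto intro!: sets_pair_measure_cong PX.sigma_finite_measure_axioms P\<epsilon>.sigma_finite_measure_axioms)
  have "AE \<omega> in N. Y \<omega> \<in> ?Y"
    by (intro AE_distrD[where f = Y and M' = borel] AE_support_of) auto
  then have "AE \<omega> in N. f (X \<omega>) + Q (X \<omega>) *v \<epsilon> \<omega> \<in> ?Y"
    using model by eventually_elim simp
  then have "AE \<omega> in N. (\<lambda>p. f (fst p) + Q (fst p) *v snd p \<in> ?Y) (X \<omega>, \<epsilon> \<omega>)" by simp
  then have "AE p in ?PX \<Otimes>\<^sub>M ?P\<epsilon>. f (fst p) + Q (fst p) *v snd p \<in> ?Y"
    unfolding joint by (subst AE_distr_iff) measurable
  then have AE_x: "AE x in ?PX. AE e in ?P\<epsilon>. f x + Q x *v e \<in> ?Y"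
    using pair.AE_pair by fastforce
  let ?A = "{x \<in> ?X. AE e in ?P\<epsilon>. f x + Q x *v e \<in> ?Y}"
  obtain C where C: "countable C" "C \<subseteq> ?A" "?A \<subseteq> closure C" by (rule separable)
  have "?X \<subseteq> closure ?A" using AE_x by (intro support_of_subset_closure) simp
  also have "closure ?A \<subseteq> closure C" using C(3) by (simp add: closure_minimal)
  finally have dense: "?X \<subseteq> closure C" .
  define S where "S = {e. \<forall>x\<in>C. f x + Q x *v e \<in> ?Y}"
  have "S = (\<Inter>x\<in>C. {e. f x + Q x *v e \<in> ?Y})" by (auto simp: S_def)
  moreover have "closed {e. f x + Q x *v e \<in> ?Y}" for x
  proof -
    have "closed ((\<lambda>e. f x + Q x *v e) -` ?Y)"
      by (intro continuous_closed_vimage Y_closed continuous_intros linear_continuous_at) simp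
    then show ?thesis by (simp add: vimage_def)
  qed
  ultimately have "closed S" by auto
  then have "S \<in> sets borel" by (rule borel_closed)
  moreover have "AE e in ?P\<epsilon>. e \<in> S"
    unfolding S_def mem_Collect_eq using C(1,2) by (subst AE_ball_countable) auto
  moreover have "f x + Q x *v e \<in> ?Y" if e: "e \<in> S" and x: "x \<in> ?X" for e x
  proof -
    obtain s where s: "\<And>n. s n \<in> C" "s \<longlonglongrightarrow> x" using dense x closure_sequential by blast
    have "continuous_on ?X (\<lambda>x. f x + Q x *v e)"
      by (intro continuous_intros cont continuous_on_matrix_vector_mult)
    moreover have "\<forall>n. s n \<in> ?X" using s(1) C(2) by blast
    ultimately have "((\<lambda>x. f x + Q x *v e) \<circ> s) \<longlonglongrightarrow> f x + Q x *v e"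
      using s(2) x unfolding continuous_on_sequentially by blast
    then show ?thesis
      using closed_sequentially[OF Y_closed, of "(\<lambda>x. f x + Q x *v e) \<circ> s"] e s(1) by (auto simp: S_def)
  qed
  ultimately show ?thesis by blast
qed

lemma sub_gaussian_exp_moment:
  fixes X :: "'a \<Rightarrow> real"
  assumes "sub_gaussian P (\<lambda>e. X e - m) v"
  shows "(\<integral>\<^sup>+e. ennreal (exp (r * X e)) \<partial>P) < \<infinity>" "X \<in> borel_measurable P"
proof -
  have [measurable]: "(\<lambda>e. X e - m) \<in> borel_measurable P"
    using assms by (auto simp: sub_gaussian_def)
  have "(\<lambda>e. (X e - m) + m) \<in> borel_measurable P" by measurable
  then show "X \<in> borel_measurable P" by simp
  have "exp (r * X e) = exp (r * m) * exp (r * (1 \<bullet> (X e - m)))" for e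
    by (simp add: algebra_simps flip: exp_add)
  then have "(\<integral>\<^sup>+e. ennreal (exp (r * X e)) \<partial>P) = (\<integral>\<^sup>+e. ennreal (exp (r * m)) * ennreal (exp (r * (1 \<bullet> (X e -
    m)))) \<partial>P)"
    by (simp add: ennreal_mult)
  also have "\<dots> = ennreal (exp (r * m)) * (\<integral>\<^sup>+e. ennreal (exp (r * (1 \<bullet> (X e - m)))) \<partial>P)"
    by (rule nn_integral_cmult) measurable
  also have "\<dots> < \<infinity>"
  proof -
    have "(\<integral>\<^sup>+e. ennreal (exp (r * (1 \<bullet> (X e - m)))) \<partial>P) \<le> ennreal (exp (v * r\<^sup>2 / 2))"
      using assms unfolding sub_gaussian_def by (elim conjE allE[of _ r] allE[of _ "1 :: real"]) simp
    then show ?thesis by (auto simp: ennreal_mult_less_top intro: le_less_trans)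
  qed
  finally show "(\<integral>\<^sup>+e. ennreal (exp (r * X e)) \<partial>P) < \<infinity>" .
qed

text \<open>The exponential of a maximum over finitely many vertices is at most the sum of the
  exponentials, and that of an absolute value at most the sum for both signs. Each summand is
  integrable by the sub-Gaussian hypothesis.\<close>

lemma exp_moment_vertex_max:
  fixes W :: "real^'v^'m" and u :: "'e \<Rightarrow> real^'m"
  assumes rank: "rank W = CARD('m)" and dual: "dual_feasible W c \<noteq> {}"
    and sg: "\<And>mu. mu extreme_point_of dual_feasible W c \<Longrightarrow> \<exists>m v. sub_gaussian P (\<lambda>e. mu \<bullet> u e - m) v"
    and le: "AE e in P. \<bar>F e\<bar> \<le> a + \<bar>vertex_max W c (u e)\<bar>"
  shows "(\<integral>\<^sup>+e. ennreal (exp \<bar>F e\<bar>) \<partial>P) < \<infinity>"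
proof -
  let ?E = "{mu. mu extreme_point_of dual_feasible W c}"
  have fin: "finite ?E" by (rule finite_extreme_points_dual_feasible)
  have mom: "(\<integral>\<^sup>+e. ennreal (exp (r * (mu \<bullet> u e))) \<partial>P) < \<infinity>" "(\<lambda>e. mu \<bullet> u e) \<in> borel_measurable P"
    if "mu \<in> ?E" for mu r
    using sg that sub_gaussian_exp_moment[of P "\<lambda>e. mu \<bullet> u e"] by blast+
  have "(\<integral>\<^sup>+e. ennreal (exp \<bar>F e\<bar>) \<partial>P)
    \<le> (\<integral>\<^sup>+e. ennreal (exp a) * (\<Sum>mu\<in>?E. ennreal (exp (1 * (mu \<bullet> u e))) + ennreal (exp ((-1) * (mu \<bullet> u e)))) \<partial>P)"
  proof (rule nn_integral_mono_AE)
    show "AE e in P. ennreal (exp \<bar>F e\<bar>) \<le> ennreal (exp a) *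
      (\<Sum>mu\<in>?E. ennreal (exp (1 * (mu \<bullet> u e))) + ennreal (exp ((-1) * (mu \<bullet> u e))))"
      using le
    proof eventually_elim
      case (elim e)
      obtain mu where mu: "mu extreme_point_of dual_feasible W c" "vertex_max W c (u e) = mu \<bullet> u e"
        by (rule vertex_max_attained[OF rank dual])
      have "exp \<bar>F e\<bar> \<le> exp (a + \<bar>mu \<bullet> u e\<bar>)" using elim mu(2) by simp
      also have "\<dots> = exp a * exp \<bar>mu \<bullet> u e\<bar>" by (simp add: exp_add)
      also have "\<dots> \<le> exp a * (exp (1 * (mu \<bullet> u e)) + exp ((-1) * (mu \<bullet> u e)))"
        by (intro mult_left_mono) (cases "0 \<le> mu \<bullet> u e", auto)
      also have "\<dots> \<le> exp a * (\<Sum>mu\<in>?E. exp (1 * (mu \<bullet> u e)) + exp ((-1) * (mu \<bullet> u e)))"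
        using mu(1) fin member_le_sum[of mu ?E "\<lambda>mu. exp (1 * (mu \<bullet> u e)) + exp ((-1) * (mu \<bullet> u e))"]
        by (intro mult_left_mono) (auto intro: add_nonneg_nonneg)
      finally show ?case
        by (simp add: ennreal_mult[symmetric] ennreal_plus[symmetric] sum_nonneg ennreal_leI add_nonneg_nonneg
            del: ennreal_plus)
    qed
  qed
  also have "\<dots> = ennreal (exp a) *
    (\<Sum>mu\<in>?E. (\<integral>\<^sup>+e. ennreal (exp (1 * (mu \<bullet> u e))) \<partial>P) + (\<integral>\<^sup>+e. ennreal (exp ((-1) * (mu \<bullet> u e))) \<partial>P))"
  proof -
    note [measurable] = mom(2)
    have "(\<integral>\<^sup>+e. ennreal (exp a) * (\<Sum>mu\<in>?E. ennreal (exp (1 * (mu \<bullet> u e))) + ennreal (exp ((-1) * (mu \<bullet> u e)))) \<partial>P)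
      = ennreal (exp a) * (\<integral>\<^sup>+e. (\<Sum>mu\<in>?E. ennreal (exp (1 * (mu \<bullet> u e))) + ennreal (exp ((-1) * (mu \<bullet> u e)))) \<partial>P)"
      by (rule nn_integral_cmult) measurable
    also have "(\<integral>\<^sup>+e. (\<Sum>mu\<in>?E. ennreal (exp (1 * (mu \<bullet> u e))) + ennreal (exp ((-1) * (mu \<bullet> u e)))) \<partial>P)
      = (\<Sum>mu\<in>?E. \<integral>\<^sup>+e. ennreal (exp (1 * (mu \<bullet> u e))) + ennreal (exp ((-1) * (mu \<bullet> u e))) \<partial>P)"
      by (rule nn_integral_sum) measurable
    also have "\<dots> = (\<Sum>mu\<in>?E. (\<integral>\<^sup>+e. ennreal (exp (1 * (mu \<bullet> u e))) \<partial>P) + (\<integral>\<^sup>+e. ennreal (exp ((-1) * (mu \<bullet> u e))) \<partial>P))"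
      by (intro sum.cong refl nn_integral_add) measurable
    finally show ?thesis .
  qed
  also have "\<dots> < \<infinity>"
  proof -
    have "(\<Sum>mu\<in>?E. (\<integral>\<^sup>+e. ennreal (exp (1 * (mu \<bullet> u e))) \<partial>P) + (\<integral>\<^sup>+e. ennreal (exp ((-1) * (mu \<bullet> u e))) \<partial>P)) < \<infinity>"
      using fin mom(1)[of _ 1] mom(1)[of _ "-1"] by (simp del: exp_less_cancel_iff)
    then show ?thesis by (simp add: ennreal_mult_less_top)
  qed
  finally show ?thesis .
qed

text \<open>Uniform continuity of f and Q on the compact set; the factor 1 + norm e is the price of
  the linear dependence on e.\<close>

lemma uniformly_small_matrix_perturbation:
  fixes f :: "real^'dx \<Rightarrow> real^'dy" and Q :: "real^'dx \<Rightarrow> real^'dy^'dy"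
  assumes X: "compact \<X>" "continuous_on \<X> f" "continuous_on \<X> Q" and \<eta>: "0 < \<eta>"
  shows "\<exists>\<delta>>0. \<forall>x\<in>\<X>. \<forall>x'\<in>\<X>. dist x x' < \<delta> \<longrightarrow>
    (\<forall>e. norm ((f x + Q x *v e) - (f x' + Q x' *v e)) \<le> \<eta> * (1 + norm e))"
proof -
  obtain K where K: "0 < K" "\<And>(A :: real^'dy^'dy) v. norm (A *v v) \<le> K * norm A * norm v"
    using matrix_vector_mult_norm_bound by blast
  have uf: "uniformly_continuous_on \<X> f" and uQ: "uniformly_continuous_on \<X> Q"
    using X by (auto intro: compact_uniformly_continuous)
  obtain d1 where d1: "d1 > 0" "\<And>x x'. x \<in> \<X> \<Longrightarrow> x' \<in> \<X> \<Longrightarrow> dist x x' < d1 \<Longrightarrow> dist (f x) (f x') < \<eta>"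
    using uf \<eta> unfolding uniformly_continuous_on_def by meson
  have "0 < \<eta> / K" using \<eta> K(1) by simp
  then obtain d2 where d2: "d2 > 0" "\<And>x x'. x \<in> \<X> \<Longrightarrow> x' \<in> \<X> \<Longrightarrow> dist x x' < d2 \<Longrightarrow> dist (Q x) (Q x') < \<eta> / K"
    using uQ unfolding uniformly_continuous_on_def by meson
  have "norm ((f x + Q x *v e) - (f x' + Q x' *v e)) \<le> \<eta> * (1 + norm e)"
    if x: "x \<in> \<X>" "x' \<in> \<X>" "dist x x' < min d1 d2" for x x' e
  proof -
    have "(f x + Q x *v e) - (f x' + Q x' *v e) = (f x - f x') + (Q x - Q x') *v e"
      by (simp add: matrix_vector_mult_diff_rdistrib)
    then have "norm ((f x + Q x *v e) - (f x' + Q x' *v e)) \<le> norm (f x - f x') + norm ((Q x - Q x') *v e)"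
      by (metis norm_triangle_ineq)
    also have "norm (f x - f x') \<le> \<eta>" using d1(2)[OF x(1,2)] x(3) by (simp add: dist_norm)
    also have "norm ((Q x - Q x') *v e) \<le> K * norm (Q x - Q x') * norm e" by (rule K(2))
    also have "K * norm (Q x - Q x') * norm e \<le> \<eta> * norm e"
    proof (rule mult_right_mono)
      have "norm (Q x - Q x') \<le> \<eta> / K" using d2(2)[OF x(1,2)] x(3) by (simp add: dist_norm)
      then show "K * norm (Q x - Q x') \<le> \<eta>" using K(1) by (simp add: field_simps)
    qed simp
    finally show ?thesis by (simp add: distrib_left)
  qed
  then show ?thesis using d1(1) d2(1) by (intro exI[of _ "min d1 d2"]) auto
qed

theorem proposition20:
  fixes N :: "'a measure"
    and X :: "'a \<Rightarrow> real^'dx" and Y \<epsilon> :: "'a \<Rightarrow> real^'dy"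
    and M :: "'b measure"
    and Xs :: "nat \<Rightarrow> 'b \<Rightarrow> real^'dx" and Ys :: "nat \<Rightarrow> 'b \<Rightarrow> real^'dy"
    and f :: "real^'dx \<Rightarrow> real^'dy" and Q :: "real^'dx \<Rightarrow> real^'dy^'dy"
    and \<X> :: "(real^'dx) set" and \<Y> :: "(real^'dy) set" and \<Z> :: "(real^'dz) set"
    and P\<^sub>X :: "(real^'dx) measure" and P\<^sub>\<epsilon> :: "(real^'dy) measure"
    and W :: "real^'dv^'m" and c\<^sub>v :: "real^'dv"
    and p :: "real^'dz \<Rightarrow> real" and h :: "real^'dy \<Rightarrow> real^'m"
    and T :: "real^'dy \<Rightarrow> real^'dz \<Rightarrow> real^'m"
    and V :: "real^'dz \<Rightarrow> real^'dy \<Rightarrow> ereal" and c :: "real^'dz \<Rightarrow> real^'dy \<Rightarrow> real"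
    and \<V> :: "real^'dy \<Rightarrow> real^'m \<Rightarrow> real^'dz \<Rightarrow> real" and \<Lambda> :: "(real^'m) set"
    and g :: "real^'dz \<Rightarrow> real^'dx \<Rightarrow> real"
    and err :: "nat \<Rightarrow> 'b \<Rightarrow> real^'dy"
    and gn :: "nat \<Rightarrow> 'b \<Rightarrow> real^'dz \<Rightarrow> real^'dx \<Rightarrow> real"
    and dev :: "nat \<Rightarrow> 'b \<Rightarrow> real^'dx \<Rightarrow> ennreal"
    and L\<^sub>h L\<^sub>p :: real and L\<^sub>T\<^sub>y :: "real^'dz \<Rightarrow> real" and L\<^sub>T\<^sub>z :: "real^'dy \<Rightarrow> real"
    and \<sigma>\<^sub>c :: "real^'dx \<Rightarrow> real"

  \<comment> \<open>population model\<close>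
  assumes "prob_space N"
    and "X \<in> borel_measurable N" "Y \<in> borel_measurable N" "\<epsilon> \<in> borel_measurable N"
    and "f \<in> borel_measurable borel" "Q \<in> borel_measurable borel"
    and P\<^sub>X: "P\<^sub>X = distr N borel X" and P\<^sub>\<epsilon>: "P\<^sub>\<epsilon> = distr N borel \<epsilon>"
    and \<X>: "\<X> = support_of P\<^sub>X"
    and \<Y>: "\<Y> = support_of (distr N borel Y)" "\<Y> \<noteq> {}" "convex \<Y>"
    and model: "AE \<omega> in N. Y \<omega> = f (X \<omega>) + Q (X \<omega>) *v \<epsilon> \<omega>"
    and regression: "integrable N Y"
      "\<And>k. AE \<omega> in N. real_cond_exp N (vimage_algebra (space N) X borel) (\<lambda>\<omega>. Y \<omega> $ k) \<omega>
              = f (X \<omega>) $ k"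
    and Q_pos: "\<And>x. x \<in> \<X> \<Longrightarrow> pos_definite (Q x)"
    and \<epsilon>_mean: "integrable N \<epsilon>" "(\<integral>\<omega>. \<epsilon> \<omega> \<partial>N) = 0"
    and \<epsilon>_indep: "prob_space.indep_set N (sets (vimage_algebra (space N) X borel))
                       (sets (vimage_algebra (space N) \<epsilon> borel))"

  \<comment> \<open>data, with observations indexed from \<open>0\<close>\<close>
    and "prob_space M"
    and "\<And>i. Xs i \<in> borel_measurable M" "\<And>i. Ys i \<in> borel_measurable M"
    and observations: "\<And>i. distr M (borel \<Otimes>\<^sub>M borel) (\<lambda>\<omega>. (Xs i \<omega>, Ys i \<omega>))
                          = distr N (borel \<Otimes>\<^sub>M borel) (\<lambda>\<omega>. (X \<omega>, Y \<omega>))"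
    and err: "err = (\<lambda>i \<omega>. matrix_inv (Q (Xs i \<omega>)) *v (Ys i \<omega> - f (Xs i \<omega>)))"

  \<comment> \<open>two-stage program\<close>
    and "h \<in> borel_measurable borel" "\<And>z. z \<in> \<Z> \<Longrightarrow> (\<lambda>y. T y z) \<in> borel_measurable borel"
    and V: "V = recourse W c\<^sub>v h T"
    and c: "c = (\<lambda>z y. p z + real_of_ereal (V z y))"
    and g: "g = (\<lambda>z x. \<integral>e. c z (f x + Q x *v e) \<partial>P\<^sub>\<epsilon>)"
    and gn: "gn = (\<lambda>n \<omega> z x. (1 / real n) * (\<Sum>i<n. c z (f x + Q x *v err i \<omega>)))"
    and dev: "dev = (\<lambda>n \<omega> x. SUP z\<in>\<Z>. ennreal \<bar>gn n \<omega> z x - g z x\<bar>)"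
    and \<Lambda>: "\<Lambda> = dual_feasible W c\<^sub>v"
    and \<V>: "\<V> = (\<lambda>y lam z. lam \<bullet> (h y - T y z))"

  \<comment> \<open>standing assumptions\<close>
    and "\<And>z. z \<in> \<Z> \<Longrightarrow> AE x in P\<^sub>X. integrable P\<^sub>\<epsilon> (\<lambda>e. c z (f x + Q x *v e))"
    and "AE x in P\<^sub>X. lower_semicontinuous_on \<Z> (\<lambda>z. g z x)"

    and A: "\<Z> \<noteq> {}" "compact \<Z>" "rank W = CARD('m)" "\<Lambda> \<noteq> {}"
      "\<And>z y. z \<in> \<Z> \<Longrightarrow> y \<in> \<Y> \<Longrightarrow> V z y < \<infinity>"
    and B: "L\<^sub>h-lipschitz_on \<Y> h" "\<And>z. z \<in> \<Z> \<Longrightarrow> (L\<^sub>T\<^sub>y z)-lipschitz_on \<Y> (\<lambda>y. T y z)"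
      "L\<^sub>p-lipschitz_on \<Z> p" "\<And>y. y \<in> \<Y> \<Longrightarrow> (L\<^sub>T\<^sub>z y)-lipschitz_on \<Z> (\<lambda>z. T y z)"
      "bdd_above (L\<^sub>T\<^sub>y ` \<Z>)" "bdd_above (L\<^sub>T\<^sub>z ` \<Y>)"
    and C: "compact \<X>" "continuous_on \<X> f" "continuous_on \<X> Q"
      "(\<integral>\<^sup>+\<omega>. (SUP (z, x) \<in> \<Z> \<times> \<X>. ennreal (norm (h (f x + Q x *v \<epsilon> \<omega>)
                                            - T (f x + Q x *v \<epsilon> \<omega>) z))) \<partial>N) < \<infinity>"
    and D: "(\<integral>\<^sup>+\<omega>. (SUP z\<in>\<Z>. ennreal ((norm (h (Y \<omega>) - T (Y \<omega>) z))\<^sup>2)) \<partial>N) < \<infinity>"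
      "\<And>lam z. lam extreme_point_of \<Lambda> \<Longrightarrow> z \<in> \<Z> \<Longrightarrow>
        AE x in P\<^sub>X. sub_gaussian P\<^sub>\<epsilon>
          (\<lambda>e. \<V> (f x + Q x *v e) lam z - (\<integral>e'. \<V> (f x + Q x *v e') lam z \<partial>P\<^sub>\<epsilon>)) ((\<sigma>\<^sub>c x)\<^sup>2)"
    and E: "prob_space.indep_vars M (\<lambda>_. borel) err UNIV"
      "\<And>i j. distr M borel (err i) = distr M borel (err j)"

  shows
    "(\<exists>L. (\<forall>z\<in>\<Z>. \<forall>y\<in>\<Y>. \<forall>y'\<in>\<Y>. \<bar>c z y' - c z y\<bar> \<le> L z * norm (y' - y)) \<and> bdd_above (L ` \<Z>))
     \<and>
     (AE x in P\<^sub>X. tends_to_0_in_prob M (\<lambda>n \<omega>. dev n \<omega> x))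
     \<and>
     (\<forall>q\<ge>1. tends_to_0_in_prob M (\<lambda>n \<omega>. Lq_norm (restrict_space P\<^sub>X \<X>) q (dev n \<omega>)))
     \<and>
     (\<forall>\<kappa>>0. AE x in P\<^sub>X. \<exists>K>0. \<exists>\<beta>>0. \<forall>n\<ge>1.
        outer_measure_of M {\<omega> \<in> space M. ennreal \<kappa> < dev n \<omega> x}
          \<le> ennreal (K * exp (- real n * \<beta>)))
     \<and>
     (AE x in P\<^sub>X.
        restrict (\<lambda>z. g z x) \<Z> \<in> mspace (C_space \<Z>) \<and>
        (\<forall>n\<ge>1. \<exists>G. random_element_version M (mtopology_of (C_space \<Z>))
                      (\<lambda>\<omega>. restrict (\<lambda>z. gn n \<omega> z x) \<Z>) G) \<and>
        (\<exists>(N' :: (real^'dz \<Rightarrow> real) measure) V_lim. prob_space N' \<and>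
          tends_in_distribution M (mtopology_of (C_space \<Z>))
            (\<lambda>n \<omega>. restrict (\<lambda>z. sqrt (real n) * (gn n \<omega> z x - g z x)) \<Z>) N' V_lim))"
proof -
  interpret N: prob_space N by fact
  interpret M: prob_space M by fact
  have meas [measurable]: "X \<in> borel_measurable N" "Y \<in> borel_measurable N" "\<epsilon> \<in> borel_measurable N"
    "f \<in> borel_measurable borel" "Q \<in> borel_measurable borel" "h \<in> borel_measurable borel"
    "\<And>i. Xs i \<in> borel_measurable M" "\<And>i. Ys i \<in> borel_measurable M" by fact+
  note dual = A(4)[unfolded \<Lambda>] and rank = A(3)
  have sets_PX: "sets P\<^sub>X = sets borel" and sets_P\<epsilon>: "sets P\<^sub>\<epsilon> = sets borel" by (simp_all add: P\<^sub>X P\<^sub>\<epsilon>)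
  have PX: "prob_space P\<^sub>X" and P\<epsilon>: "prob_space P\<^sub>\<epsilon>"
    unfolding P\<^sub>X P\<^sub>\<epsilon> by (rule N.prob_space_distr, simp)+
  interpret PX: prob_space P\<^sub>X by (rule PX)
  interpret P\<epsilon>: prob_space P\<^sub>\<epsilon> by (rule P\<epsilon>)
  have AE_X: "AE x in P\<^sub>X. x \<in> \<X>" unfolding \<X> using sets_PX by (rule AE_support_of)
  have err_meas [measurable]: "err i \<in> borel_measurable M" for i using E(1) by (simp add: M.indep_vars_def2)
  have det: "AE x in P\<^sub>X. det (Q x) \<noteq> 0"
    using AE_X by eventually_elim (rule pos_definite_det_nonzero[OF Q_pos])
  \<comment> \<open>That the common law of the errors is \<open>P\<^sub>\<epsilon>\<close> is
    derived from the joint law of an observation.\<close>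
  have distr_err: "distr M borel (err i) = P\<^sub>\<epsilon>" for i
    unfolding P\<^sub>\<epsilon>
  proof (rule distr_residual[where Xs = "Xs i" and Ys = "Ys i" and X = X and Y = Y and f = f and Q = Q])
    show "err i \<omega> = matrix_inv (Q (Xs i \<omega>)) *v (Ys i \<omega> - f (Xs i \<omega>))" for \<omega> by (simp add: err)
    show "AE x in distr N borel X. det (Q x) \<noteq> 0" using det unfolding P\<^sub>X .
  qed (rule meas err_meas model observations)+
  \<comment> \<open>The vertex formula and the Lipschitz bounds for c are available only on the
    support of Y; S guarantees them for all x at once.\<close>
  obtain S where S: "S \<in> sets borel" "AE e in P\<^sub>\<epsilon>. e \<in> S" "\<And>e x. e \<in> S \<Longrightarrow> x \<in> \<X> \<Longrightarrow> f x + Q x *v e \<in> \<Y>"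
    using AE_all_in_support[OF N.prob_space_axioms meas(1-5) \<epsilon>_indep model] C(2,3)
    unfolding \<X> P\<^sub>X P\<^sub>\<epsilon> \<Y>(1) by blast

  have c_eq: "c z y = p z + vertex_max W c\<^sub>v (h y - T y z)" if "z \<in> \<Z>" "y \<in> \<Y>" for z y
    using A(5)[OF that] recourse_less_infinity_iff[OF rank dual, of h T z y]
      recourse_eq_vertex_max[OF rank dual, of h y T z] by (simp add: c V)
  have c_meas: "c z \<in> borel_measurable borel" if "z \<in> \<Z>" for z
  proof -
    have "(\<lambda>y. T y z) \<in> borel_measurable borel" using that by fact
    then have "(\<lambda>y. real_of_ereal (recourse W c\<^sub>v h T z y)) \<in> borel_measurable borel"
      by (intro borel_measurable_recourse[OF rank dual] meas)
    then show ?thesis unfolding c V by simp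
  qed
  obtain B where B0: "0 \<le> B" and Bl: "\<And>u u'. \<bar>vertex_max W c\<^sub>v u - vertex_max W c\<^sub>v u'\<bar> \<le> B * norm (u - u')"
    using vertex_max_lipschitz[OF rank dual] by blast
  define Ly where "Ly z = B * (L\<^sub>h + L\<^sub>T\<^sub>y z)" for z
  have c_lip_y: "\<bar>c z y' - c z y\<bar> \<le> Ly z * norm (y' - y)" if z: "z \<in> \<Z>" and y: "y \<in> \<Y>" "y' \<in> \<Y>" for z y y'
  proof -
    have "\<bar>c z y' - c z y\<bar> \<le> B * norm ((h y' - T y' z) - (h y - T y z))"
      using Bl by (simp add: c_eq z y)
    also have "\<dots> \<le> B * (norm (h y' - h y) + norm (T y' z - T y z))"
    proof (intro mult_left_mono B0)
      have "(h y' - T y' z) - (h y - T y z) = (h y' - h y) - (T y' z - T y z)" by simp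
      then show "norm ((h y' - T y' z) - (h y - T y z)) \<le> norm (h y' - h y) + norm (T y' z - T y z)"
        by (metis norm_triangle_ineq4)
    qed
    also have "\<dots> \<le> B * (L\<^sub>h * norm (y' - y) + L\<^sub>T\<^sub>y z * norm (y' - y))"
      using lipschitz_onD[OF B(1) y(2,1)] lipschitz_onD[OF B(2)[OF z] y(2,1)]
      by (intro mult_left_mono add_mono B0) (auto simp: dist_norm)
    finally show ?thesis by (simp add: Ly_def algebra_simps)
  qed
  obtain bY where by_bd: "\<And>z. z \<in> \<Z> \<Longrightarrow> L\<^sub>T\<^sub>y z \<le> bY" using B(5) by (auto simp: bdd_above_def)
  obtain bz where bz_bd: "\<And>y. y \<in> \<Y> \<Longrightarrow> L\<^sub>T\<^sub>z y \<le> bz" using B(6) by (auto simp: bdd_above_def)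
  have Ly_le: "Ly z \<le> B * (L\<^sub>h + bY)" if "z \<in> \<Z>" for z
    unfolding Ly_def using by_bd[OF that] B0 by (intro mult_left_mono) auto
  \<comment> \<open>Absolute values and the summand 1 make the constant positive without case
    distinctions.\<close>
  define Lc where "Lc = \<bar>L\<^sub>p\<bar> + B * \<bar>bz\<bar> + 1"
  have Lc: "0 < Lc" using B0 unfolding Lc_def by (intro add_nonneg_pos add_nonneg_nonneg mult_nonneg_nonneg) auto
  have c_lip_z: "\<bar>c z y - c z' y\<bar> \<le> Lc * dist z z'" if z: "z \<in> \<Z>" "z' \<in> \<Z>" and y: "y \<in> \<Y>" for z z' y
  proof -
    have "\<bar>c z y - c z' y\<bar> \<le> \<bar>p z - p z'\<bar> + B * norm ((h y - T y z) - (h y - T y z'))"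
      using Bl[of "h y - T y z" "h y - T y z'"] by (simp add: c_eq z y)
    also have "(h y - T y z) - (h y - T y z') = - (T y z - T y z')" by simp
    also have "\<bar>p z - p z'\<bar> \<le> \<bar>L\<^sub>p\<bar> * dist z z'"
      using lipschitz_onD[OF B(3) z] mult_right_mono[OF abs_ge_self[of L\<^sub>p] zero_le_dist[of z z']]
      by (simp add: dist_real_def)
    also have "norm (- (T y z - T y z')) \<le> \<bar>bz\<bar> * dist z z'"
    proof -
      have "norm (T y z - T y z') \<le> L\<^sub>T\<^sub>z y * dist z z'"
        using lipschitz_onD[OF B(4)[OF y] z] by (simp add: dist_norm)
      also have "\<dots> \<le> \<bar>bz\<bar> * dist z z'" using bz_bd[OF y] by (intro mult_right_mono) auto
      finally show ?thesis by (simp add: norm_minus_commute)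
    qed
    finally have "\<bar>c z y - c z' y\<bar> \<le> \<bar>L\<^sub>p\<bar> * dist z z' + B * (\<bar>bz\<bar> * dist z z')"
      using B0 by (simp add: mult_left_mono)
    also have "\<dots> \<le> Lc * dist z z'" by (simp add: Lc_def algebra_simps)
    finally show ?thesis .
  qed

  obtain D0 where D0: "countable D0" "D0 \<subseteq> \<Z>" "\<Z> \<subseteq> closure D0" by (rule separable)
  let ?E = "{mu. mu extreme_point_of dual_feasible W c\<^sub>v}"
  have finE: "finite ?E" by (rule finite_extreme_points_dual_feasible)
  define sg where "sg x mu z \<longleftrightarrow> sub_gaussian P\<^sub>\<epsilon>
    (\<lambda>e. \<V> (f x + Q x *v e) mu z - (\<integral>e'. \<V> (f x + Q x *v e') mu z \<partial>P\<^sub>\<epsilon>)) ((\<sigma>\<^sub>c x)\<^sup>2)" for x mu z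
  \<comment> \<open>Each pair of a vertex and a point z has its own null set of x; finitely many
    vertices and the countable set D0 leave a common one.\<close>
  have "AE x in P\<^sub>X. \<forall>mu\<in>?E. \<forall>z\<in>D0. sg x mu z"
    using D(2) D0 finE unfolding sg_def \<Lambda>
    by (subst AE_ball_countable, simp add: countable_finite, intro ballI, subst AE_ball_countable) auto
  note AE_sg = this
  define GG where "GG = {x \<in> \<X>. \<forall>mu\<in>?E. \<forall>z\<in>D0. sg x mu z}"
  have AE_GG: "AE x in P\<^sub>X. x \<in> GG" using AE_X AE_sg by eventually_elim (simp add: GG_def)
  have GG: "GG \<subseteq> \<X>" "\<X> \<subseteq> closure GG"
    using support_of_subset_closure[OF sets_PX AE_sg] unfolding GG_def \<X> by auto
  define \<phi> where "\<phi> x z e = c z (f x + Q x *v e)" for x z e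
  have exp_mom: "(\<integral>\<^sup>+e. ennreal (exp \<bar>\<phi> x z e\<bar>) \<partial>P\<^sub>\<epsilon>) < \<infinity>" if x: "x \<in> GG" and z: "z \<in> D0" for x z
  proof (rule exp_moment_vertex_max[OF rank dual])
    show "\<exists>m v. sub_gaussian P\<^sub>\<epsilon> (\<lambda>e. mu \<bullet> (h (f x + Q x *v e) - T (f x + Q x *v e) z) - m) v"
      if "mu extreme_point_of dual_feasible W c\<^sub>v" for mu
      using x z that unfolding GG_def sg_def \<V> by blast
    show "AE e in P\<^sub>\<epsilon>. \<bar>\<phi> x z e\<bar> \<le> \<bar>p z\<bar> + \<bar>vertex_max W c\<^sub>v (h (f x + Q x *v e) - T (f x + Q x *v e) z)\<bar>"
      using S(2)
    proof eventually_elim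
      case (elim e)
      have "f x + Q x *v e \<in> \<Y>" using S(3)[OF elim] x GG by blast
      then show ?case unfolding \<phi>_def using c_eq[of z "f x + Q x *v e"] z D0 by auto
    qed
  qed
  interpret R: residual_process M P\<^sub>\<epsilon> err \<Z> D0 \<X> GG S \<phi> Lc
  proof
    show "M.indep_vars (\<lambda>_. borel) err UNIV" by (rule E(1))
    show "distr M borel (err i) = P\<^sub>\<epsilon>" for i by (rule distr_err)
    have "integrable (distr N borel \<epsilon>) norm"
      using \<epsilon>_mean(1) by (subst integrable_distr_eq) auto
    then show "integrable P\<^sub>\<epsilon> norm" by (simp add: P\<^sub>\<epsilon>)
    show "\<phi> x z \<in> borel_measurable borel" if "x \<in> \<X>" "z \<in> \<Z>" for x z
      unfolding \<phi>_def using c_meas[OF that(2)] by measurable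
    show "\<bar>\<phi> x z e - \<phi> x z' e\<bar> \<le> Lc * dist z z'" if "x \<in> \<X>" "z \<in> \<Z>" "z' \<in> \<Z>" "e \<in> S" for x z z' e
      unfolding \<phi>_def using that S(3) by (intro c_lip_z) auto
    show "\<exists>\<delta>>0. \<forall>x\<in>\<X>. \<forall>x'\<in>\<X>. dist x x' < \<delta> \<longrightarrow> (\<forall>z\<in>\<Z>. \<forall>e\<in>S. \<bar>\<phi> x z e - \<phi> x' z e\<bar> \<le> \<eta> * (1 + norm e))"
      if \<eta>: "0 < \<eta>" for \<eta>
    proof -
      \<comment> \<open>One Lipschitz constant in y for all z, made positive so that \<eta> can be
        divided by it.\<close>
      define LY where "LY = \<bar>B * (L\<^sub>h + bY)\<bar> + 1"
      have LY: "0 < LY" unfolding LY_def by (simp add: add_nonneg_pos)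
      have "0 < \<eta> / LY" using \<eta> LY by simp
      from uniformly_small_matrix_perturbation[OF C(1,2,3) this] obtain \<delta> where \<delta>: "\<delta> > 0"
        "\<And>x x' e. x \<in> \<X> \<Longrightarrow> x' \<in> \<X> \<Longrightarrow> dist x x' < \<delta> \<Longrightarrow>
          norm ((f x + Q x *v e) - (f x' + Q x' *v e)) \<le> \<eta> / LY * (1 + norm e)" by blast
      have "\<bar>\<phi> x z e - \<phi> x' z e\<bar> \<le> \<eta> * (1 + norm e)"
        if x: "x \<in> \<X>" "x' \<in> \<X>" "dist x x' < \<delta>" and z: "z \<in> \<Z>" and e: "e \<in> S" for x x' z e
      proof -
        have "\<bar>\<phi> x z e - \<phi> x' z e\<bar> \<le> Ly z * norm ((f x + Q x *v e) - (f x' + Q x' *v e))"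
          unfolding \<phi>_def using x z e S(3) by (intro c_lip_y) auto
        also have "\<dots> \<le> LY * (\<eta> / LY * (1 + norm e))"
          using \<delta>(2)[OF x] Ly_le[OF z] LY by (intro mult_mono) (auto simp: LY_def)
        also have "\<dots> = \<eta> * (1 + norm e)" using LY by simp
        finally show ?thesis .
      qed
      then show ?thesis using \<delta>(1) by blast
    qed
  qed (fact A(1,2) C(1) D0(2,3) GG S(1,2) Lc exp_mom)+
  have \<gamma>: "R.\<gamma> x z = g z x" for x z by (simp add: R.\<gamma>_def g \<phi>_def)
  have \<gamma>n: "R.\<gamma>n n \<omega> x z = gn n \<omega> z x" for n \<omega> x z by (simp add: R.\<gamma>n_def gn \<phi>_def)
  note consistency = R.uniform_consistency[unfolded \<gamma> \<gamma>n]
  have dev_le: "dev n \<omega> x \<le> ennreal \<kappa>" if "\<forall>z\<in>\<Z>. \<bar>gn n \<omega> z x - g z x\<bar> \<le> \<kappa>" for n \<omega> x \<kappa>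
    unfolding dev using that by (intro SUP_least ennreal_leI) auto

  have i: "\<exists>L. (\<forall>z\<in>\<Z>. \<forall>y\<in>\<Y>. \<forall>y'\<in>\<Y>. \<bar>c z y' - c z y\<bar> \<le> L z * norm (y' - y)) \<and> bdd_above (L ` \<Z>)"
    using c_lip_y Ly_le by (intro exI[of _ Ly]) (auto intro!: bdd_aboveI2)

  \<comment> \<open>The event of uniform consistency does not depend on x, so this holds on the
    whole support and not only on GG.\<close>
  have ii: "tends_to_0_in_prob M (\<lambda>n \<omega>. dev n \<omega> x)" if x: "x \<in> \<X>" for x
  proof (rule tends_to_0_in_probI[OF M.prob_space_axioms])
    fix e \<tau> :: real assume "0 < e" "0 < \<tau>"
    from consistency[OF this] obtain n0 where n0: "\<forall>n\<ge>n0. \<exists>E\<in>sets M. R.bad \<subseteq> E \<and> M.prob E \<le> \<tau> \<and>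
      (\<forall>\<omega>\<in>space M - E. \<forall>x\<in>\<X>. \<forall>z\<in>\<Z>. \<bar>gn n \<omega> z x - g z x\<bar> \<le> e)" by (elim exE)
    have "\<exists>E\<in>sets M. M.prob E \<le> \<tau> \<and> {\<omega> \<in> space M. ennreal e < dev n \<omega> x} \<subseteq> E" if "n \<ge> n0" for n
    proof -
      from n0[rule_format, OF that] obtain E where E: "E \<in> sets M" "M.prob E \<le> \<tau>"
        "\<forall>\<omega>\<in>space M - E. \<forall>x\<in>\<X>. \<forall>z\<in>\<Z>. \<bar>gn n \<omega> z x - g z x\<bar> \<le> e" by (elim bexE conjE)
      have "dev n \<omega> x \<le> ennreal e" if "\<omega> \<in> space M - E" for \<omega>
        using E(3) that x by (intro dev_le) blast
      then show ?thesis using E(1,2) by (intro bexI[of _ E]) (auto simp: not_less[symmetric])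
    qed
    then show "\<exists>n0. \<forall>n\<ge>n0. \<exists>E\<in>sets M. M.prob E \<le> \<tau> \<and> {\<omega> \<in> space M. ennreal e < dev n \<omega> x} \<subseteq> E" by blast
  qed

  have X_closed: "closed \<X>" using C(1) by (rule compact_imp_closed)
  have X_sets: "\<X> \<in> sets P\<^sub>X" unfolding sets_PX using X_closed by (rule borel_closed)
  have space_rX: "space (restrict_space P\<^sub>X \<X>) = \<X>"
    by (simp add: space_restrict_space P\<^sub>X)
  have prob_rX: "prob_space (restrict_space P\<^sub>X \<X>)"
  proof
    have "emeasure P\<^sub>X \<X> = 1" using AE_X X_sets by (simp add: PX.emeasure_eq_1_AE)
    then show "emeasure (restrict_space P\<^sub>X \<X>) (space (restrict_space P\<^sub>X \<X>)) = 1"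
      using X_sets by (simp add: space_rX emeasure_restrict_space)
  qed
  \<comment> \<open>For fixed data g is measurable in x as a parameter integral, and on the support
    the supremum reduces to the countable set D0.\<close>
  have dev_meas: "dev n \<omega> \<in> borel_measurable (restrict_space P\<^sub>X \<X>)" if \<omega>: "\<omega> \<in> space M - R.bad" for n \<omega>
  proof -
    have m: "(\<lambda>x. ennreal \<bar>gn n \<omega> z x - g z x\<bar>) \<in> borel_measurable P\<^sub>X" if z: "z \<in> D0" for z
    proof -
      have [measurable]: "c z \<in> borel_measurable borel" using c_meas z D0(2) by blast
      have [measurable_cong]: "sets P\<^sub>\<epsilon> = sets borel" "sets P\<^sub>X = sets borel" by (fact sets_P\<epsilon> sets_PX)+
      have [measurable]: "g z \<in> borel_measurable P\<^sub>X" unfolding g by measurable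
      have [measurable]: "gn n \<omega> z \<in> borel_measurable P\<^sub>X" unfolding gn by measurable
      show ?thesis by measurable
    qed
    have "(\<lambda>x. SUP z\<in>D0. ennreal \<bar>gn n \<omega> z x - g z x\<bar>) \<in> borel_measurable (restrict_space P\<^sub>X \<X>)"
      using D0(1) m by (intro borel_measurable_SUP measurable_restrict_space1) auto
    moreover have "dev n \<omega> x = (SUP z\<in>D0. ennreal \<bar>gn n \<omega> z x - g z x\<bar>)" if "x \<in> space (restrict_space P\<^sub>X \<X>)" for x
      using R.SUP_dev_eq_dense[OF _ \<omega>, of x n] that unfolding space_rX dev \<gamma> \<gamma>n by simp
    ultimately show ?thesis by (subst measurable_cong)
  qed
  \<comment> \<open>On the good event the deviation is at most e for all x in the support, and on a
    probability space a constant bound passes to every norm of order q, the essential supremum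
    included.\<close>
  have iii: "tends_to_0_in_prob M (\<lambda>n \<omega>. Lq_norm (restrict_space P\<^sub>X \<X>) q (dev n \<omega>))" if q: "q \<ge> 1" for q
  proof (rule tends_to_0_in_probI[OF M.prob_space_axioms])
    fix e \<tau> :: real assume e: "0 < e" and \<tau>: "0 < \<tau>"
    from consistency[OF e \<tau>] obtain n0 where n0: "\<forall>n\<ge>n0. \<exists>E\<in>sets M. R.bad \<subseteq> E \<and> M.prob E \<le> \<tau> \<and>
      (\<forall>\<omega>\<in>space M - E. \<forall>x\<in>\<X>. \<forall>z\<in>\<Z>. \<bar>gn n \<omega> z x - g z x\<bar> \<le> e)" by (elim exE)
    have "\<exists>E\<in>sets M. M.prob E \<le> \<tau> \<and> {\<omega> \<in> space M. ennreal e < Lq_norm (restrict_space P\<^sub>X \<X>) q (dev n \<omega>)} \<subseteq> E"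
      if "n \<ge> n0" for n
    proof -
      from n0[rule_format, OF that] obtain E where E: "E \<in> sets M" "R.bad \<subseteq> E" "M.prob E \<le> \<tau>"
        "\<forall>\<omega>\<in>space M - E. \<forall>x\<in>\<X>. \<forall>z\<in>\<Z>. \<bar>gn n \<omega> z x - g z x\<bar> \<le> e" by (elim bexE conjE)
      have "Lq_norm (restrict_space P\<^sub>X \<X>) q (dev n \<omega>) \<le> ennreal e" if \<omega>: "\<omega> \<in> space M - E" for \<omega>
      proof (rule Lq_norm_le_const[OF prob_rX _ _ q])
        show "dev n \<omega> \<in> borel_measurable (restrict_space P\<^sub>X \<X>)" using \<omega> E(2) by (intro dev_meas) blast
        show "dev n \<omega> x \<le> ennreal e" if "x \<in> space (restrict_space P\<^sub>X \<X>)" for x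
          using E(4) \<omega> that unfolding space_rX by (intro dev_le) blast
      qed (use e in simp)
      then show ?thesis using E(1,3) by (intro bexI[of _ E]) (auto simp: not_less[symmetric])
    qed
    then show "\<exists>n0. \<forall>n\<ge>n0. \<exists>E\<in>sets M. M.prob E \<le> \<tau> \<and>
      {\<omega> \<in> space M. ennreal e < Lq_norm (restrict_space P\<^sub>X \<X>) q (dev n \<omega>)} \<subseteq> E" by blast
  qed

  have iv: "\<exists>K>0. \<exists>\<beta>>0. \<forall>n\<ge>1. outer_measure_of M {\<omega> \<in> space M. ennreal \<kappa> < dev n \<omega> x}
    \<le> ennreal (K * exp (- real n * \<beta>))"
    if x: "x \<in> GG" and \<kappa>: "0 < \<kappa>" for x \<kappa>
  proof -
    from R.pointwise_chernoff[OF x \<kappa>, unfolded \<gamma> \<gamma>n] obtain K \<beta> where K: "K > 0" "\<beta> > 0" and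
      KE: "\<forall>n>0. \<exists>E\<in>sets M. R.bad \<subseteq> E \<and> M.prob E \<le> K * exp (- real n * \<beta>) \<and>
        (\<forall>\<omega>\<in>space M - E. \<forall>z\<in>\<Z>. \<bar>gn n \<omega> z x - g z x\<bar> \<le> \<kappa>)" by (elim exE conjE)
    have "outer_measure_of M {\<omega> \<in> space M. ennreal \<kappa> < dev n \<omega> x} \<le> ennreal (K * exp (- real n * \<beta>))" if n:
      "n \<ge> 1" for n
    proof -
      have "0 < n" using n by simp
      from KE[rule_format, OF this] obtain E where E: "E \<in> sets M" "M.prob E \<le> K * exp (- real n * \<beta>)"
        "\<forall>\<omega>\<in>space M - E. \<forall>z\<in>\<Z>. \<bar>gn n \<omega> z x - g z x\<bar> \<le> \<kappa>" by (elim bexE conjE)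
      have "dev n \<omega> x \<le> ennreal \<kappa>" if "\<omega> \<in> space M - E" for \<omega>
        using E(3) that by (intro dev_le) blast
      then have "{\<omega> \<in> space M. ennreal \<kappa> < dev n \<omega> x} \<subseteq> E" by (auto simp: not_less[symmetric])
      then have "outer_measure_of M {\<omega> \<in> space M. ennreal \<kappa> < dev n \<omega> x} \<le> emeasure M E"
        using E(1) by (rule outer_measure_of_le)
      also have "\<dots> \<le> ennreal (K * exp (- real n * \<beta>))"
        unfolding M.emeasure_eq_measure using E(2) by (rule ennreal_leI)
      finally show ?thesis .
    qed
    then show ?thesis using K by blast
  qed

  have v: "restrict (\<lambda>z. g z x) \<Z> \<in> mspace (C_space \<Z>) \<and>
        (\<forall>n\<ge>1. \<exists>G. random_element_version M (mtopology_of (C_space \<Z>))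
                      (\<lambda>\<omega>. restrict (\<lambda>z. gn n \<omega> z x) \<Z>) G) \<and>
        (\<exists>(N' :: (real^'dz \<Rightarrow> real) measure) V_lim. prob_space N' \<and>
          tends_in_distribution M (mtopology_of (C_space \<Z>))
            (\<lambda>n \<omega>. restrict (\<lambda>z. sqrt (real n) * (gn n \<omega> z x - g z x)) \<Z>) N' V_lim)"
    if x: "x \<in> GG" for x
  proof (intro conjI allI impI)
    have xX: "x \<in> \<X>" using x GG by blast
    show "restrict (\<lambda>z. g z x) \<Z> \<in> mspace (C_space \<Z>)"
      using R.\<gamma>_in_C_space[OF xX] unfolding \<gamma>[abs_def] .
    show "\<exists>G. random_element_version M (mtopology_of (C_space \<Z>)) (\<lambda>\<omega>. restrict (\<lambda>z. gn n \<omega> z x) \<Z>) G" for n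
      using R.\<gamma>n_version[OF xX D0(1), of n] unfolding \<gamma>n[abs_def] .
    show "\<exists>(N' :: (real^'dz \<Rightarrow> real) measure) V_lim. prob_space N' \<and>
          tends_in_distribution M (mtopology_of (C_space \<Z>))
            (\<lambda>n \<omega>. restrict (\<lambda>z. sqrt (real n) * (gn n \<omega> z x - g z x)) \<Z>) N' V_lim"
      using R.functional_clt[OF x] unfolding \<gamma> \<gamma>n .
  qed
  show ?thesis
  proof (intro conjI allI impI)
    show "AE x in P\<^sub>X. tends_to_0_in_prob M (\<lambda>n \<omega>. dev n \<omega> x)"
      using AE_X by eventually_elim (rule ii)
    show "AE x in P\<^sub>X. \<exists>K>0. \<exists>\<beta>>0. \<forall>n\<ge>1.
        outer_measure_of M {\<omega> \<in> space M. ennreal \<kappa> < dev n \<omega> x} \<le> ennreal (K * exp (- real n * \<beta>))" if "0 < \<kappa>" for \<kappa>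
      using AE_GG by eventually_elim (rule iv[OF _ that])
    show "AE x in P\<^sub>X. restrict (\<lambda>z. g z x) \<Z> \<in> mspace (C_space \<Z>) \<and>
        (\<forall>n\<ge>1. \<exists>G. random_element_version M (mtopology_of (C_space \<Z>))
                      (\<lambda>\<omega>. restrict (\<lambda>z. gn n \<omega> z x) \<Z>) G) \<and>
        (\<exists>(N' :: (real^'dz \<Rightarrow> real) measure) V_lim. prob_space N' \<and>
          tends_in_distribution M (mtopology_of (C_space \<Z>))
            (\<lambda>n \<omega>. restrict (\<lambda>z. sqrt (real n) * (gn n \<omega> z x - g z x)) \<Z>) N' V_lim)"
      using AE_GG by eventually_elim (rule v)
  qed (fact i iii)+
qed

end
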